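(* Let $N\ge 1$ be an integer and let $0<m<1$, $\sigma>0$ and $1<p<p_L(\sigma)$. Consider the equation $u_t=\Delta u^m+|x|^{\sigma}u^p$ in $\mathbb{R}^N\times(0,\infty)$ and its self-similar solutions of the form $$u(x,t)=t^{\alpha}f(|x|t^{\beta}).$$ (1) Let $N\geq 3$, $m\in(0,m_s)$ and $\max\{1,p_s(\sigma)\}<p<p_L(\sigma)$. Then there exist self-similar solutions of this form whose profiles $f$ satisfy $$f(\xi)\sim\left[D-\frac{\alpha(1-m)}{2mN}\xi^2\right]^{-1/(1-m)}\ \text{as }\xi\to0,\qquad f(\xi)\sim C\xi^{-(N-2)/m}\ \text{as }\xi\to\infty,$$ for some constants $C,D>0$. (2) Let $N\geq 3$, $m\in(0,m_s)$ and $\max\{1,p_s(\sigma)\}<p<p_L(\sigma)$. Then there also exist self-similar solutions of this form whose profiles $f$ satisfy $$f(\xi)\sim\left[D-\frac{\alpha(1-m)}{2mN}\xi^2\right]^{-1/(1-m)}\ \text{as }\xi\to0,\qquad f(\xi)\sim C\xi^{-(\sigma+2)/(p-m)}\ \text{as }\xi\to\infty,$$ for some constants $C,D>0$. (3) If at least one of the conditions $m\in[m_s,1)$, $N\in\{1,2\}$, or $1<p<p_s(\sigma)$ is fulfilled, then there is no self-similar solution of this form.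
   Context: Notation: $p_L(\sigma)=1+\frac{\sigma(1-m)}{2}$; $m_s=\frac{N-2}{N+2}$; $p_s(\sigma)=\frac{m(N+2\sigma+2)}{N-2}$ if $N\ge3$, and $p_s(\sigma)=+\infty$ by convention if $N\in\{1,2\}$; $L=\sigma(m-1)+2(p-1)$, which is negative since $p<p_L(\sigma)$; $$\alpha=-\frac{\sigma+2}{L}>0,\qquad \beta=-\frac{p-m}{L}>0.$$ A self-similar solution of the form $u(x,t)=t^{\alpha}f(|x|t^{\beta})$ means one whose profile $f:[0,\infty)\to[0,\infty)$, $f=f(\xi)$ with $\xi=|x|t^\beta$, is a non-negative function with $f(0)=A>0$, $f'(0)=0$, such that $f^m$ is of class $C^1$ on $(0,\infty)$ (so that at any point $\xi_0\in(0,\infty)$ where $f$ vanishes, the interface condition $(f^m)'(\xi_0)=0$ holds) and which solves, wherever it is positive, $$(f^m)''(\xi)+\frac{N-1}{\xi}(f^m)'(\xi)-\alpha f(\xi)-\beta\xi f'(\xi)+\xi^{\sigma}f^p(\xi)=0 .$$ The behavior as $\xi\to0$ written above is understood as the expansion $f(\xi)^{m-1}=D-\frac{\alpha(1-m)}{2mN}\xi^2+o(\xi^2)$; the notation $f\sim g$ as $\xi\to\infty$ means $f/g\to1$. *)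

theory Defs
  imports "HOL-Analysis.Analysis" "HOL-Library.Landau_Symbols"
begin

definition p_L :: "real \<Rightarrow> real \<Rightarrow> real" where
  "p_L m \<sigma> = 1 + \<sigma> * (1 - m) / 2"

definition m_s :: "nat \<Rightarrow> real" where
  "m_s N = (real N - 2) / (real N + 2)"

definition p_s :: "nat \<Rightarrow> real \<Rightarrow> real \<Rightarrow> ereal" where
  "p_s N m \<sigma> =
     (if N \<ge> 3 then ereal (m * (real N + 2 * \<sigma> + 2) / (real N - 2)) else \<infinity>)"

definition L_exp :: "real \<Rightarrow> real \<Rightarrow> real \<Rightarrow> real" where
  "L_exp m \<sigma> p = \<sigma> * (m - 1) + 2 * (p - 1)"

definition alpha :: "real \<Rightarrow> real \<Rightarrow> real \<Rightarrow> real" where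
  "alpha m \<sigma> p = - (\<sigma> + 2) / L_exp m \<sigma> p"

definition beta :: "real \<Rightarrow> real \<Rightarrow> real \<Rightarrow> real" where
  "beta m \<sigma> p = - (p - m) / L_exp m \<sigma> p"

text \<open>
  Only the values of a profile on \<open>[0,\<infinity>)\<close> matter: the derivative at \<open>0\<close> is one-sided, and all
  other derivatives are taken at points of the open half-line. No condition besides
  \<open>C\<^sup>1\<close>-regularity of \<open>f\<^sup>m\<close> is imposed at the zeros of \<open>f\<close>; the interface condition there is a
  consequence (lemma \<open>is_profile_interface\<close>).
\<close>
definition is_profile ::
    "nat \<Rightarrow> real \<Rightarrow> real \<Rightarrow> real \<Rightarrow> (real \<Rightarrow> real) \<Rightarrow> bool" where
  "is_profile N m \<sigma> p f \<longleftrightarrow>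
     (\<forall>\<xi>\<ge>0. f \<xi> \<ge> 0) \<and>
     f 0 > 0 \<and>
     (f has_real_derivative 0) (at 0 within {0..}) \<and>
     (\<lambda>\<xi>. f \<xi> powr m) C1_differentiable_on {0<..} \<and>
     (\<forall>\<xi>>0. f \<xi> > 0 \<longrightarrow>
        f differentiable (at \<xi>) \<and>
        deriv (\<lambda>\<xi>. f \<xi> powr m) differentiable (at \<xi>) \<and>
        deriv (deriv (\<lambda>\<xi>. f \<xi> powr m)) \<xi>
          + (real N - 1) / \<xi> * deriv (\<lambda>\<xi>. f \<xi> powr m) \<xi>
          - alpha m \<sigma> p * f \<xi> - beta m \<sigma> p * \<xi> * deriv f \<xi>
          + \<xi> powr \<sigma> * f \<xi> powr p = 0)"

text \<open>
  For \<open>u\<close> of this form, the equation in \<open>is_profile\<close> is what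
  \<open>u\<^sub>t = \<Delta>u\<^sup>m + |x|\<^sup>\<sigma> u\<^sup>p\<close> becomes in the variable \<open>\<xi> = |x| t\<^sup>\<beta>\<close>. The dimension of the space is
  \<open>CARD('n)\<close>.
\<close>
definition self_similar_solution ::
    "real \<Rightarrow> real \<Rightarrow> real \<Rightarrow> (real \<Rightarrow> real) \<Rightarrow> (real ^ 'n \<Rightarrow> real \<Rightarrow> real) \<Rightarrow> bool" where
  "self_similar_solution m \<sigma> p f u \<longleftrightarrow>
     is_profile CARD('n) m \<sigma> p f \<and>
     (\<forall>x. \<forall>t>0. u x t = t powr alpha m \<sigma> p * f (norm x * t powr beta m \<sigma> p))"

text \<open>
  The relation \<open>f(\<xi>) \<sim> [D - \<alpha>(1-m)/(2mN) \<xi>\<^sup>2]\<close> to the power \<open>-1/(1-m)\<close> as \<open>\<xi> \<rightarrow> 0\<close> is a second-order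
  expansion of \<open>f\<close> to the power \<open>m-1\<close>; read as \<open>f/g \<rightarrow> 1\<close> it would only fix \<open>f(0)\<close>.
\<close>
definition behavior_at_0 ::
    "nat \<Rightarrow> real \<Rightarrow> real \<Rightarrow> real \<Rightarrow> real \<Rightarrow> (real \<Rightarrow> real) \<Rightarrow> bool" where
  "behavior_at_0 N m \<sigma> p D f \<longleftrightarrow>
     (\<lambda>\<xi>. f \<xi> powr (m - 1) - (D - alpha m \<sigma> p * (1 - m) / (2 * m * real N) * \<xi>\<^sup>2))
       \<in> o[at_right 0](\<lambda>\<xi>. \<xi>\<^sup>2)"

lemma is_profile_interface:
  assumes "is_profile N m \<sigma> p f" "\<xi> > 0" "f \<xi> = 0"
  shows "((\<lambda>\<xi>. f \<xi> powr m) has_real_derivative 0) (at \<xi>)"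
proof -
  let ?g = "\<lambda>\<xi>. f \<xi> powr m"
  obtain d where d: "(?g has_real_derivative d) (at \<xi>)"
    using assms(1,2) unfolding is_profile_def C1_differentiable_on_def
    by (force simp: has_real_derivative_iff_has_vector_derivative)
  have "?g \<xi> \<le> ?g y" for y
    using assms(3) by simp
  then have "d = 0"
    using DERIV_local_min[OF d, of 1] by simp
  then show ?thesis
    using d by simp
qed

end

theory Submission
  imports Defs
begin

text \<open>
  Put \<open>\<theta> = (\<sigma> + 2) / (p - m) = \<alpha> / \<beta>\<close>. For \<open>\<xi> = exp s\<close> and \<open>V = (\<xi> powr \<theta> * f) powr m\<close> the profile equation becomes
  \<open>V'' + c V' - K V + V powr q = \<beta> exp (- s / \<beta>) (V powr (1 / m))'\<close> with \<open>q = p / m\<close>: an autonomous Emden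
  equation apart from a drift that vanishes as \<open>s \<rightarrow> \<infinity>\<close>. The energy \<open>E\<close> of the Emden equation satisfies
  \<open>E' = (V')\<^sup>2 (h V powr (1 / m - 1) - c)\<close> with \<open>h > 0\<close>, and the sign of \<open>c\<close> is that of \<open>p - p_s\<close>.

  If \<open>c < 0\<close>, the energy increases strictly from its value \<open>0\<close> at \<open>\<xi> = 0\<close>. At an interface it would have to
  vanish again, and without interface positivity of \<open>E\<close> makes \<open>V\<close> eventually monotone, which leads either to
  an equilibrium of positive energy or to blow-up. So there is no profile.

  If \<open>c > 0\<close>, shoot with \<open>f(0)\<close>. For small \<open>f(0)\<close> the drift never beats the damping, so the energy becomes
  negative and \<open>V\<close> is trapped and converges to the positive equilibrium: these are the profiles of (2), and
  they form an open set. For large \<open>f(0)\<close> the solution exceeds a level \<open>H\<close> from which no return without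
  crossing \<open>0\<close> is possible. A boundary value of the open set stays in \<open>(0, H)\<close> with nonnegative
  energy, hence \<open>V \<rightarrow> 0\<close>, and the Riccati equation of \<open>V' / V\<close> gives the decay rate in (1).
\<close>

section \<open>Real functions on a half-line\<close>

text \<open>Everything is done for \<open>v = f powr m\<close>: its equation has the powers 1 / m
  and p / m, both above 1, hence locally Lipschitz even at \<open>v = 0\<close>. The obstacles are
  the singular point \<xi> = 0, possible blow-up and loss of positivity. The integrated equation
  with \<open>v\<close> clamped to an interval [0, M] meets all three: its solutions are global,
  depend continuously on \<open>v 0\<close>, and solve the true equation as long as they stay inside
  (0, M). Shooting only controls \<open>V\<close>, and a bound on \<open>V\<close> says nothing
  about \<open>v\<close> near \<xi> = 0. The gap is closed by an initial interval on which every
  solution increases, the same for all initial values. Its length must be small in terms of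
  \<open>M\<close>, which in turn depends on that length; the powers combine to the exponent 1 /
  \<beta>, so this is no vicious circle. The positivity of 1 / \<beta> is the hypothesis p < p_L,
  and it is also what makes the drift transient. The case m \<ge> m_s belongs to
  \<open>c < 0\<close> because for N \<ge> 3 it forces p < p_s once p < p_L.\<close>

lemma eventually_at_topE:
  fixes Q :: "real \<Rightarrow> bool"
  assumes "eventually Q at_top"
  obtains s1 where "s1 \<ge> a" "\<And>s. s \<ge> s1 \<Longrightarrow> Q s"
proof -
  obtain N where N: "\<forall>s\<ge>N. Q s"
    using assms by (auto simp: eventually_at_top_linorder)
  show thesis
    by (rule that[of "max N a"]) (use N in auto)
qed

lemma deriv_bound_above:
  fixes f :: "real \<Rightarrow> real"
  assumes "a \<le> b" "\<And>x. a \<le> x \<Longrightarrow> x \<le> b \<Longrightarrow> (f has_real_derivative f' x) (at x)"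
    and "\<And>x. a \<le> x \<Longrightarrow> x \<le> b \<Longrightarrow> f' x \<le> k"
  shows "f b \<le> f a + k * (b - a)"
proof -
  have "f b - k * b \<le> f a - k * a"
  proof (rule DERIV_nonpos_imp_nonincreasing[OF assms(1), of "\<lambda>x. f x - k * x"])
    fix x assume "a \<le> x" "x \<le> b"
    then have "((\<lambda>x. f x - k * x) has_real_derivative f' x - k * 1) (at x)"
      by (intro DERIV_diff DERIV_cmult DERIV_ident assms(2))
    then show "\<exists>y. ((\<lambda>x. f x - k * x) has_real_derivative y) (at x) \<and> y \<le> 0"
      using assms(3)[OF \<open>a \<le> x\<close> \<open>x \<le> b\<close>] by (intro exI[of _ "f' x - k * 1"]) auto
  qed
  then show ?thesis by (simp add: algebra_simps)
qed

lemma deriv_bound_below: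
  fixes f :: "real \<Rightarrow> real"
  assumes "a \<le> b" "\<And>x. a \<le> x \<Longrightarrow> x \<le> b \<Longrightarrow> (f has_real_derivative f' x) (at x)"
    and "\<And>x. a \<le> x \<Longrightarrow> x \<le> b \<Longrightarrow> k \<le> f' x"
  shows "f a + k * (b - a) \<le> f b"
proof -
  have "- f b \<le> - f a + (-k) * (b - a)"
    using assms(2,3) by (intro deriv_bound_above[OF assms(1), where f' = "\<lambda>x. - f' x"] DERIV_minus) auto
  then show ?thesis by simp
qed

lemma deriv_nonpos_antimono:
  fixes f :: "real \<Rightarrow> real"
  assumes "a \<le> b" "\<And>x. a \<le> x \<Longrightarrow> x \<le> b \<Longrightarrow> (f has_real_derivative f' x) (at x)"
    and "\<And>x. a \<le> x \<Longrightarrow> x \<le> b \<Longrightarrow> f' x \<le> 0"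
  shows "f b \<le> f a"
  using deriv_bound_above[OF assms] by simp

lemma deriv_nonneg_mono:
  fixes f :: "real \<Rightarrow> real"
  assumes "a \<le> b" "\<And>x. a \<le> x \<Longrightarrow> x \<le> b \<Longrightarrow> (f has_real_derivative f' x) (at x)"
    and "\<And>x. a \<le> x \<Longrightarrow> x \<le> b \<Longrightarrow> 0 \<le> f' x"
  shows "f a \<le> f b"
  using deriv_bound_below[OF assms] by simp

text \<open>A function whose derivative is negative at each of its zeros cannot come back to zero
  from below: at the last point with \<open>f\<close> \<le> 0 before a positive value it would
  vanish and yet be negative just to the right. This controls the signs of the velocity and of the
  Riccati variable.\<close>

lemma negative_after_downcrossing:
  fixes f :: "real \<Rightarrow> real"
  assumes der: "\<And>x. a \<le> x \<Longrightarrow> x \<le> b \<Longrightarrow> (f has_real_derivative f' x) (at x)"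
    and down: "\<And>x. a \<le> x \<Longrightarrow> x \<le> b \<Longrightarrow> f x = 0 \<Longrightarrow> f' x < 0"
    and "f a \<le> 0" "a < s" "s \<le> b"
  shows "f s < 0"
proof (rule ccontr)
  have not_pos: False if s: "a < s" "s \<le> b" "f s > 0" for s
  proof -
    define T where "T = {x \<in> {a..s}. f x \<le> 0}"
    have cont: "continuous_on {a..s} f"
    proof (rule DERIV_atLeastAtMost_imp_continuous_on)
      fix x assume "a \<le> x" "x \<le> s"
      then show "\<exists>y. (f has_real_derivative y) (at x)"
        using der[of x] s by auto
    qed
    have "closed T"
      unfolding T_def using cont by (intro continuous_on_closed_Collect_le) auto
    then have "compact ({a..s} \<inter> T)"
      by (intro compact_Int_closed) auto
    moreover have "{a..s} \<inter> T = T"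
      by (auto simp: T_def)
    ultimately have "compact T"
      by simp
    moreover have "a \<in> T"
      using assms(3) s by (auto simp: T_def)
    ultimately obtain t where t: "t \<in> T" "\<And>x. x \<in> T \<Longrightarrow> x \<le> t"
      using compact_attains_sup[of T] by blast
    have "t < s" using t(1) s(3) by (cases "t = s") (auto simp: T_def)
    have pos: "f x > 0" if "t < x" "x \<le> s" for x
    proof (rule ccontr)
      assume "\<not> f x > 0"
      then have "x \<in> T" using that t(1) by (auto simp: T_def)
      then show False using t(2)[of x] that by simp
    qed
    have "f t = 0"
    proof (rule ccontr)
      assume "f t \<noteq> 0"
      then have "f t < 0" using t(1) by (auto simp: T_def)
      moreover have "continuous_on {t..s} f"
        using t(1) by (intro continuous_on_subset[OF cont]) (auto simp: T_def)
      ultimately obtain x where "t \<le> x" "x \<le> s" "f x = 0"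
        using IVT'[OF less_imp_le less_imp_le less_imp_le, of f t 0 s] s(3) \<open>t < s\<close> by blast
      moreover have "x \<noteq> t" using \<open>f t < 0\<close> \<open>f x = 0\<close> by auto
      ultimately show False using pos[of x] by simp
    qed
    have "a \<le> t" "t \<le> b" using t(1) s by (auto simp: T_def)
    with DERIV_neg_dec_right[OF der[of t] down[of t]] \<open>f t = 0\<close>
    obtain d where d: "d > 0" "\<And>h. 0 < h \<Longrightarrow> h < d \<Longrightarrow> f (t + h) < f t"
      by auto
    define h where "h = min (d/2) (s - t)"
    have h: "0 < h" "h < d" "h \<le> s - t"
      using \<open>d > 0\<close> \<open>t < s\<close> unfolding h_def by linarith+
    show False
      using d(2)[OF h(1,2)] pos[of "t + h"] h \<open>f t = 0\<close> by simp
  qed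
  assume "\<not> f s < 0"
  moreover have "\<not> f s > 0"
    using not_pos[OF \<open>a < s\<close> \<open>s \<le> b\<close>] by blast
  ultimately have "f s = 0" by simp
  with DERIV_neg_dec_left[OF der[of s] down[of s]] \<open>a < s\<close> \<open>s \<le> b\<close>
  obtain d where d: "d > 0" "\<And>h. 0 < h \<Longrightarrow> h < d \<Longrightarrow> f s < f (s - h)"
    by auto
  define h where "h = min (d/2) ((s - a)/2)"
  have "0 < h"
    using \<open>d > 0\<close> \<open>a < s\<close> by (simp add: h_def)
  moreover have "h \<le> d/2" "h \<le> (s - a)/2"
    unfolding h_def by (rule min.cobounded1, rule min.cobounded2)
  ultimately have h: "0 < h" "h < d" "a < s - h"
    using \<open>d > 0\<close> \<open>a < s\<close> by simp_all
  show False
    using d(2)[OF h(1,2)] not_pos[of "s - h"] h \<open>s \<le> b\<close> \<open>f s = 0\<close> by simp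
qed

text \<open>Provides the first exit point for continuation arguments: the set where \<open>f\<close>
  is nonpositive is compact and has a minimum. That may be \<open>a\<close> itself, which is
  excluded where necessary by the sign of \<open>f a\<close>.\<close>

lemma first_nonpositive:
  fixes f :: "real \<Rightarrow> real"
  assumes "continuous_on {a..b} f" "a \<le> b" "f b \<le> 0"
  shows "\<exists>y\<in>{a..b}. f y \<le> 0 \<and> (\<forall>x. a \<le> x \<longrightarrow> x < y \<longrightarrow> 0 < f x)"
proof -
  define Z where "Z = {x \<in> {a..b}. f x \<le> 0}"
  have "closed Z"
    unfolding Z_def by (intro continuous_on_closed_Collect_le assms(1) continuous_intros)
  then have "compact ({a..b} \<inter> Z)"
    by (intro compact_Int_closed) auto
  moreover have "{a..b} \<inter> Z = Z" by (auto simp: Z_def)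
  moreover have "b \<in> Z" using assms by (simp add: Z_def)
  ultimately obtain y where y: "y \<in> Z" "\<And>x. x \<in> Z \<Longrightarrow> y \<le> x"
    using compact_attains_inf[of Z] by auto
  have "0 < f x" if "a \<le> x" "x < y" for x
  proof (rule ccontr)
    assume "\<not> 0 < f x"
    then have "x \<in> Z" using that y(1) by (auto simp: Z_def)
    then show False using y(2) that by force
  qed
  then show ?thesis using y(1) by (auto simp: Z_def)
qed

lemma increasing_bounded_converges:
  fixes f :: "real \<Rightarrow> real"
  assumes mono: "\<And>x y. a \<le> x \<Longrightarrow> x \<le> y \<Longrightarrow> f x \<le> f y"
    and bdd: "\<And>x. a \<le> x \<Longrightarrow> f x \<le> B"
  obtains L where "(f \<longlongrightarrow> L) at_top" "\<And>x. a \<le> x \<Longrightarrow> f x \<le> L"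
proof -
  define L where "L = Sup (f ` {a..})"
  have bddS: "bdd_above (f ` {a..})" using bdd by (auto intro!: bdd_aboveI)
  then have le: "f x \<le> L" if "a \<le> x" for x
    unfolding L_def using that by (intro cSup_upper) auto
  have "(f \<longlongrightarrow> L) at_top"
  proof (rule order_tendstoI)
    fix c assume "c < L"
    then obtain x where x: "x \<ge> a" "c < f x"
      unfolding L_def using less_cSup_iff[OF _ bddS] by auto
    then show "\<forall>\<^sub>F y in at_top. c < f y"
      using mono[of x] by (intro eventually_mono[OF eventually_ge_at_top[of x]]) (use less_le_trans in blast)
  next
    fix c assume "L < c"
    then show "\<forall>\<^sub>F y in at_top. f y < c"
      using le by (intro eventually_mono[OF eventually_ge_at_top[of a]]) (use le_less_trans in blast)
  qed
  then show thesis using le that by blast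
qed

lemma decreasing_bounded_converges:
  fixes f :: "real \<Rightarrow> real"
  assumes mono: "\<And>x y. a \<le> x \<Longrightarrow> x \<le> y \<Longrightarrow> f y \<le> f x"
    and bdd: "\<And>x. a \<le> x \<Longrightarrow> B \<le> f x"
  obtains L where "(f \<longlongrightarrow> L) at_top" "\<And>x. a \<le> x \<Longrightarrow> L \<le> f x"
proof -
  obtain L where "((\<lambda>x. - f x) \<longlongrightarrow> L) at_top" "\<And>x. a \<le> x \<Longrightarrow> - f x \<le> L"
    by (rule increasing_bounded_converges[of a "\<lambda>x. - f x" "-B"]) (use assms in auto)
  then show thesis
    using that[of "-L"] tendsto_minus[of "\<lambda>x. - f x" L] by (force simp: minus_le_iff)
qed

lemma tendsto_parameter:
  fixes f :: "real \<Rightarrow> real"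
  assumes "\<And>b. \<bar>f b - f a\<bar> \<le> C * \<bar>b - a\<bar>"
  shows "(f \<longlongrightarrow> f a) (nhds a)"
proof -
  have "((\<lambda>b. C * \<bar>b - a\<bar>) \<longlongrightarrow> C * \<bar>a - a\<bar>) (nhds a)"
    by (intro tendsto_intros filterlim_ident)
  then have lim: "((\<lambda>b. C * \<bar>b - a\<bar>) \<longlongrightarrow> 0) (nhds a)" by simp
  have "((\<lambda>b. f b - f a) \<longlongrightarrow> 0) (nhds a)"
    by (rule Lim_null_comparison[OF _ lim]) (use assms in simp)
  then show ?thesis by (simp add: LIM_zero_iff)
qed

lemma DERIV_powr_const:
  fixes f :: "real \<Rightarrow> real"
  assumes "(f has_real_derivative f') (at x)" "f x > 0"
  shows "((\<lambda>x. f x powr a) has_real_derivative a * f x powr (a - 1) * f') (at x)"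
  using DERIV_fun_powr[OF assms, of a] by simp

text \<open>The positive function \<open>f powr (1 - \<rho>)\<close> has derivative at most
  \<open>- (\<rho> - 1) * k\<close>, so it would have to reach 0 no later than at the point
  \<open>b\<close> where the linear bound does.\<close>

lemma superlinear_growth_blows_up:
  fixes f :: "real \<Rightarrow> real"
  assumes der: "\<And>x. a \<le> x \<Longrightarrow> (f has_real_derivative f' x) (at x)"
    and pos: "\<And>x. a \<le> x \<Longrightarrow> f x > 0"
    and growth: "\<And>x. a \<le> x \<Longrightarrow> k * f x powr \<rho> \<le> f' x"
    and "k > 0" "\<rho> > 1"
  shows False
proof -
  define g where "g x = f x powr (1 - \<rho>)" for x
  have g_der: "(g has_real_derivative (1 - \<rho>) * f x powr (- \<rho>) * f' x) (at x)" if "a \<le> x" for x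
    unfolding g_def using DERIV_powr_const[OF der[OF that] pos[OF that], of "1 - \<rho>"] by simp
  define b where "b = a + g a / ((\<rho> - 1) * k)"
  have "g a > 0" using pos[of a] by (simp add: g_def)
  then have "a \<le> b" using assms by (simp add: b_def)
  have "g b \<le> g a + (- ((\<rho> - 1) * k)) * (b - a)"
  proof (rule deriv_bound_above[OF \<open>a \<le> b\<close> g_der])
    fix x assume "a \<le> x"
    have "f x powr (-\<rho>) * (k * f x powr \<rho>) \<le> f x powr (-\<rho>) * f' x"
      using growth[OF \<open>a \<le> x\<close>] by (intro mult_left_mono) auto
    then have "k \<le> f x powr (-\<rho>) * f' x"
      using pos[OF \<open>a \<le> x\<close>] by (simp add: powr_minus field_simps)
    then have "(\<rho> - 1) * k \<le> (\<rho> - 1) * (f x powr (-\<rho>) * f' x)"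
      using assms by (intro mult_left_mono) auto
    then show "(1 - \<rho>) * f x powr (-\<rho>) * f' x \<le> - ((\<rho> - 1) * k)"
      by (simp add: algebra_simps)
  qed auto
  also have "\<dots> = 0" using assms by (simp add: b_def)
  finally show False using pos[OF \<open>a \<le> b\<close>] by (simp add: g_def)
qed

text \<open>A Barbalat argument. The convergent \<open>E\<close> drops by less than \<eta> over a
  time step \<open>h\<close>, so the mean value theorem finds a point in the step where
  \<open>U\<close> is below \<open>e / 2\<close>; the bound on \<open>U'\<close> carries this back
  to the start of the step.\<close>

lemma barbalat_dissipation:
  fixes E U :: "real \<Rightarrow> real"
  assumes E: "\<And>s. s \<ge> a \<Longrightarrow> (E has_real_derivative E' s) (at s)"
    and U: "\<And>s. s \<ge> a \<Longrightarrow> (U has_real_derivative U' s) (at s)"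
    and diss: "\<And>s. s \<ge> a \<Longrightarrow> E' s \<le> - k * (U s)\<^sup>2" and "k > 0"
    and bdd: "\<And>s. s \<ge> a \<Longrightarrow> B \<le> E s"
    and lip: "\<And>s. s \<ge> a \<Longrightarrow> \<bar>U' s\<bar> \<le> C"
  shows "(U \<longlongrightarrow> 0) at_top"
proof (rule tendstoI)
  fix e :: real assume "e > 0"
  have "C \<ge> 0" using lip[of a] by auto
  obtain L where L: "(E \<longlongrightarrow> L) at_top" "\<And>s. a \<le> s \<Longrightarrow> L \<le> E s"
  proof (rule decreasing_bounded_converges[of a E B])
    fix x y assume "a \<le> x" "x \<le> y"
    then show "E y \<le> E x"
      using diss \<open>k > 0\<close>
      by (intro deriv_nonpos_antimono[OF _ E]) (auto intro: order.trans[OF diss])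
  qed (use bdd in auto)
  \<comment> \<open>\<open>U\<close> changes by at most \<open>e / 2\<close> during a step of this
    length, with \<open>C + 1\<close> to avoid a division by 0; \<eta> is the drop of
    \<open>E\<close> over the step at the dissipation rate belonging to
    \<open>e / 2\<close>.\<close>
  define h where "h = (e / 2) / (C + 1)"
  define \<eta> where "\<eta> = k * h * (e/2)\<^sup>2"
  have "h > 0" using \<open>e > 0\<close> \<open>C \<ge> 0\<close> by (simp add: h_def)
  then have "\<eta> > 0" using \<open>e > 0\<close> \<open>k > 0\<close> by (simp add: \<eta>_def)
  have Ch: "C * h \<le> e / 2"
  proof -
    have "C * h \<le> (C + 1) * h" using \<open>h > 0\<close> by simp
    also have "\<dots> = e / 2"
      using \<open>C \<ge> 0\<close> unfolding h_def times_divide_eq_right[of "C + 1" "e / 2" "C + 1"]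
      by (intro nonzero_mult_div_cancel_left) simp
    finally show ?thesis .
  qed
  have "\<forall>\<^sub>F s in at_top. E s < L + \<eta>"
    using L(1) \<open>\<eta> > 0\<close> by (auto intro: order_tendstoD)
  then have "\<forall>\<^sub>F s in at_top. E s < L + \<eta> \<and> s \<ge> a"
    using eventually_ge_at_top[of a] by eventually_elim auto
  then show "\<forall>\<^sub>F s in at_top. dist (U s) 0 < e"
  proof eventually_elim
    case (elim s)
    obtain z where z: "s < z" "z < s + h" "E (s + h) - E s = h * E' z"
      using MVT2[of s "s + h" E E'] \<open>h > 0\<close> E elim by force
    have "z \<ge> a" using z elim by simp
    have "k * h * (U z)\<^sup>2 \<le> E s - E (s + h)"
      using mult_left_mono[OF diss[OF \<open>z \<ge> a\<close>], of h] \<open>h > 0\<close> z(3) by (simp add: algebra_simps)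
    also have "\<dots> < \<eta>" using L(2)[of "s + h"] elim \<open>h > 0\<close> by auto
    finally have "(U z)\<^sup>2 < (e/2)\<^sup>2"
      unfolding \<eta>_def using mult_less_cancel_left_pos[of "k * h" "(U z)\<^sup>2" "(e/2)\<^sup>2"] \<open>k > 0\<close> \<open>h > 0\<close>
      by simp
    then have 1: "\<bar>U z\<bar> < e / 2"
      using power_less_imp_less_base[of "\<bar>U z\<bar>" 2 "e/2"] \<open>e > 0\<close> by simp
    obtain w where w: "s < w" "w < z" "U z - U s = (z - s) * U' w"
      using MVT2[OF z(1), of U U'] U elim by force
    have "\<bar>U z - U s\<bar> \<le> h * C"
    proof -
      have "\<bar>U' w\<bar> \<le> C" "\<bar>z - s\<bar> \<le> h"
        using lip[of w] w(1) z(1,2) elim by simp_all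
      then show ?thesis
        unfolding w(3) abs_mult using \<open>h > 0\<close> by (intro mult_mono) auto
    qed
    then show ?case using 1 Ch unfolding dist_real_def mult.commute[of C h] by linarith
  qed
qed

lemma continuous_on_atLeastI:
  fixes f :: "real \<Rightarrow> real"
  assumes "\<And>b. continuous_on {a..b} f"
  shows "continuous_on {a..} f"
  unfolding continuous_on_eq_continuous_within
proof
  fix x assume "x \<in> {a..}"
  then have "continuous (at x within {a..x + 1}) f"
    using assms[of "x + 1"] by (auto simp: continuous_on_eq_continuous_within)
  moreover have "at x within {a..} = at x within {a..x + 1}"
    by (rule at_within_nhd[of x "{..<x + 1}"]) auto
  ultimately show "continuous (at x within {a..}) f" by simp
qed

section \<open>The Emden equation with a decaying drift\<close>

text \<open>In the application \<open>r\<close> is 1 / m and \<open>q\<close> is p / m. The signs of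
  \<open>c\<close> and \<open>K\<close> stay open: nonexistence has \<open>c < 0\<close> and
  \<open>K\<close> of either sign, existence has both positive.\<close>

locale emden =
  fixes c K q r \<beta> :: real
  assumes r_gt_1: "1 < r" and q_gt_r: "r < q" and \<beta>_pos: "0 < \<beta>"
begin

definition h :: "real \<Rightarrow> real" where
  "h s = \<beta> * r * exp (- s / \<beta>)"

definition accel :: "real \<Rightarrow> real \<Rightarrow> real \<Rightarrow> real" where
  "accel s x y = - c * y + K * x - x powr q + h s * x powr (r - 1) * y"

text \<open>The absolute value makes the potential continuous on the whole line, so that limits can
  be taken before their sign is known.\<close>

definition potential :: "real \<Rightarrow> real" where
  "potential x = \<bar>x\<bar> powr (q + 1) / (q + 1) - K * x\<^sup>2 / 2"

definition energy :: "(real \<Rightarrow> real) \<Rightarrow> (real \<Rightarrow> real) \<Rightarrow> real \<Rightarrow> real" where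
  "energy V U s = (U s)\<^sup>2 / 2 + potential (V s)"

text \<open>Positivity belongs to the notion because powers of \<open>V\<close> are differentiated.
  Derivatives are two-sided even at the ends of \<open>I\<close>; thus the condition is pointwise,
  and solutions on singletons assemble to a solution on any set.\<close>

definition solves :: "real set \<Rightarrow> (real \<Rightarrow> real) \<Rightarrow> (real \<Rightarrow> real) \<Rightarrow> bool" where
  "solves I V U \<longleftrightarrow> (\<forall>s\<in>I. 0 < V s \<and> (V has_real_derivative U s) (at s) \<and>
     (U has_real_derivative accel s (V s) (U s)) (at s))"

lemma q_gt_1: "1 < q"
  using r_gt_1 q_gt_r by simp

lemma h_pos: "0 < h s"
  using \<beta>_pos r_gt_1 by (simp add: h_def)

lemma exp_decay: "((\<lambda>s. exp (- s / \<beta>)) \<longlongrightarrow> 0) at_top"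
proof -
  have "filterlim (\<lambda>s. - s / \<beta>) at_bot at_top"
    using \<beta>_pos by (auto intro!: filterlim_uminus_at_bot[THEN iffD2] filterlim_at_top_mult_tendsto_pos
        filterlim_ident tendsto_const simp: divide_inverse)
  then show ?thesis
    by (rule filterlim_compose[OF exp_at_bot])
qed

lemma h_tendsto_0: "(h \<longlongrightarrow> 0) at_top"
  unfolding h_def[abs_def] by (rule tendsto_mult_right_zero[OF exp_decay])

lemma solvesD:
  assumes "solves I V U" "s \<in> I"
  shows "0 < V s" "(V has_real_derivative U s) (at s)"
    "(U has_real_derivative accel s (V s) (U s)) (at s)"
  using assms by (auto simp: solves_def)

lemma solves_subset: "solves I V U \<Longrightarrow> J \<subseteq> I \<Longrightarrow> solves J V U"
  by (auto simp: solves_def)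

section \<open>Potential and energy balance\<close>

lemma potential_pos: "x \<ge> 0 \<Longrightarrow> potential x = x powr (q + 1) / (q + 1) - K * x\<^sup>2 / 2"
  by (simp add: potential_def)

lemma potential_0 [simp]: "potential 0 = 0"
  by (simp add: potential_def)

lemma powr_q_plus_1: "x > 0 \<Longrightarrow> x powr (q + 1) = x\<^sup>2 * x powr (q - 1)"
  using powr_add[of x 2 "q - 1"] by (simp add: add.commute)

lemma powr_q: "x > 0 \<Longrightarrow> x powr q = x * x powr (q - 1)"
  using powr_add[of x 1 "q - 1"] by simp

lemma potential_factor:
  "x > 0 \<Longrightarrow> potential x = x\<^sup>2 * (x powr (q - 1) / (q + 1) - K / 2)"
  by (simp add: potential_pos powr_q_plus_1 right_diff_distrib)

lemma continuous_on_potential: "continuous_on S potential"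
  unfolding potential_def[abs_def] using q_gt_1
  by (intro continuous_intros continuous_on_powr') auto

lemma tendsto_potential: "(f \<longlongrightarrow> l) F \<Longrightarrow> ((\<lambda>x. potential (f x)) \<longlongrightarrow> potential l) F"
  using continuous_on_tendsto_compose[OF continuous_on_potential[of UNIV]] by auto

lemma continuous_on_energy:
  "continuous_on S V \<Longrightarrow> continuous_on S U \<Longrightarrow> continuous_on S (energy V U)"
  unfolding energy_def[abs_def]
  by (intro continuous_intros continuous_on_compose2[OF continuous_on_potential[of UNIV]]) auto

text \<open>The force \<open>K * x - x powr q\<close> is minus the derivative of the potential and
  cancels; what remains is the work of the two terms proportional to the velocity.\<close>

lemma energy_derivative:
  assumes "solves I V U" "s \<in> I"
  shows "(energy V U has_real_derivative (U s)\<^sup>2 * (h s * V s powr (r - 1) - c)) (at s)"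
proof -
  note V = solvesD[OF assms]
  have "((\<lambda>s. V s powr (q + 1) / (q + 1)) has_real_derivative
      (q + 1) * V s powr (q + 1 - 1) * U s / (q + 1)) (at s)"
    by (rule DERIV_cdivide[OF DERIV_powr_const[OF V(2,1)]])
  then have "((\<lambda>s. V s powr (q + 1) / (q + 1)) has_real_derivative V s powr q * U s) (at s)"
    using q_gt_1 by simp
  moreover have "((\<lambda>s. (U s)\<^sup>2 / 2) has_real_derivative U s * accel s (V s) (U s)) (at s)"
    by (auto intro!: derivative_eq_intros V(3))
  moreover have "((\<lambda>s. K * (V s)\<^sup>2 / 2) has_real_derivative K * V s * U s) (at s)"
    by (auto intro!: derivative_eq_intros V(2))
  ultimately have "((\<lambda>s. (U s)\<^sup>2 / 2 + (V s powr (q + 1) / (q + 1) - K * (V s)\<^sup>2 / 2)) has_real_derivative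
      U s * accel s (V s) (U s) + (V s powr q * U s - K * V s * U s)) (at s)"
    by (intro DERIV_add DERIV_diff)
  moreover have "U s * accel s (V s) (U s) + (V s powr q * U s - K * V s * U s)
      = (U s)\<^sup>2 * (h s * V s powr (r - 1) - c)"
    by (simp add: accel_def algebra_simps power2_eq_square)
  ultimately have der: "((\<lambda>s. (U s)\<^sup>2 / 2 + (V s powr (q + 1) / (q + 1) - K * (V s)\<^sup>2 / 2)) has_real_derivative
      (U s)\<^sup>2 * (h s * V s powr (r - 1) - c)) (at s)"
    by simp
  have "(V \<longlongrightarrow> V s) (nhds s)"
    using DERIV_isCont[OF V(2)] by (simp add: isCont_def tendsto_at_iff_tendsto_nhds)
  then have "\<forall>\<^sub>F t in nhds s. 0 < V t"
    using V(1) by (rule order_tendstoD)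
  then have eq: "\<forall>\<^sub>F t in nhds s. energy V U t = (U t)\<^sup>2 / 2 + (V t powr (q + 1) / (q + 1) - K * (V t)\<^sup>2 / 2)"
    by eventually_elim (simp add: energy_def potential_pos)
  then show ?thesis
    using der DERIV_cong_ev[OF refl eq refl] by simp
qed

text \<open>Where the potential is positive, the force points towards 0, whatever the sign of
  \<open>K\<close>. Hence at positive energy every critical point of \<open>V\<close> is a strict
  local maximum.\<close>

lemma potential_pos_imp:
  assumes "x > 0" "potential x > 0"
  shows "K * x < x powr q"
proof -
  have *: "x powr (q - 1) / (q + 1) > K / 2"
    using assms by (simp add: potential_factor zero_less_mult_iff)
  have "K < x powr (q - 1)"
  proof (cases "K \<ge> 0")
    case True
    have "K \<le> (q + 1) / 2 * K"
      using True q_gt_1 mult_right_mono[of 1 "(q + 1)/2" K] by simp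
    also have "\<dots> < x powr (q - 1)" using * q_gt_1 by (simp add: field_simps)
    finally show ?thesis .
  next
    case False
    then show ?thesis using powr_gt_zero[of x "q - 1"] assms by linarith
  qed
  then show ?thesis using assms by (simp add: powr_q)
qed

text \<open>The equation in divergence form: all velocity terms are absorbed into a total
  derivative, so the derivative of this quantity involves \<open>V\<close> alone and passes to the
  limit without control of \<open>U\<close>.\<close>

definition flux :: "(real \<Rightarrow> real) \<Rightarrow> (real \<Rightarrow> real) \<Rightarrow> real \<Rightarrow> real" where
  "flux V U s = U s + c * V s - \<beta> * exp (- s / \<beta>) * V s powr r"

lemma flux_derivative:
  assumes "solves I V U" "s \<in> I"
  shows "(flux V U has_real_derivative K * V s - V s powr q + exp (- s / \<beta>) * V s powr r) (at s)"
proof -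
  note V = solvesD[OF assms]
  have 1: "((\<lambda>s. V s powr r) has_real_derivative r * V s powr (r - 1) * U s) (at s)"
    by (rule DERIV_powr_const[OF V(2,1)])
  have 2: "((\<lambda>s. \<beta> * exp (- s / \<beta>)) has_real_derivative - exp (- s / \<beta>)) (at s)"
    using \<beta>_pos by (auto intro!: derivative_eq_intros)
  have "(flux V U has_real_derivative accel s (V s) (U s) + c * U s -
     (\<beta> * exp (- s / \<beta>) * (r * V s powr (r - 1) * U s) + - exp (- s / \<beta>) * V s powr r)) (at s)"
    unfolding flux_def[abs_def]
    by (rule DERIV_diff[OF DERIV_add[OF V(3) DERIV_cmult[OF V(2)]] DERIV_mult'[OF 2 1]])
  then show ?thesis
    by (simp add: accel_def h_def algebra_simps)
qed

section \<open>Antidamping\<close>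

text \<open>The energy never falls below its positive initial value, so the limit \<open>l\<close>
  has positive potential and the force there is some \<open>- g < 0\<close>. Then the flux decreases
  at least at rate \<open>g / 2\<close> forever, although along suitable times it converges to
  \<open>c * l\<close>.\<close>

lemma no_limit_if_antidamped:
  assumes c: "c < 0" and V: "solves {a..} V U" and E: "energy V U a > 0"
    and lim: "(V \<longlongrightarrow> l) at_top"
  shows False
proof -
  have V_pos: "0 < V s" if "s \<ge> a" for s
    using solvesD(1)[OF V] that by simp
  have V_der: "(V has_real_derivative U s) (at s)" if "s \<ge> a" for s
    using solvesD(2)[OF V] that by simp
  have E_mono: "energy V U a \<le> energy V U s" if "s \<ge> a" for s
  proof (rule deriv_nonneg_mono[OF that])
    fix x assume "a \<le> x"
    then show "(energy V U has_real_derivative (U x)\<^sup>2 * (h x * V x powr (r - 1) - c)) (at x)"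
      by (intro energy_derivative[OF V]) auto
    have "0 \<le> h x * V x powr (r - 1)"
      using h_pos[of x] by simp
    then show "0 \<le> (U x)\<^sup>2 * (h x * V x powr (r - 1) - c)"
      using c by (intro mult_nonneg_nonneg) auto
  qed
  \<comment> \<open>Convergence of \<open>V\<close> alone gives no limit for \<open>U\<close>; mean
    value points supply times tending to infinity along which \<open>U\<close> tends to 0.\<close>
  have "\<exists>z. s < z \<and> z < s + 1 \<and> U z = V (s + 1) - V s" if "s \<ge> a" for s
    using MVT2[of s "s + 1" V U] V_der that by force
  then obtain \<theta> where \<theta>: "\<And>s. s \<ge> a \<Longrightarrow> s < \<theta> s \<and> \<theta> s < s + 1 \<and> U (\<theta> s) = V (s + 1) - V s"
    by metis
  have \<theta>_lim: "filterlim \<theta> at_top at_top"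
    using \<theta> by (intro filterlim_at_top_mono[OF filterlim_ident] eventually_mono[OF eventually_ge_at_top[of a]])
      (auto simp: less_imp_le)
  have "((\<lambda>s. V (s + 1)) \<longlongrightarrow> l) at_top"
    by (rule filterlim_compose[OF lim filterlim_at_top_mono[OF filterlim_ident]]) simp
  then have "((\<lambda>s. V (s + 1) - V s) \<longlongrightarrow> l - l) at_top"
    using lim by (rule tendsto_diff)
  then have "((\<lambda>s. V (s + 1) - V s) \<longlongrightarrow> 0) at_top"
    by simp
  then have U\<theta>: "((\<lambda>s. U (\<theta> s)) \<longlongrightarrow> 0) at_top"
    by (rule Lim_transform_eventually) (auto intro!: eventually_mono[OF eventually_ge_at_top[of a]] simp: \<theta>)
  have V\<theta>: "((\<lambda>s. V (\<theta> s)) \<longlongrightarrow> l) at_top"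
    by (rule filterlim_compose[OF lim \<theta>_lim])
  have "((\<lambda>s. energy V U (\<theta> s)) \<longlongrightarrow> 0\<^sup>2 / 2 + potential l) at_top"
    unfolding energy_def by (intro tendsto_intros tendsto_potential U\<theta> V\<theta>) auto
  moreover have "\<forall>\<^sub>F s in at_top. energy V U a \<le> energy V U (\<theta> s)"
    using \<theta> E_mono by (intro eventually_mono[OF eventually_ge_at_top[of a]]) force
  ultimately have "energy V U a \<le> 0\<^sup>2 / 2 + potential l"
    by (intro tendsto_lowerbound) auto
  then have pot: "potential l > 0" using E by simp
  have "l \<ge> 0"
    using V_pos by (intro tendsto_lowerbound[OF lim] eventually_mono[OF eventually_ge_at_top[of a]])
      (auto intro: less_imp_le)
  then have "l > 0" using pot by (cases "l = 0") auto
  define g where "g = l powr q - K * l"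
  have "g > 0"
    using potential_pos_imp[OF \<open>l > 0\<close> pot] by (simp add: g_def)
  let ?F = "flux V U" and ?F' = "\<lambda>s. K * V s - V s powr q + exp (- s / \<beta>) * V s powr r"
  have "(?F' \<longlongrightarrow> K * l - l powr q + 0 * l powr r) at_top"
    using \<open>l > 0\<close> by (intro tendsto_intros lim exp_decay) auto
  then have "(?F' \<longlongrightarrow> - g) at_top"
    by (simp add: g_def)
  then have "\<forall>\<^sub>F s in at_top. ?F' s < - g / 2"
    using \<open>g > 0\<close> by (intro order_tendstoD) auto
  then obtain b where b: "b \<ge> a" "\<And>s. s \<ge> b \<Longrightarrow> ?F' s < - g / 2"
    by (rule eventually_at_topE[where a = a]) blast
  have F_le: "?F s \<le> ?F b + (- g / 2) * (s - b)" if "s \<ge> b" for s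
  proof (rule deriv_bound_above[OF that])
    fix x assume "b \<le> x"
    then show "(?F has_real_derivative ?F' x) (at x)"
      using b by (intro flux_derivative[OF V]) simp
    show "?F' x \<le> - g / 2"
      using b(2)[OF \<open>b \<le> x\<close>] by simp
  qed
  have "((\<lambda>s. ?F (\<theta> s)) \<longlongrightarrow> 0 + c * l - \<beta> * 0 * l powr r) at_top"
    unfolding flux_def using \<open>l > 0\<close>
    by (intro tendsto_intros U\<theta> V\<theta> filterlim_compose[OF exp_decay \<theta>_lim]) auto
  then have "((\<lambda>s. ?F (\<theta> s)) \<longlongrightarrow> c * l) at_top"
    by simp
  then have "\<forall>\<^sub>F s in at_top. ?F (\<theta> s) > c * l - 1"
    by (rule order_tendstoD) simp
  then obtain b1 where b1: "b1 \<ge> b" "\<And>s. s \<ge> b1 \<Longrightarrow> ?F (\<theta> s) > c * l - 1"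
    by (rule eventually_at_topE[where a = b]) blast
  \<comment> \<open>Late enough for the linear decrease of the flux to have brought it down to
    \<open>c * l - 1\<close>.\<close>
  define t where "t = max b1 (b + (?F b - c * l + 1) * 2 / g)"
  have "t \<ge> b1" "t \<ge> b + (?F b - c * l + 1) * 2 / g" by (simp_all add: t_def)
  then have "t \<ge> a" "t \<ge> b" using b b1 by auto
  have "?F (\<theta> t) \<le> ?F b + (- g / 2) * (\<theta> t - b)"
    using \<theta>[OF \<open>t \<ge> a\<close>] \<open>t \<ge> b\<close> by (intro F_le) simp
  also have "\<dots> \<le> ?F b + (- g / 2) * ((?F b - c * l + 1) * 2 / g)"
    using \<theta>[OF \<open>t \<ge> a\<close>] \<open>t \<ge> b + _\<close> \<open>g > 0\<close> by (intro add_left_mono mult_left_mono_neg) auto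
  also have "(- g / 2) * ((?F b - c * l + 1) * 2 / g) = - (?F b - c * l + 1)"
    using \<open>g > 0\<close> by (simp add: field_simps)
  finally show False using b1(2)[OF \<open>t \<ge> b1\<close>] by simp
qed

text \<open>Above a level \<open>B\<close> the power \<open>q\<close> dominates, so
  \<open>X = - flux\<close> grows at least at rate \<open>V powr q / 2\<close>, while
  \<open>U > 0\<close> bounds \<open>X\<close> by a multiple of \<open>V powr r\<close>. Hence
  \<open>X'\<close> is at least a multiple of \<open>X powr (q / r)\<close> with
  \<open>q / r > 1\<close>, which cannot last. Starting at \<open>a \<ge> 0\<close> keeps
  \<open>exp (- s / \<beta>)\<close> at most 1.\<close>

lemma no_unbounded_increase:
  assumes V: "solves {a..} V U" and "a \<ge> 0" and U: "\<And>s. s \<ge> a \<Longrightarrow> U s > 0"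
    and unbdd: "\<And>B. \<exists>s\<ge>a. V s > B"
  shows False
proof -
  have V_pos: "0 < V s" and V_der: "(V has_real_derivative U s) (at s)" if "s \<ge> a" for s
    using solvesD(1,2)[OF V] that by simp_all
  have V_mono: "V s \<le> V t" if "a \<le> s" "s \<le> t" for s t
    using that U by (intro deriv_nonneg_mono[OF that(2) V_der]) (auto intro: less_imp_le)
  have "((\<lambda>x::real. K * x powr (1 - q) + x powr (r - q)) \<longlongrightarrow> K * 0 + 0) at_top"
    using q_gt_1 q_gt_r by (intro tendsto_intros tendsto_neg_powr filterlim_ident) auto
  then have "\<forall>\<^sub>F x in at_top. K * x powr (1 - q) + x powr (r - q) < 1 / 2"
    by (intro order_tendstoD) auto
  then obtain B where B: "B \<ge> 1" "\<And>x. x \<ge> B \<Longrightarrow> K * x powr (1 - q) + x powr (r - q) < 1 / 2"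
    by (rule eventually_at_topE[where a = 1]) auto
  have B': "x powr q - K * x - x powr r \<ge> x powr q / 2" if "x \<ge> B" for x
  proof -
    have "x > 0" using that B by simp
    have "x powr q * (K * x powr (1 - q) + x powr (r - q)) \<le> x powr q * (1 / 2)"
      using B(2)[OF that] by (intro mult_left_mono) auto
    moreover have "x powr q * (K * x powr (1 - q)) = K * x" "x powr q * x powr (r - q) = x powr r"
      using \<open>x > 0\<close> powr_add[of x q "1 - q"] powr_add[of x q "r - q"] by (auto simp: algebra_simps)
    ultimately show ?thesis by (simp add: distrib_left)
  qed
  obtain b where b: "b \<ge> a" "V b > B" using unbdd by blast
  have V_ge: "V s \<ge> B" if "s \<ge> b" for s
    using V_mono[OF b(1) that] b(2) by simp
  define X where "X s = - flux V U s" for s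
  define X' where "X' s = V s powr q - K * V s - exp (- s / \<beta>) * V s powr r" for s
  have exp_le: "exp (- s / \<beta>) \<le> 1" if "s \<ge> b" for s
    using that b \<open>a \<ge> 0\<close> \<beta>_pos by simp
  have X_der: "(X has_real_derivative X' s) (at s)" if "s \<ge> b" for s
  proof -
    have "(X has_real_derivative - (K * V s - V s powr q + exp (- s / \<beta>) * V s powr r)) (at s)"
      unfolding X_def[abs_def] using that b by (intro DERIV_minus flux_derivative[OF V]) simp
    then show ?thesis by (simp add: X'_def)
  qed
  have X'_ge: "X' s \<ge> V s powr q / 2" if "s \<ge> b" for s
  proof -
    have "exp (- s / \<beta>) * V s powr r \<le> 1 * V s powr r"
      using exp_le[OF that] by (intro mult_right_mono) auto
    then show ?thesis using B'[OF V_ge[OF that]] by (simp add: X'_def)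
  qed
  define C where "C = \<bar>c\<bar> + \<beta>"
  have "C > 0" using \<beta>_pos by (simp add: C_def)
  have X_le: "X s \<le> C * V s powr r" if "s \<ge> b" for s
  proof -
    have "V s \<ge> 1" using V_ge[OF that] B by simp
    then have "V s \<le> V s powr r"
      using powr_mono[of 1 r "V s"] r_gt_1 by simp
    then have "- c * V s \<le> \<bar>c\<bar> * V s powr r"
      using \<open>V s \<ge> 1\<close> by (intro mult_mono) auto
    moreover have "\<beta> * exp (- s / \<beta>) * V s powr r \<le> \<beta> * 1 * V s powr r"
      using exp_le[OF that] \<beta>_pos by (intro mult_right_mono mult_left_mono) auto
    moreover have "U s > 0" using U b that by simp
    ultimately show ?thesis by (simp add: X_def flux_def C_def algebra_simps)
  qed
  have X_lin: "X b + (1/2) * (s - b) \<le> X s" if "s \<ge> b" for s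
  proof (rule deriv_bound_below[OF that X_der])
    fix x assume x: "b \<le> x"
    have "V x \<ge> 1" using V_ge[OF x] B by simp
    then have "V x powr q \<ge> 1" using q_gt_1 by (intro ge_one_powr_ge_zero) auto
    then show "1/2 \<le> X' x" using X'_ge[OF x] by simp
  qed
  define d where "d = b + 2 * \<bar>X b\<bar> + 2"
  have "d \<ge> b" by (simp add: d_def)
  have X_pos: "X s > 0" if "s \<ge> d" for s
    using X_lin[of s] that \<open>d \<ge> b\<close> by (simp add: d_def abs_if field_simps split: if_splits)
  show False
  proof (rule superlinear_growth_blows_up[of d X X' "(1/2) * (1/C) powr (q/r)" "q/r"])
    fix s assume s: "d \<le> s"
    then have "s \<ge> b" using \<open>d \<ge> b\<close> by simp
    show "(X has_real_derivative X' s) (at s)" "0 < X s"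
      using X_der[OF \<open>s \<ge> b\<close>] X_pos[OF s] .
    have "V s > 0" using V_pos b \<open>s \<ge> b\<close> by simp
    have "X s / C \<le> V s powr r"
      using X_le[OF \<open>s \<ge> b\<close>] \<open>C > 0\<close> by (simp add: field_simps)
    then have "(X s / C) powr (q/r) \<le> (V s powr r) powr (q/r)"
      using X_pos[OF s] \<open>C > 0\<close> r_gt_1 q_gt_1 by (intro powr_mono2) auto
    also have "\<dots> = V s powr q"
      using r_gt_1 by (simp add: powr_powr)
    finally have "(1/C) powr (q/r) * X s powr (q/r) \<le> V s powr q"
      using X_pos[OF s] \<open>C > 0\<close> by (simp add: powr_divide)
    then show "1/2 * (1/C) powr (q/r) * X s powr (q/r) \<le> X' s"
      using X'_ge[OF \<open>s \<ge> b\<close>] by simp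
  qed (use \<open>C > 0\<close> r_gt_1 q_gt_r in auto)
qed

text \<open>By \<open>potential_pos_imp\<close> the velocity is strictly decreasing at each of its
  zeros, so once it is nonpositive it stays so. Either \<open>V\<close> is eventually nonincreasing,
  or it increases for all times.\<close>

lemma no_positive_energy_if_antidamped:
  assumes c: "c < 0" and V: "solves {0..} V U" and E: "\<And>s. s \<ge> 0 \<Longrightarrow> energy V U s > 0"
  shows False
proof -
  have V_pos: "0 < V s" and V_der: "(V has_real_derivative U s) (at s)"
    and U_der: "(U has_real_derivative accel s (V s) (U s)) (at s)" if "s \<ge> 0" for s
    using solvesD[OF V] that by simp_all
  have V': "solves {a..} V U" if "a \<ge> 0" for a
    using that by (intro solves_subset[OF V]) auto
  have down: "accel s (V s) (U s) < 0" if "s \<ge> 0" "U s = 0" for s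
    using potential_pos_imp[OF V_pos[OF that(1)]] E[OF that(1)] that(2)
    by (simp add: accel_def energy_def)
  show False
  proof (cases "\<exists>a\<ge>0. U a \<le> 0")
    case True
    then obtain a where a: "a \<ge> 0" "U a \<le> 0" by blast
    have U_neg: "U s \<le> 0" if "s \<ge> a" for s
    proof (cases "s = a")
      case False
      then have "U s < 0"
        using a that by (intro negative_after_downcrossing[of a s U, OF U_der down]) auto
      then show ?thesis by simp
    qed (use a in simp)
    have V_anti: "V t \<le> V s" if "a \<le> s" "s \<le> t" for s t
      using that U_neg a by (intro deriv_nonpos_antimono[OF that(2) V_der]) auto
    obtain l where "(V \<longlongrightarrow> l) at_top"
      by (rule decreasing_bounded_converges[of a V 0]) (use V_anti V_pos a in \<open>auto intro: less_imp_le\<close>)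
    then show False
      using no_limit_if_antidamped[OF c V'[OF a(1)] E[OF a(1)]] by blast
  next
    case False
    then have U_pos: "U s > 0" if "s \<ge> 0" for s
      using that by force
    have V_mono: "V s \<le> V t" if "0 \<le> s" "s \<le> t" for s t
      using that U_pos by (intro deriv_nonneg_mono[OF that(2) V_der]) (auto intro: less_imp_le)
    show False
    proof (cases "\<exists>B. \<forall>s\<ge>0. V s \<le> B")
      case True
      then obtain B where B: "\<And>s. s \<ge> 0 \<Longrightarrow> V s \<le> B" by blast
      obtain l where "(V \<longlongrightarrow> l) at_top"
        by (rule increasing_bounded_converges[OF V_mono B])
      then show False
        using no_limit_if_antidamped[OF c V E] by blast
    next
      case False
      then have "\<exists>s\<ge>0. V s > B" for B
        by (simp add: not_le)
      from no_unbounded_increase[OF V order_refl U_pos this] show False .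
    qed
  qed
qed

text \<open>The energy is nondecreasing and at least \<open>potential (V s)\<close>, which tends to
  0 at minus infinity; so it is nonnegative. If it were 0 at \<open>b\<close>, it would vanish
  identically before \<open>b\<close>, forcing \<open>U = 0\<close> and a constant positive
  \<open>V\<close>.\<close>

lemma energy_positive_from_minus_infinity:
  assumes c: "c < 0" and V: "solves {..b} V U" and lim: "(V \<longlongrightarrow> 0) at_bot"
  shows "energy V U b > 0"
proof -
  have damp: "0 < h s * V s powr (r - 1) - c" for s
  proof -
    have "0 \<le> h s * V s powr (r - 1)" using h_pos[of s] by simp
    then show ?thesis using c by linarith
  qed
  have E_der: "(energy V U has_real_derivative (U s)\<^sup>2 * (h s * V s powr (r - 1) - c)) (at s)" if "s \<le> b" for s
    using that by (intro energy_derivative[OF V]) simp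
  have E_mono: "energy V U s \<le> energy V U t" if "s \<le> t" "t \<le> b" for s t
  proof (rule deriv_nonneg_mono[OF that(1) E_der])
    fix x
    show "0 \<le> (U x)\<^sup>2 * (h x * V x powr (r - 1) - c)"
      using damp[of x] by (intro mult_nonneg_nonneg) auto
  qed (use that in simp)
  have E_ge: "0 \<le> energy V U s" if "s \<le> b" for s
  proof (rule tendsto_upperbound)
    show "((\<lambda>t. potential (V t)) \<longlongrightarrow> 0) at_bot"
      using tendsto_potential[OF lim] by simp
    show "\<forall>\<^sub>F t in at_bot. potential (V t) \<le> energy V U s"
    proof (rule eventually_mono[OF eventually_le_at_bot[of s]])
      fix t assume "t \<le> s"
      then show "potential (V t) \<le> energy V U s"
        using E_mono[of t s] that zero_le_power2[of "U t"] unfolding energy_def by linarith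
    qed
  qed simp
  show ?thesis
  proof (rule ccontr)
    assume "\<not> energy V U b > 0"
    then have E0: "energy V U s = 0" if "s \<le> b" for s
      using E_ge[OF that] E_mono[OF that order_refl] by simp
    have U0: "U s = 0" if "s < b" for s
    proof -
      have "(energy V U has_real_derivative 0) (at s)"
      proof -
        have "\<forall>\<^sub>F x in nhds s. x \<in> {..<b}"
          using that by (intro eventually_nhds_in_open) auto
        then have ev: "\<forall>\<^sub>F x in nhds s. energy V U x = 0"
          by (rule eventually_mono) (simp add: E0)
        show ?thesis
          using DERIV_cong_ev[OF refl ev refl] by simp
      qed
      then have "(U s)\<^sup>2 * (h s * V s powr (r - 1) - c) = 0"
        by (rule DERIV_unique[OF E_der[OF less_imp_le[OF that]]])
      then show ?thesis using damp[of s] by simp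
    qed
    define d where "d = b - 1"
    have const: "V d = V s" if "s \<le> d" for s
    proof (rule antisym)
      have 1: "\<And>x. s \<le> x \<Longrightarrow> x \<le> d \<Longrightarrow> (V has_real_derivative U x) (at x)"
        using solvesD(2)[OF V] by (simp add: d_def)
      have 2: "\<And>x. s \<le> x \<Longrightarrow> x \<le> d \<Longrightarrow> U x = 0"
        by (intro U0) (simp add: d_def)
      show "V s \<le> V d" by (rule deriv_nonneg_mono[OF that 1]) (simp_all add: 2)
      show "V d \<le> V s" by (rule deriv_nonpos_antimono[OF that 1]) (simp_all add: 2)
    qed
    have "\<forall>\<^sub>F s in at_bot. V d = V s"
      by (rule eventually_mono[OF eventually_le_at_bot[of d] const])
    then have "((\<lambda>_::real. V d) \<longlongrightarrow> 0) at_bot"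
      using tendsto_cong[of "\<lambda>_. V d" V at_bot 0] lim by simp
    then have "V d = 0"
      by (simp add: tendsto_const_iff)
    then show False using solvesD(1)[OF V, of d] by (simp add: d_def)
  qed
qed

section \<open>Damping\<close>

text \<open>Once \<open>h\<close> is small, half of the damping absorbs the drift of a bounded
  solution; the other half remains as genuine dissipation.\<close>

lemma damping_eventually:
  assumes "c > 0" and V: "solves {a..} V U" and le: "\<And>s. s \<ge> a \<Longrightarrow> V s \<le> M"
  shows "\<exists>b\<ge>a. (\<forall>s\<ge>b. h s * V s powr (r - 1) \<le> c / 2) \<and>
    (\<forall>s t. b \<le> s \<longrightarrow> s \<le> t \<longrightarrow> energy V U t \<le> energy V U s)"
proof -
  have "((\<lambda>s. h s * M powr (r - 1)) \<longlongrightarrow> 0) at_top"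
    by (rule tendsto_mult_left_zero[OF h_tendsto_0])
  then have "\<forall>\<^sub>F s in at_top. h s * M powr (r - 1) < c / 2"
    using \<open>c > 0\<close> by (intro order_tendstoD) auto
  then obtain b where b: "b \<ge> a" "\<And>s. s \<ge> b \<Longrightarrow> h s * M powr (r - 1) < c / 2"
    by (rule eventually_at_topE[where a = a]) blast
  have damp: "h s * V s powr (r - 1) \<le> c / 2" if "s \<ge> b" for s
  proof -
    have "s \<ge> a" using that b by simp
    then have "V s powr (r - 1) \<le> M powr (r - 1)"
      using solvesD(1)[OF V, of s] le[of s] r_gt_1 by (intro powr_mono2) auto
    then have "h s * V s powr (r - 1) \<le> h s * M powr (r - 1)"
      using h_pos[of s] by (intro mult_left_mono) auto
    then show ?thesis using b(2)[OF that] by simp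
  qed
  moreover have "energy V U t \<le> energy V U s" if "b \<le> s" "s \<le> t" for s t
  proof (rule deriv_nonpos_antimono[OF \<open>s \<le> t\<close>])
    fix x assume "s \<le> x"
    then have "b \<le> x" using that by simp
    then show "(energy V U has_real_derivative (U x)\<^sup>2 * (h x * V x powr (r - 1) - c)) (at x)"
      using b by (intro energy_derivative[OF V]) auto
    show "(U x)\<^sup>2 * (h x * V x powr (r - 1) - c) \<le> 0"
      using damp[OF \<open>b \<le> x\<close>] \<open>c > 0\<close> by (intro mult_nonneg_nonpos) auto
  qed
  ultimately show ?thesis using b(1) by blast
qed

lemma potential_lower_bound:
  assumes "0 < x" "x \<le> M"
  shows "- \<bar>K\<bar> * M\<^sup>2 / 2 \<le> potential x"
proof -
  have "K * x\<^sup>2 \<le> \<bar>K\<bar> * M\<^sup>2"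
    using assms by (intro mult_mono power_mono) auto
  moreover have "0 \<le> x powr (q + 1) / (q + 1)"
    using q_gt_1 by simp
  moreover have "potential x = x powr (q + 1) / (q + 1) - K * x\<^sup>2 / 2"
    using assms by (simp add: potential_pos)
  ultimately show ?thesis by linarith
qed

text \<open>The first claim is \<open>barbalat_dissipation\<close> for the energy. For the second,
  \<open>U (s + 1) - U s\<close> is small, so the acceleration is small at some \<open>z\<close> in
  between; there the drag is small too, hence so is the force, and since the force changes at a rate
  proportional to \<open>U\<close>, it is small at \<open>s\<close> as well.\<close>

lemma velocity_and_force_vanish:
  assumes "c > 0" and V: "solves {a..} V U" and le: "\<And>s. s \<ge> a \<Longrightarrow> V s \<le> M"
  shows "(U \<longlongrightarrow> 0) at_top" "((\<lambda>s. K * V s - V s powr q) \<longlongrightarrow> 0) at_top"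
proof -
  obtain b where b: "b \<ge> a" "\<forall>s\<ge>b. h s * V s powr (r - 1) \<le> c / 2"
    "\<forall>s t. b \<le> s \<longrightarrow> s \<le> t \<longrightarrow> energy V U t \<le> energy V U s"
    using damping_eventually[OF assms] by blast
  note b = b(1) b(2,3)[rule_format]
  have V_pos: "0 < V s" and V_der: "(V has_real_derivative U s) (at s)"
    and U_der: "(U has_real_derivative accel s (V s) (U s)) (at s)"
    and V_le: "V s \<le> M" if "s \<ge> b" for s
    using solvesD[OF V] b(1) le that by simp_all
  have "M > 0" using V_pos[of b] V_le[of b] by simp
  have E_ge: "- \<bar>K\<bar> * M\<^sup>2 / 2 \<le> energy V U s" if "s \<ge> b" for s
    using potential_lower_bound[OF V_pos[OF that] V_le[OF that]]
    unfolding energy_def by (rule add_increasing[rotated]) simp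
  define W where "W = 2 * (energy V U b + \<bar>K\<bar> * M\<^sup>2 / 2)"
  have U_sq: "(U s)\<^sup>2 \<le> W" if "s \<ge> b" for s
  proof -
    have "(U s)\<^sup>2 / 2 + potential (V s) \<le> energy V U b"
      using b(3)[of b s] that by (simp add: energy_def)
    then show ?thesis
      using potential_lower_bound[OF V_pos[OF that] V_le[OF that]] by (simp add: W_def)
  qed
  have U_le: "\<bar>U s\<bar> \<le> W + 1" if "s \<ge> b" for s
  proof -
    have "\<bar>U s\<bar> \<le> (U s)\<^sup>2 + 1"
      using zero_le_power2[of "\<bar>U s\<bar> - 1"] zero_le_power2[of "U s"]
      by (simp add: power2_diff)
    then show ?thesis using U_sq[OF that] by simp
  qed
  have drag: "\<bar>- c * U s + h s * V s powr (r - 1) * U s\<bar> \<le> c * \<bar>U s\<bar>" if "s \<ge> b" for s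
  proof -
    have "\<bar>- c + h s * V s powr (r - 1)\<bar> \<le> c"
    proof -
      have "0 \<le> h s * V s powr (r - 1)"
        using h_pos[of s] by simp
      then show ?thesis using b(2)[OF that] \<open>c > 0\<close> by linarith
    qed
    then have "\<bar>- c + h s * V s powr (r - 1)\<bar> * \<bar>U s\<bar> \<le> c * \<bar>U s\<bar>"
      by (intro mult_right_mono) auto
    then show ?thesis unfolding distrib_right[symmetric] abs_mult .
  qed
  have powr_le: "V s powr e \<le> M powr e" if "s \<ge> b" "e \<ge> 0" for s e
    using V_pos[OF that(1)] V_le[OF that(1)] that(2) by (intro powr_mono2) auto
  show U0: "(U \<longlongrightarrow> 0) at_top"
  proof (rule barbalat_dissipation[of b "energy V U" _ U _ "c / 2" _ "c * (W + 1) + \<bar>K\<bar> * M + M powr q"])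
    fix s assume s: "b \<le> s"
    show "(energy V U has_real_derivative (U s)\<^sup>2 * (h s * V s powr (r - 1) - c)) (at s)"
      using s b(1) by (intro energy_derivative[OF V]) simp
    show "(U has_real_derivative accel s (V s) (U s)) (at s)"
      by (rule U_der[OF s])
    have "(U s)\<^sup>2 * (h s * V s powr (r - 1) - c) \<le> (U s)\<^sup>2 * (- (c / 2))"
      using b(2)[OF s] by (intro mult_left_mono) auto
    then show "(U s)\<^sup>2 * (h s * V s powr (r - 1) - c) \<le> - (c / 2) * (U s)\<^sup>2"
      by (simp add: mult.commute)
    show "- \<bar>K\<bar> * M\<^sup>2 / 2 \<le> energy V U s"
      by (rule E_ge[OF s])
    have "\<bar>- c * U s + h s * V s powr (r - 1) * U s\<bar> \<le> c * (W + 1)"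
      using order.trans[OF drag[OF s] mult_left_mono[OF U_le[OF s]]] \<open>c > 0\<close> by simp
    moreover have "\<bar>K * V s\<bar> \<le> \<bar>K\<bar> * M"
      unfolding abs_mult using V_pos[OF s] V_le[OF s] by (intro mult_left_mono) auto
    moreover have "\<bar>V s powr q\<bar> \<le> M powr q"
      using powr_le[OF s, of q] q_gt_1 by simp
    moreover have "accel s (V s) (U s) = (- c * U s + h s * V s powr (r - 1) * U s) + K * V s - V s powr q"
      by (simp add: accel_def)
    ultimately show "\<bar>accel s (V s) (U s)\<bar> \<le> c * (W + 1) + \<bar>K\<bar> * M + M powr q"
      by linarith
  qed (use \<open>c > 0\<close> in simp)
  define D where "D = \<bar>K\<bar> + q * M powr (q - 1)"
  have "D \<ge> 0" using q_gt_1 by (simp add: D_def)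
  let ?g = "\<lambda>s. K * V s - V s powr q"
  have g_der: "(?g has_real_derivative K * U s - q * V s powr (q - 1) * U s) (at s)" if "s \<ge> b" for s
    by (intro DERIV_diff DERIV_cmult V_der[OF that] DERIV_powr_const[OF V_der[OF that] V_pos[OF that]])
  have g'_le: "\<bar>K * U s - q * V s powr (q - 1) * U s\<bar> \<le> D * \<bar>U s\<bar>" if "s \<ge> b" for s
  proof -
    have "q * V s powr (q - 1) \<le> q * M powr (q - 1)"
      using powr_le[OF that, of "q - 1"] q_gt_1 by (intro mult_left_mono) auto
    moreover have "0 \<le> q * V s powr (q - 1)" using q_gt_1 by simp
    ultimately have "\<bar>K - q * V s powr (q - 1)\<bar> \<le> D"
      unfolding D_def by linarith
    then have "\<bar>K - q * V s powr (q - 1)\<bar> * \<bar>U s\<bar> \<le> D * \<bar>U s\<bar>"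
      by (intro mult_right_mono) auto
    then show ?thesis by (simp add: abs_mult[symmetric] left_diff_distrib)
  qed
  show "(?g \<longlongrightarrow> 0) at_top"
  proof (rule tendstoI)
    fix e :: real assume "e > 0"
    \<comment> \<open>The error \<open>e\<close> is shared by the increment of \<open>U\<close> (at
      most twice \<eta>), the drag (\<open>c\<close> times \<eta>) and the change of the force
      between \<open>s\<close> and \<open>z\<close> (\<open>D\<close> times \<eta>).\<close>
    define \<eta> where "\<eta> = e / (2 + c + D)"
    have "\<eta> > 0" using \<open>e > 0\<close> \<open>c > 0\<close> \<open>D \<ge> 0\<close> by (simp add: \<eta>_def)
    have \<eta>: "2 * \<eta> + c * \<eta> + D * \<eta> = e"
    proof -
      have "(2 + c + D) * \<eta> = e"
        using \<open>c > 0\<close> \<open>D \<ge> 0\<close> by (simp add: \<eta>_def)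
      then show ?thesis by (simp add: distrib_right)
    qed
    have "\<forall>\<^sub>F s in at_top. \<bar>U s\<bar> < \<eta>"
      using tendstoD[OF U0 \<open>\<eta> > 0\<close>] by simp
    then obtain d where d: "d \<ge> b" "\<And>s. s \<ge> d \<Longrightarrow> \<bar>U s\<bar> < \<eta>"
      by (rule eventually_at_topE[where a = b]) blast
    have "\<bar>?g s\<bar> < e" if "s \<ge> d" for s
    proof -
      have sb: "t \<ge> b" if "t \<ge> s" for t using that \<open>s \<ge> d\<close> d(1) by simp
      have Us: "\<bar>U t\<bar> < \<eta>" if "t \<ge> s" for t using that \<open>s \<ge> d\<close> d(2) by simp
      obtain z where z: "s < z" "z < s + 1" "U (s + 1) - U s = accel z (V z) (U z)"
        using MVT2[of s "s + 1" U "\<lambda>z. accel z (V z) (U z)", OF _ U_der[OF sb]] by auto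
      obtain w where w: "s < w" "w < z" "?g z - ?g s = (z - s) * (K * U w - q * V w powr (q - 1) * U w)"
        using MVT2[of s z ?g "\<lambda>w. K * U w - q * V w powr (q - 1) * U w", OF z(1) g_der[OF sb]] by auto
      have "\<bar>accel z (V z) (U z)\<bar> < 2 * \<eta>"
        using z(3) Us[of s] Us[of "s + 1"] by simp
      moreover have "\<bar>- c * U z + h z * V z powr (r - 1) * U z\<bar> \<le> c * \<eta>"
      proof (rule order.trans[OF drag mult_left_mono])
        show "z \<ge> b" "\<bar>U z\<bar> \<le> \<eta>" using sb[of z] Us[of z] z(1) by simp_all
      qed (use \<open>c > 0\<close> in simp)
      moreover have "accel z (V z) (U z) = (- c * U z + h z * V z powr (r - 1) * U z) + ?g z"
        by (simp add: accel_def)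
      moreover have "\<bar>?g z - ?g s\<bar> \<le> 1 * (D * \<eta>)"
        unfolding w(3) abs_mult
      proof (rule mult_mono)
        show "\<bar>z - s\<bar> \<le> 1" using z by simp
        have "D * \<bar>U w\<bar> \<le> D * \<eta>" using Us[of w] w \<open>D \<ge> 0\<close> by (intro mult_left_mono) auto
        then show "\<bar>K * U w - q * V w powr (q - 1) * U w\<bar> \<le> D * \<eta>"
          using g'_le[of w] sb[of w] w(1) by simp
      qed auto
      ultimately show ?thesis using \<eta> by linarith
    qed
    then show "\<forall>\<^sub>F s in at_top. dist (?g s) 0 < e"
      by (intro eventually_mono[OF eventually_ge_at_top[of d]]) simp
  qed
qed

text \<open>The energy stays below a negative constant, which keeps \<open>V\<close> above some
  \<delta> > 0. The vanishing force \<open>K * V - V powr q\<close> may therefore be divided by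
  \<open>V\<close>, giving \<open>V powr (q - 1)\<close> \<longlongrightarrow>
  \<open>K\<close>.\<close>

lemma converges_to_equilibrium:
  assumes "c > 0" "K > 0" and V: "solves {a..} V U" and le: "\<And>s. s \<ge> a \<Longrightarrow> V s \<le> M"
    and E: "\<And>s. s \<ge> a \<Longrightarrow> energy V U s < 0"
  shows "(V \<longlongrightarrow> K powr (1 / (q - 1))) at_top"
proof -
  obtain b where b: "b \<ge> a" "\<forall>s t. b \<le> s \<longrightarrow> s \<le> t \<longrightarrow> energy V U t \<le> energy V U s"
    using damping_eventually[OF assms(1) V le] by blast
  define e where "e = - energy V U b"
  have "e > 0" using E[OF b(1)] by (simp add: e_def)
  define \<delta> where "\<delta> = sqrt (2 * e / K)"
  have "\<delta> > 0" using \<open>e > 0\<close> \<open>K > 0\<close> by (simp add: \<delta>_def)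
  have V_pos: "0 < V s" if "s \<ge> b" for s
    using solvesD(1)[OF V, of s] b(1) that by simp
  have V_ge: "V s \<ge> \<delta>" if "s \<ge> b" for s
  proof -
    have "potential (V s) \<le> - e"
      using b(2)[rule_format, OF order_refl that] zero_le_power2[of "U s"] unfolding e_def energy_def by linarith
    moreover have "0 \<le> V s powr (q + 1) / (q + 1)" using q_gt_1 by simp
    ultimately have "e \<le> K * (V s)\<^sup>2 / 2"
      using V_pos[OF that] by (simp add: potential_pos)
    then have "2 * e / K \<le> (V s)\<^sup>2" using \<open>K > 0\<close> by (simp add: field_simps)
    then show ?thesis unfolding \<delta>_def using V_pos[OF that] by (intro real_le_lsqrt) auto
  qed
  have lim: "((\<lambda>s. \<bar>K * V s - V s powr q\<bar> / \<delta>) \<longlongrightarrow> 0) at_top"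
    by (intro tendsto_divide_zero tendsto_rabs_zero velocity_and_force_vanish[OF assms(1) V le])
  have "((\<lambda>s. K - V s powr (q - 1)) \<longlongrightarrow> 0) at_top"
  proof (rule Lim_null_comparison[OF _ lim])
    show "\<forall>\<^sub>F s in at_top. norm (K - V s powr (q - 1)) \<le> \<bar>K * V s - V s powr q\<bar> / \<delta>"
    proof (rule eventually_mono[OF eventually_ge_at_top[of b]])
      fix s assume s: "b \<le> s"
      have "\<bar>K * V s - V s powr q\<bar> = V s * \<bar>K - V s powr (q - 1)\<bar>"
      proof -
        have "K * V s - V s powr q = V s * (K - V s powr (q - 1))"
          using V_pos[OF s] by (simp add: powr_q algebra_simps)
        then show ?thesis using V_pos[OF s] by (simp add: abs_mult)
      qed
      also have "\<dots> \<ge> \<delta> * \<bar>K - V s powr (q - 1)\<bar>"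
        using V_ge[OF s] by (intro mult_right_mono) auto
      finally (xtrans) show "norm (K - V s powr (q - 1)) \<le> \<bar>K * V s - V s powr q\<bar> / \<delta>"
        using \<open>\<delta> > 0\<close> by (simp add: field_simps)
    qed
  qed
  then have "((\<lambda>s. K - (K - V s powr (q - 1))) \<longlongrightarrow> K - 0) at_top"
    by (intro tendsto_intros)
  then have "((\<lambda>s. (V s powr (q - 1)) powr (1 / (q - 1))) \<longlongrightarrow> K powr (1 / (q - 1))) at_top"
    using \<open>K > 0\<close> by (intro tendsto_intros) auto
  then show ?thesis
  proof (rule Lim_transform_eventually)
    show "\<forall>\<^sub>F s in at_top. (V s powr (q - 1)) powr (1 / (q - 1)) = V s"
      using V_pos q_gt_1 by (intro eventually_mono[OF eventually_ge_at_top[of b]]) (simp add: powr_powr abs_of_pos)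
  qed
qed

text \<open>Where the force vanishes, the potential equals \<open>- k * V^2\<close> with the
  positive constant \<open>k\<close> below. Nonnegative energy with vanishing velocity and force
  thus leaves room only for \<open>V = 0\<close>.\<close>

lemma decays_to_zero:
  assumes "c > 0" "K > 0" and V: "solves {a..} V U" and le: "\<And>s. s \<ge> a \<Longrightarrow> V s \<le> M"
    and E: "\<And>s. s \<ge> a \<Longrightarrow> energy V U s \<ge> 0"
  shows "(V \<longlongrightarrow> 0) at_top"
proof (rule tendstoI)
  fix \<delta> :: real assume "\<delta> > 0"
  note lim = velocity_and_force_vanish[OF assms(1) V le]
  define k where "k = K / 2 - K / (q + 1)"
  have "k > 0" using \<open>K > 0\<close> q_gt_1 by (simp add: k_def field_simps)
  have "((\<lambda>s. (U s)\<^sup>2 / 2 + \<bar>K * V s - V s powr q\<bar> * (M / (q + 1))) \<longlongrightarrow> 0\<^sup>2 / 2 + \<bar>0\<bar> * (M / (q + 1))) at_top"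
    by (intro tendsto_intros lim) auto
  then have "\<forall>\<^sub>F s in at_top. (U s)\<^sup>2 / 2 + \<bar>K * V s - V s powr q\<bar> * (M / (q + 1)) < k * \<delta>\<^sup>2"
    using \<open>k > 0\<close> \<open>\<delta> > 0\<close> by (intro order_tendstoD) auto
  then show "\<forall>\<^sub>F s in at_top. dist (V s) 0 < \<delta>"
    using eventually_ge_at_top[of a]
  proof eventually_elim
    case (elim s)
    have "V s > 0" using solvesD(1)[OF V] elim by simp
    have "V s * (V s powr q - K * V s) \<le> V s * \<bar>K * V s - V s powr q\<bar>"
      using \<open>V s > 0\<close> by (intro mult_left_mono) auto
    also have "\<dots> \<le> M * \<bar>K * V s - V s powr q\<bar>"
      using le[OF elim(2)] by (intro mult_right_mono) auto
    finally have "V s * (V s powr q - K * V s) \<le> M * \<bar>K * V s - V s powr q\<bar>" .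
    then have "V s * (V s powr q - K * V s) / (q + 1) \<le> M * \<bar>K * V s - V s powr q\<bar> / (q + 1)"
      using q_gt_1 by (intro divide_right_mono) auto
    moreover have "potential (V s) = V s * (V s powr q - K * V s) / (q + 1) - k * (V s)\<^sup>2"
    proof -
      have "potential (V s) = V s * V s powr q / (q + 1) - K * (V s)\<^sup>2 / 2"
        using \<open>V s > 0\<close> by (simp add: potential_pos powr_add)
      then show ?thesis
        unfolding k_def divide_inverse by (simp add: algebra_simps power2_eq_square)
    qed
    moreover have "0 \<le> (U s)\<^sup>2 / 2 + potential (V s)"
      using E[OF elim(2)] by (simp add: energy_def)
    ultimately have "k * (V s)\<^sup>2 < k * \<delta>\<^sup>2"
      using elim(1) by (simp add: mult.commute)
    then have "(V s)\<^sup>2 < \<delta>\<^sup>2" using \<open>k > 0\<close> by simp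
    then show ?case
      using power_less_imp_less_base[of "V s" 2 \<delta>] \<open>\<delta> > 0\<close> \<open>V s > 0\<close> by simp
  qed
qed

section \<open>Decay rate through a Riccati equation\<close>

text \<open>The quadratic part of the Riccati equation for \<open>z = U / V\<close> factors with
  roots \<nu> and \<open>- \<mu>\<close>, the exponents of the equation linearized at 0 without
  drift. Adding \<mu> measures the distance to the decaying exponent.\<close>

lemma log_derivative:
  assumes V: "solves I V U" "s \<in> I" and K: "K = \<nu> * \<mu>" and c: "c = \<mu> - \<nu>"
  shows "((\<lambda>s. U s / V s + \<mu>) has_real_derivative
     (\<nu> - U s / V s) * (U s / V s + \<mu>) + (h s * V s powr (r - 1) * (U s / V s) - V s powr (q - 1))) (at s)"
proof -
  note S = solvesD[OF V]
  have der: "((\<lambda>s. U s / V s + \<mu>) has_real_derivative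
      (accel s (V s) (U s) * V s - U s * U s) / (V s * V s) + 0) (at s)"
    using S(1) by (intro DERIV_add DERIV_divide S DERIV_const) auto
  have "(accel s (V s) (U s) * V s - U s * U s) / (V s * V s) =
      accel s (V s) (U s) / V s - (U s / V s) * (U s / V s)"
    using S(1) by (simp add: diff_divide_distrib)
  moreover have "accel s (V s) (U s) / V s =
      - c * (U s / V s) + K - V s powr (q - 1) + h s * V s powr (r - 1) * (U s / V s)"
    using S(1) by (simp add: accel_def powr_q add_divide_distrib diff_divide_distrib)
  moreover have "- c * z + K - z * z = (\<nu> - z) * (z + \<mu>)" for z
    unfolding K c by (simp add: algebra_simps)
  note this[of "U s / V s"]
  ultimately have "(accel s (V s) (U s) * V s - U s * U s) / (V s * V s) + 0 =
      (\<nu> - U s / V s) * (U s / V s + \<mu>) + (h s * V s powr (r - 1) * (U s / V s) - V s powr (q - 1))"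
    by linarith
  with der show ?thesis by (rule back_subst)
qed

text \<open>The function \<open>J s = ln (V s) + \<mu> * s\<close> has derivative
  \<open>Y = U / V + \<mu>\<close>. It converges because \<open>Y\<close> is nonnegative and its
  integral is bounded; the bound uses a preliminary exponential decay of \<open>V\<close> with some
  rate \<kappa>.\<close>

lemma decay_rate:
  assumes "0 < \<nu>" "\<nu> < \<mu>" and K: "K = \<nu> * \<mu>" and c: "c = \<mu> - \<nu>"
    and V: "solves {a..} V U" and le: "\<And>s. s \<ge> a \<Longrightarrow> V s \<le> M"
    and E: "\<And>s. s \<ge> a \<Longrightarrow> energy V U s \<ge> 0"
  shows "\<exists>C>0. ((\<lambda>s. V s * exp (\<mu> * s)) \<longlongrightarrow> C) at_top"
proof -
  have "K > 0" "c > 0" "\<mu> > 0" using assms(1-4) by auto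
  have lim: "(V \<longlongrightarrow> 0) at_top"
    by (rule decays_to_zero[OF \<open>c > 0\<close> \<open>K > 0\<close> V le E])
  have "((\<lambda>s. V s powr (q - 1)) \<longlongrightarrow> 0) at_top"
  proof (rule tendsto_zero_powrI[OF lim tendsto_const])
    show "\<forall>\<^sub>F s in at_top. 0 \<le> V s"
      using solvesD(1)[OF V] by (intro eventually_mono[OF eventually_ge_at_top[of a]]) (simp add: less_imp_le)
  qed (use q_gt_1 in simp)
  then have "\<forall>\<^sub>F s in at_top. V s powr (q - 1) < (q + 1) * K / 4"
    using \<open>K > 0\<close> q_gt_1 by (intro order_tendstoD) auto
  then obtain b where b: "b \<ge> a" "\<And>s. s \<ge> b \<Longrightarrow> V s powr (q - 1) < (q + 1) * K / 4"
    by (rule eventually_at_topE[where a = a]) blast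
  have ba: "s \<ge> a" if "s \<ge> b" for s using b(1) that by simp
  have V_pos: "0 < V s" and V_der: "(V has_real_derivative U s) (at s)"
    and U_der: "(U has_real_derivative accel s (V s) (U s)) (at s)" if "s \<ge> b" for s
    using solvesD[OF V] ba[OF that] by simp_all
  \<comment> \<open>Beyond \<open>b\<close> the potential is at most \<open>- (K / 4) * V^2\<close>,
    so nonnegative energy means \<open>U^2\<close> \<ge> \<open>(K / 2) * V^2\<close>. In particular
    \<open>U\<close> never vanishes, and as \<open>V\<close> tends to 0 it must be negative.\<close>
  define \<kappa> where "\<kappa> = sqrt (K / 2)"
  have "\<kappa> > 0" using \<open>K > 0\<close> by (simp add: \<kappa>_def)
  have U_ge: "\<kappa> * V s \<le> \<bar>U s\<bar>" if "s \<ge> b" for s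
  proof -
    have "V s powr (q - 1) / (q + 1) \<le> K / 4"
      using b(2)[OF that] q_gt_1 by (simp add: field_simps)
    then have "V s powr (q - 1) / (q + 1) - K / 2 \<le> - (K / 4)"
      by linarith
    then have "(V s)\<^sup>2 * (V s powr (q - 1) / (q + 1) - K / 2) \<le> (V s)\<^sup>2 * (- (K / 4))"
      by (intro mult_left_mono) auto
    then have "potential (V s) \<le> (V s)\<^sup>2 * (- (K / 4))"
      using V_pos[OF that] by (simp add: potential_factor)
    moreover have "(\<kappa> * V s)\<^sup>2 = - 2 * ((V s)\<^sup>2 * (- (K / 4)))"
      using \<open>K > 0\<close> by (simp add: \<kappa>_def power_mult_distrib)
    ultimately have "(\<kappa> * V s)\<^sup>2 \<le> (U s)\<^sup>2"
      using E[OF ba[OF that]] unfolding energy_def by linarith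
    then have "\<bar>\<kappa> * V s\<bar> \<le> \<bar>U s\<bar>" by (simp add: abs_le_square_iff)
    then show ?thesis by simp
  qed
  have U_nz: "U s \<noteq> 0" if "s \<ge> b" for s
    using U_ge[OF that] mult_pos_pos[OF \<open>\<kappa> > 0\<close> V_pos[OF that]] by auto
  have U_neg: "U s < 0" if t: "s \<ge> b" for s
  proof (rule ccontr)
    assume "\<not> U s < 0"
    then have "U s > 0" using U_nz[OF t] by simp
    have pos: "U x \<ge> 0" if "s \<le> x" for x
    proof (rule ccontr)
      assume "\<not> 0 \<le> U x"
      moreover have "continuous_on {s..x} U"
      proof (rule DERIV_atLeastAtMost_imp_continuous_on)
        fix y assume "s \<le> y" "y \<le> x"
        then show "\<exists>d. (U has_real_derivative d) (at y)"
          using U_der[of y] t by auto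
      qed
      ultimately obtain y where "s \<le> y" "U y = 0"
        using IVT2'[of U x 0 s] \<open>U s > 0\<close> \<open>s \<le> x\<close> by auto
      then show False using U_nz[of y] t by simp
    qed
    have "V s \<le> V x" if "s \<le> x" for x
      using pos t by (intro deriv_nonneg_mono[OF that V_der]) auto
    then have "V s \<le> 0"
      by (intro tendsto_lowerbound[OF lim] eventually_mono[OF eventually_ge_at_top[of s]]) auto
    then show False using V_pos[OF t] by simp
  qed
  have U_le: "U s \<le> - \<kappa> * V s" if "s \<ge> b" for s
    using U_ge[OF that] U_neg[OF that] by simp
  define D where "D = V b * exp (\<kappa> * b)"
  have "D > 0" using V_pos[of b] by (simp add: D_def)
  have V_le: "V s \<le> D * exp (- \<kappa> * s)" if "s \<ge> b" for s
  proof -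
    have "V s * exp (\<kappa> * s) \<le> V b * exp (\<kappa> * b)"
    proof (rule deriv_nonpos_antimono[OF that])
      fix x assume x: "b \<le> x"
      have "((\<lambda>x. exp (\<kappa> * x)) has_real_derivative \<kappa> * exp (\<kappa> * x)) (at x)"
        by (auto intro!: derivative_eq_intros)
      from DERIV_mult[OF V_der[OF x] this]
      show "((\<lambda>x. V x * exp (\<kappa> * x)) has_real_derivative (U x + \<kappa> * V x) * exp (\<kappa> * x)) (at x)"
        by (simp add: algebra_simps)
      show "(U x + \<kappa> * V x) * exp (\<kappa> * x) \<le> 0"
        using U_le[OF x] by (intro mult_nonpos_nonneg) auto
    qed
    then have "V s * exp (\<kappa> * s) * exp (- \<kappa> * s) \<le> D * exp (- \<kappa> * s)"
      unfolding D_def by (intro mult_right_mono) auto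
    then show ?thesis by (simp add: mult.assoc exp_add[symmetric])
  qed
  define Z where "Z s = U s / V s" for s
  define Y where "Y s = U s / V s + \<mu>" for s
  define e where "e s = h s * V s powr (r - 1) * Z s - V s powr (q - 1)" for s
  have Y_Z: "Y s = Z s + \<mu>" for s by (simp add: Y_def Z_def)
  have Z_neg: "Z s < 0" if "s \<ge> b" for s
    using U_neg[OF that] V_pos[OF that] by (simp add: Z_def divide_neg_pos)
  have Y_der: "(Y has_real_derivative (\<nu> - Z s) * Y s + e s) (at s)" if "s \<ge> b" for s
    using log_derivative[OF V _ K c] ba[OF that] by (simp add: Y_def[abs_def] Z_def e_def)
  have e_neg: "e s < 0" if "s \<ge> b" for s
  proof -
    have "h s * V s powr (r - 1) * Z s \<le> 0"
      using h_pos[of s] Z_neg[OF that] by (intro mult_nonneg_nonpos) auto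
    moreover have "0 < V s powr (q - 1)"
      using V_pos[OF that] by simp
    ultimately show ?thesis unfolding e_def by linarith
  qed
  \<comment> \<open>A negative \<open>Y\<close> would stay negative because \<open>e < 0\<close>;
    then \<open>\<nu> - Z\<close> \<ge> \<open>- Y\<close> gives \<open>Y'\<close> \<le>
    \<open>- Y^2\<close>, and \<open>Y\<close> would reach minus infinity in finite time.\<close>
  have Y_nonneg: "Y s \<ge> 0" if t: "s \<ge> b" for s
  proof (rule ccontr)
    assume "\<not> Y s \<ge> 0"
    have Y_neg: "Y x < 0" if "s \<le> x" for x
    proof (cases "x = s")
      case False
      then show ?thesis
      proof (intro negative_after_downcrossing[of s x Y, OF Y_der])
        fix y assume "s \<le> y" "Y y = 0"
        then show "(\<nu> - Z y) * Y y + e y < 0" using e_neg[of y] t by simp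
      qed (use that t \<open>\<not> Y s \<ge> 0\<close> in auto)
    qed (use \<open>\<not> Y s \<ge> 0\<close> in simp)
    show False
    proof (rule superlinear_growth_blows_up[of s "\<lambda>x. - Y x" "\<lambda>x. - ((\<nu> - Z x) * Y x + e x)" 1 2])
      fix x assume x: "s \<le> x"
      then have "x \<ge> b" using t by simp
      show "((\<lambda>x. - Y x) has_real_derivative - ((\<nu> - Z x) * Y x + e x)) (at x)"
        by (rule DERIV_minus[OF Y_der[OF \<open>x \<ge> b\<close>]])
      show "0 < - Y x" using Y_neg[OF x] by simp
      have "(- Y x) * (- Y x) \<le> (\<nu> - Z x) * (- Y x)"
        using Y_neg[OF x] \<open>\<mu> > 0\<close> \<open>0 < \<nu>\<close> by (intro mult_right_mono) (auto simp: Y_Z)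
      then show "1 * (- Y x) powr 2 \<le> - ((\<nu> - Z x) * Y x + e x)"
        using Y_neg[OF x] e_neg[OF \<open>x \<ge> b\<close>] by (simp add: power2_eq_square)
    qed auto
  qed
  define J where "J s = ln (V s) + \<mu> * s" for s
  have J_der: "(J has_real_derivative Y s) (at s)" if "s \<ge> b" for s
  proof -
    have "(J has_real_derivative 1 / V s * U s + \<mu> * 1) (at s)"
      unfolding J_def[abs_def]
      by (intro DERIV_add DERIV_cmult DERIV_ident DERIV_chain2[OF DERIV_ln_divide V_der[OF that]] V_pos that)
    then show ?thesis by (simp add: Y_def)
  qed
  have J_mono: "J s \<le> J t" if "b \<le> s" "s \<le> t" for s t
    using that Y_nonneg by (intro deriv_nonneg_mono[OF that(2) J_der]) auto
  define k where "k = \<kappa> * (q - 1)"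
  define B1 where "B1 = D powr (q - 1) / \<nu>"
  define B2 where "B2 = \<beta> * r * M powr (r - 1) * \<mu> / \<nu>"
  have "k > 0" using \<open>\<kappa> > 0\<close> q_gt_1 by (simp add: k_def)
  have "M > 0" using V_pos[of b] le[of b] b(1) by simp
  have "B1 > 0" "B2 > 0"
    using \<open>D > 0\<close> \<open>M > 0\<close> \<open>0 < \<nu>\<close> \<open>\<mu> > 0\<close> \<beta>_pos r_gt_1 by (simp_all add: B1_def B2_def)
  \<comment> \<open>By the Riccati equation \<open>Y - Y' / \<nu>\<close> equals
    \<open>(Z * Y - e) / \<nu>\<close>, where \<open>Z * Y\<close> \<le> 0 and \<open>- e\<close> is
    exponentially small. The two exponentials are primitives, up to sign, of the bounds for its two
    parts, so \<open>R\<close> is nonincreasing and bounds \<open>J\<close>.\<close>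
  define R where "R s = J s - Y s / \<nu> + (B1 / k * exp (- k * s) + B2 * \<beta> * exp (- s / \<beta>))" for s
  have R_anti: "R s \<le> R b" if "s \<ge> b" for s
  proof (rule deriv_nonpos_antimono[OF that])
    fix x assume x: "b \<le> x"
    have "((\<lambda>s. B1 / k * exp (- k * s)) has_real_derivative - B1 * exp (- k * x)) (at x)"
      using \<open>k > 0\<close> by (auto intro!: derivative_eq_intros)
    moreover have "((\<lambda>s. B2 * \<beta> * exp (- s / \<beta>)) has_real_derivative - B2 * exp (- x / \<beta>)) (at x)"
      using \<beta>_pos by (auto intro!: derivative_eq_intros)
    ultimately show "(R has_real_derivative Y x - ((\<nu> - Z x) * Y x + e x) / \<nu> +
        (- B1 * exp (- k * x) + - B2 * exp (- x / \<beta>))) (at x)"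
      unfolding R_def[abs_def] by (intro DERIV_add DERIV_diff J_der[OF x] DERIV_cdivide Y_der[OF x])
    have "Y x - ((\<nu> - Z x) * Y x + e x) / \<nu> = (Z x * Y x - e x) / \<nu>"
      using \<open>0 < \<nu>\<close> by (simp add: field_simps)
    also have "\<dots> \<le> (V x powr (q - 1) + h x * M powr (r - 1) * \<mu>) / \<nu>"
    proof (rule divide_right_mono)
      have "h x * V x powr (r - 1) * (- Z x) \<le> h x * M powr (r - 1) * \<mu>"
      proof (intro mult_mono)
        show "V x powr (r - 1) \<le> M powr (r - 1)"
          using V_pos[OF x] le[OF ba[OF x]] r_gt_1 by (intro powr_mono2) auto
        show "- Z x \<le> \<mu>" using Y_nonneg[OF x] by (simp add: Y_Z)
      qed (use h_pos[of x] Z_neg[OF x] in \<open>auto intro: less_imp_le mult_nonneg_nonneg\<close>)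
      moreover have "Z x * Y x \<le> 0"
        using Z_neg[OF x] Y_nonneg[OF x] by (intro mult_nonpos_nonneg) auto
      ultimately show "Z x * Y x - e x \<le> V x powr (q - 1) + h x * M powr (r - 1) * \<mu>"
        by (simp add: e_def)
    qed (use \<open>0 < \<nu>\<close> in simp)
    also have "\<dots> \<le> B1 * exp (- k * x) + B2 * exp (- x / \<beta>)"
    proof -
      have "V x powr (q - 1) \<le> (D * exp (- \<kappa> * x)) powr (q - 1)"
        using V_pos[OF x] V_le[OF x] q_gt_1 by (intro powr_mono2) auto
      also have "\<dots> = D powr (q - 1) * exp (- k * x)"
        using \<open>D > 0\<close> by (simp add: powr_mult exp_powr_real k_def mult_ac)
      finally have "V x powr (q - 1) / \<nu> \<le> B1 * exp (- k * x)"
        using \<open>0 < \<nu>\<close> by (simp add: B1_def divide_right_mono)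
      moreover have "h x * M powr (r - 1) * \<mu> / \<nu> = B2 * exp (- x / \<beta>)"
        by (simp add: h_def B2_def)
      ultimately show ?thesis by (simp add: add_divide_distrib)
    qed
    finally show "Y x - ((\<nu> - Z x) * Y x + e x) / \<nu> + (- B1 * exp (- k * x) + - B2 * exp (- x / \<beta>)) \<le> 0"
      by simp
  qed
  have J_le: "J s \<le> R b + \<mu> / \<nu>" if s: "s \<ge> b" for s
  proof -
    have "0 \<le> B1 / k * exp (- k * s) + B2 * \<beta> * exp (- s / \<beta>)"
      using \<open>B1 > 0\<close> \<open>B2 > 0\<close> \<open>k > 0\<close> \<beta>_pos by simp
    then have "J s \<le> R b + Y s / \<nu>"
      using R_anti[OF s] unfolding R_def by linarith
    moreover have "Y s / \<nu> \<le> \<mu> / \<nu>"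
      using Z_neg[OF s] \<open>0 < \<nu>\<close> by (intro divide_right_mono) (auto simp: Y_Z)
    ultimately show ?thesis by simp
  qed
  obtain l where l: "(J \<longlongrightarrow> l) at_top"
    by (rule increasing_bounded_converges[OF J_mono J_le])
  then have "((\<lambda>s. exp (J s)) \<longlongrightarrow> exp l) at_top"
    by (rule tendsto_exp)
  then have "((\<lambda>s. V s * exp (\<mu> * s)) \<longlongrightarrow> exp l) at_top"
    by (rule Lim_transform_eventually)
      (use V_pos in \<open>auto intro!: eventually_mono[OF eventually_ge_at_top[of b]] simp: J_def exp_add\<close>)
  then show ?thesis by (intro exI[of _ "exp l"]) simp
qed

section \<open>Potential well, overshoot and trapping\<close>

text \<open>For \<open>K > 0\<close> this is the positive zero of the potential, the rim of the well
  that holds solutions of negative energy.\<close>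

definition zero_level :: real where
  "zero_level = ((q + 1) * K / 2) powr (1 / (q - 1))"

lemma potential_neg_imp:
  assumes "K > 0" "x \<ge> 0" "potential x < 0"
  shows "0 < x" "x < zero_level"
proof -
  show "0 < x" using assms by (cases "x = 0") auto
  then have "x powr (q - 1) / (q + 1) - K / 2 < 0"
    using assms(3) by (simp add: potential_factor mult_less_0_iff)
  then have "x powr (q - 1) < (q + 1) * K / 2"
    using q_gt_1 by (simp add: field_simps)
  then have "(x powr (q - 1)) powr (1 / (q - 1)) < zero_level"
    unfolding zero_level_def using q_gt_1 by (intro powr_less_mono2) auto
  then show "x < zero_level"
    using \<open>0 < x\<close> q_gt_1 by (simp add: powr_powr)
qed

lemma potential_ge:
  assumes "K > 0" "x > 0"
  shows "- (K * zero_level\<^sup>2 / 2) \<le> potential x"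
proof (cases "potential x < 0")
  case True
  then have "x \<le> zero_level"
    using potential_neg_imp[of x] assms by simp
  then show ?thesis
    using potential_lower_bound[OF assms(2)] assms(1) by simp
next
  case False
  moreover have "0 \<le> K * zero_level\<^sup>2 / 2" using assms by simp
  ultimately show ?thesis by linarith
qed

text \<open>A solution starting at rest from a very high level keeps so much energy over two units of
  time that it has to run into \<open>V = 0\<close>.\<close>

lemma overshoot:
  assumes "c > 0" "K > 0"
  shows "\<forall>\<^sub>F M in at_top. \<forall>V U a. solves {a..} V U \<longrightarrow> V a = M \<longrightarrow> U a \<noteq> 0"
proof -
  \<comment> \<open>Over two units of time the energy shifted by \<open>b\<close> loses at most the
    factor \<open>exp (- 4 * c)\<close>, so about \<open>2 * d * M powr (q + 1)\<close> survives.
    Below \<open>M / k\<close> the potential can hold at most half of it. The shift \<open>b\<close>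
    makes the potential nonnegative.\<close>
  define k where "k = 2 * exp (4 * c)"
  define b where "b = K * zero_level\<^sup>2 / 2"
  define d where "d = exp (- 4 * c) / (2 * (q + 1))"
  have "k \<ge> 2" using \<open>c > 0\<close> by (simp add: k_def)
  have "b \<ge> 0" using \<open>K > 0\<close> by (simp add: b_def)
  have "d > 0" using q_gt_1 by (simp add: d_def)
  \<comment> \<open>The three bounds give in turn: above \<open>M / k\<close> the linear part of the
    force is at most half of the other; the force brings \<open>V\<close> below \<open>M / k\<close>
    within one unit of time; the surviving energy absorbs the lower order terms with
    \<open>M^2 / 2\<close> to spare.\<close>
  define T where "T = max (2 * K * k powr (q - 1)) (max (4 * (1 + c) * k powr q) ((K / 2 + 1 / 2 + b) / d))"
  have "filterlim (\<lambda>M::real. M powr (q - 1)) at_top at_top"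
    using q_gt_1 by (intro real_powr_at_top) simp
  then have "\<forall>\<^sub>F M::real in at_top. T \<le> M powr (q - 1)"
    by (simp add: filterlim_at_top)
  then show ?thesis
    using eventually_ge_at_top[of 1]
  proof eventually_elim
    case (elim M)
    have "M > 0" using elim by simp
    have T: "2 * K * k powr (q - 1) \<le> M powr (q - 1)" "4 * (1 + c) * k powr q \<le> M powr (q - 1)"
      "(K / 2 + 1 / 2 + b) / d \<le> M powr (q - 1)"
      using elim(1) by (simp_all add: T_def)
    have cond1: "2 * K \<le> (M / k) powr (q - 1)"
      using T(1) \<open>M > 0\<close> \<open>k \<ge> 2\<close> by (simp add: powr_divide field_simps)
    have cond2: "4 * (1 + c) * M \<le> (M / k) powr q"
    proof -
      have "4 * (1 + c) * k powr q * M \<le> M powr (q - 1) * M"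
        using T(2) \<open>M > 0\<close> by (intro mult_right_mono) auto
      also have "\<dots> = M powr q" using powr_q[OF \<open>M > 0\<close>] by (simp add: mult.commute)
      finally show ?thesis using \<open>M > 0\<close> \<open>k \<ge> 2\<close> by (simp add: powr_divide field_simps)
    qed
    have cond3: "(K / 2 + 1 / 2) * M\<^sup>2 + b \<le> M powr (q + 1) * d"
    proof -
      have "b \<le> b * M\<^sup>2"
        using \<open>b \<ge> 0\<close> elim(2) mult_left_mono[of 1 "M\<^sup>2" b] by simp
      then have "(K / 2 + 1 / 2) * M\<^sup>2 + b \<le> M\<^sup>2 * (K / 2 + 1 / 2 + b)"
        by (simp add: algebra_simps)
      also have "\<dots> \<le> M\<^sup>2 * (M powr (q - 1) * d)"
        using T(3) \<open>d > 0\<close> by (intro mult_left_mono) (auto simp: field_simps)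
      finally show ?thesis using powr_q_plus_1[OF \<open>M > 0\<close>] by (simp add: mult.assoc)
    qed
    show "\<forall>V U a. solves {a..} V U \<longrightarrow> V a = M \<longrightarrow> U a \<noteq> 0"
    proof (intro allI impI notI)
      fix V U a assume V: "solves {a..} V U" and Va: "V a = M" and Ua: "U a = 0"
      have V_pos: "0 < V s" and V_der: "(V has_real_derivative U s) (at s)"
        and U_der: "(U has_real_derivative accel s (V s) (U s)) (at s)" if "s \<ge> a" for s
        using solvesD[OF V] that by simp_all
      have pot: "potential (V s) + b \<ge> 0" if "s \<ge> a" for s
        using potential_ge[OF \<open>K > 0\<close> V_pos[OF that]] unfolding b_def by linarith
      have Ea: "energy V U a = M powr (q + 1) / (q + 1) - K * M\<^sup>2 / 2"
        using \<open>M > 0\<close> by (simp add: energy_def Va Ua potential_pos)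
      \<comment> \<open>Energy is lost at rate at most \<open>c * U^2\<close>, hence at most
        \<open>2 * c\<close> times the shifted energy.\<close>
      have E_ge: "(energy V U a + b) * exp (- 4 * c) \<le> energy V U s + b" if s: "s \<ge> a" "s \<le> a + 2" for s
      proof -
        have "(energy V U a + b) * exp (2 * c * a) \<le> (energy V U s + b) * exp (2 * c * s)"
        proof (rule deriv_nonneg_mono[OF s(1)])
          fix x assume x: "a \<le> x"
          have 1: "((\<lambda>x. exp (2 * c * x)) has_real_derivative 2 * c * exp (2 * c * x)) (at x)"
            by (auto intro!: derivative_eq_intros)
          have 2: "((\<lambda>x. energy V U x + b) has_real_derivative
             (U x)\<^sup>2 * (h x * V x powr (r - 1) - c) + 0) (at x)"
            using x by (intro DERIV_add energy_derivative[OF V] DERIV_const) simp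
          show "((\<lambda>x. (energy V U x + b) * exp (2 * c * x)) has_real_derivative
              ((U x)\<^sup>2 * (h x * V x powr (r - 1) - c) + 0) * exp (2 * c * x) +
              2 * c * exp (2 * c * x) * (energy V U x + b)) (at x)"
            by (rule DERIV_mult[OF 2 1])
          have "0 \<le> (U x)\<^sup>2 * (h x * V x powr (r - 1))" "0 \<le> 2 * c * (potential (V x) + b)"
            using h_pos[of x] pot[OF x] \<open>c > 0\<close> by simp_all
          then have "0 \<le> (U x)\<^sup>2 * (h x * V x powr (r - 1)) + 2 * c * (potential (V x) + b)"
            by (rule add_nonneg_nonneg)
          also have "\<dots> = (U x)\<^sup>2 * (h x * V x powr (r - 1) - c) + 2 * c * (energy V U x + b)"
            by (simp add: energy_def algebra_simps)
          finally have "0 \<le> ((U x)\<^sup>2 * (h x * V x powr (r - 1) - c) + 2 * c * (energy V U x + b)) * exp (2 * c * x)"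
            by simp
          then show "0 \<le> ((U x)\<^sup>2 * (h x * V x powr (r - 1) - c) + 0) * exp (2 * c * x) +
              2 * c * exp (2 * c * x) * (energy V U x + b)"
            by (simp add: algebra_simps)
        qed
        then have "(energy V U a + b) * exp (2 * c * a) * exp (- (2 * c * s)) \<le>
            (energy V U s + b) * exp (2 * c * s) * exp (- (2 * c * s))"
          by (intro mult_right_mono) auto
        then have *: "(energy V U a + b) * exp (2 * c * a - 2 * c * s) \<le> energy V U s + b"
          by (simp add: mult.assoc exp_add[symmetric])
        have "2 * c * (s - a) \<le> 2 * c * 2"
          using s \<open>c > 0\<close> by (intro mult_left_mono) auto
        then have "exp (- 4 * c) \<le> exp (2 * c * a - 2 * c * s)"
          by (simp add: algebra_simps)
        moreover have "energy V U a + b \<ge> 0"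
          using pot[of a] by (simp add: energy_def Ua)
        ultimately have "(energy V U a + b) * exp (- 4 * c) \<le> (energy V U a + b) * exp (2 * c * a - 2 * c * s)"
          by (intro mult_left_mono)
        then show ?thesis using * by simp
      qed
      have E_big: "M powr (q + 1) * d + M\<^sup>2 / 2 \<le> energy V U s" if s: "s \<ge> a" "s \<le> a + 2" for s
      proof -
        have "(energy V U a + b) * exp (- 4 * c) =
            2 * (M powr (q + 1) * d) - K * M\<^sup>2 / 2 * exp (- 4 * c) + b * exp (- 4 * c)"
          using q_gt_1 by (simp add: Ea d_def field_simps)
        moreover have "K * M\<^sup>2 / 2 * exp (- 4 * c) \<le> K * M\<^sup>2 / 2"
          using \<open>c > 0\<close> \<open>K > 0\<close> mult_left_mono[of "exp (- 4 * c)" 1 "K * M\<^sup>2 / 2"] by simp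
        moreover have "0 \<le> b * exp (- 4 * c)"
          using \<open>b \<ge> 0\<close> by simp
        moreover have "(K / 2 + 1 / 2) * M\<^sup>2 = K * M\<^sup>2 / 2 + M\<^sup>2 / 2"
          by (simp add: algebra_simps)
        ultimately show ?thesis using E_ge[OF s] cond3 by linarith
      qed
      have E_pos: "energy V U s > 0" if s: "s \<ge> a" "s \<le> a + 2" for s
      proof -
        have "0 \<le> M powr (q + 1) * d" "0 < M\<^sup>2 / 2"
          using \<open>d > 0\<close> \<open>M > 0\<close> by simp_all
        then show ?thesis using E_big[OF s] by linarith
      qed
      have down: "accel s (V s) (U s) < 0" if "a \<le> s" "s \<le> a + 2" "U s = 0" for s
        using potential_pos_imp[OF V_pos[OF that(1)]] E_pos[OF that(1,2)] that(3)
        by (simp add: accel_def energy_def)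
      have U_neg: "U s < 0" if "a < s" "s \<le> a + 2" for s
        by (rule negative_after_downcrossing[OF U_der down _ that]) (use Ua in auto)
      have U_le: "U s \<le> 0" if "a \<le> s" "s \<le> a + 2" for s
        using U_neg[of s] that Ua by (cases "s = a") auto
      have V_anti: "V t \<le> V s" if "a \<le> s" "s \<le> t" "t \<le> a + 2" for s t
        using that by (intro deriv_nonpos_antimono[OF that(2) V_der U_le]) auto
      \<comment> \<open>If \<open>V\<close> stayed above \<open>M / k\<close> for one unit of time,
        the force would be at most \<open>- L\<close>; integrating first \<open>U + c * V\<close>
        and then \<open>V\<close> would give \<open>V (a + 1)\<close> \<le> 0.\<close>
      have half: "V (a + 1) < M / k"
      proof (rule ccontr)
        assume "\<not> V (a + 1) < M / k"
        then have V_ge: "M / k \<le> V s" if "a \<le> s" "s \<le> a + 1" for s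
          using V_anti[of s "a + 1"] that by simp
        define L where "L = (M / k) powr q / 2"
        have "M / k > 0" using \<open>M > 0\<close> \<open>k \<ge> 2\<close> by simp
        have force: "K * V s - V s powr q \<le> - L" if s: "a \<le> s" "s \<le> a + 1" for s
        proof -
          have "(M / k) powr (q - 1) \<le> V s powr (q - 1)"
            using V_ge[OF s] \<open>M / k > 0\<close> q_gt_1 by (intro powr_mono2) auto
          then have "V s * (2 * K) \<le> V s * V s powr (q - 1)"
            using cond1 V_pos[OF s(1)] by (intro mult_left_mono) auto
          then have "K * V s - V s powr q \<le> - (V s powr q / 2)"
            using powr_q[OF V_pos[OF s(1)]] by (simp add: field_simps)
          moreover have "(M / k) powr q \<le> V s powr q"
            using V_ge[OF s] \<open>M / k > 0\<close> q_gt_1 by (intro powr_mono2) auto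
          ultimately show ?thesis by (simp add: L_def)
        qed
        have H: "U s + c * V s \<le> (U a + c * V a) + (- L) * (s - a)" if s: "a \<le> s" "s \<le> a + 1" for s
        proof (rule deriv_bound_above[OF s(1)])
          fix x assume "a \<le> x" "x \<le> s"
          then have x: "a \<le> x" "x \<le> a + 1" using s by auto
          show "((\<lambda>s. U s + c * V s) has_real_derivative accel x (V x) (U x) + c * U x) (at x)"
            by (intro DERIV_add DERIV_cmult U_der V_der x)
          have "h x * V x powr (r - 1) * U x \<le> 0"
            using h_pos[of x] U_le[of x] x by (intro mult_nonneg_nonpos) auto
          then show "accel x (V x) (U x) + c * U x \<le> - L"
            using force[OF x] by (simp add: accel_def)
        qed
        have "V (a + 1) - c * M * (a + 1 - a) + L / 2 * (a + 1 - a)\<^sup>2 \<le> V a - c * M * (a - a) + L / 2 * (a - a)\<^sup>2"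
        proof (rule deriv_nonpos_antimono[where f = "\<lambda>s. V s - c * M * (s - a) + L / 2 * (s - a)\<^sup>2"])
          fix x assume x: "a \<le> x" "x \<le> a + 1"
          show "((\<lambda>s. V s - c * M * (s - a) + L / 2 * (s - a)\<^sup>2) has_real_derivative
              U x - c * M + L * (x - a)) (at x)"
            by (auto intro!: derivative_eq_intros V_der x)
          have "0 \<le> c * V x" using V_pos[OF x(1)] \<open>c > 0\<close> by simp
          then show "U x - c * M + L * (x - a) \<le> 0"
            using H[OF x] by (simp add: Va Ua)
        qed simp
        moreover have "(1 + c) * M \<le> L / 2" using cond2 unfolding L_def by (simp add: algebra_simps)
        ultimately have "V (a + 1) \<le> 0" by (simp add: Va algebra_simps)
        then show False using V_pos[of "a + 1"] by simp
      qed
      \<comment> \<open>Below \<open>M / k\<close> the potential leaves \<open>U^2\<close> \<ge>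
        \<open>M^2\<close>, so in the second unit of time \<open>V\<close> falls by
        \<open>M\<close>, more than what is left of it.\<close>
      have "V (a + 2) \<le> V (a + 1) + (- M) * (a + 2 - (a + 1))"
      proof (rule deriv_bound_above)
        fix x assume x: "a + 1 \<le> x" "x \<le> a + 2"
        then show "(V has_real_derivative U x) (at x)" by (intro V_der) simp
        have "V x > 0" using V_pos[of x] x by simp
        have "V x \<le> M / k" using V_anti[of "a + 1" x] x half by simp
        then have "V x powr (q + 1) \<le> (M / k) powr (q + 1)"
          using \<open>V x > 0\<close> q_gt_1 by (intro powr_mono2) auto
        also have "\<dots> = M powr (q + 1) / k powr (q + 1)"
          using \<open>M > 0\<close> \<open>k \<ge> 2\<close> by (simp add: powr_divide)
        also have "\<dots> \<le> M powr (q + 1) / k"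
          using \<open>k \<ge> 2\<close> q_gt_1 powr_mono[of 1 "q + 1" k] by (intro divide_left_mono) auto
        also have "\<dots> = (q + 1) * (M powr (q + 1) * d)"
        proof -
          have "d * (2 * (q + 1)) = exp (- 4 * c)"
            unfolding d_def using q_gt_1 by (intro nonzero_eq_divide_eq[THEN iffD1, OF _ refl]) simp
          then have "(q + 1) * d = exp (- 4 * c) / 2"
            by (simp add: algebra_simps)
          also have "\<dots> = 1 / k"
            by (simp add: k_def exp_minus field_simps)
          finally have "M powr (q + 1) * ((q + 1) * d) = M powr (q + 1) / k"
            by simp
          then show ?thesis by (simp add: mult_ac)
        qed
        finally have "V x powr (q + 1) / (q + 1) \<le> M powr (q + 1) * d"
          using q_gt_1 by (simp add: field_simps)
        moreover have "potential (V x) \<le> V x powr (q + 1) / (q + 1)"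
          using \<open>V x > 0\<close> \<open>K > 0\<close> by (simp add: potential_pos)
        ultimately have "M\<^sup>2 \<le> (U x)\<^sup>2"
          using E_big[of x] x by (simp add: energy_def)
        then have "\<bar>M\<bar> \<le> \<bar>U x\<bar>" by (simp add: abs_le_square_iff)
        then show "U x \<le> - M" using U_le[of x] x \<open>M > 0\<close> by simp
      qed simp
      moreover have "M / k \<le> M" using \<open>M > 0\<close> \<open>k \<ge> 2\<close> by (simp add: divide_le_eq)
      ultimately have "V (a + 2) \<le> 0" using half by simp
      then show False using V_pos[of "a + 2"] by simp
    qed
  qed
qed

text \<open>A Gronwall bound: \<open>V^2 + U^2\<close> decays at most exponentially and cannot
  vanish at \<open>b\<close>. The drift enters with a favorable sign, so \<open>C\<close> collects
  only the remaining coefficients, with \<open>M\<close> a bound for \<open>V\<close> on the compact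
  interval. The equation is available only before \<open>b\<close>, where \<open>V\<close> is
  positive; continuity covers the end.\<close>

lemma no_double_zero:
  assumes "a < b" and V: "solves {a..<b} V U"
    and cont: "continuous_on {a..b} V" "continuous_on {a..b} U" and zero: "V b = 0" "U b = 0"
  shows False
proof -
  have "bounded (V ` {a..b})"
    using cont(1) by (intro compact_imp_bounded compact_continuous_image) auto
  then obtain M where "\<forall>y\<in>V ` {a..b}. \<bar>y\<bar> \<le> M"
    unfolding bounded_iff real_norm_def by blast
  then have M: "\<bar>V x\<bar> \<le> M" if "x \<in> {a..b}" for x
    using that by blast
  define C where "C = 1 + \<bar>K\<bar> + 2 * \<bar>c\<bar> + M powr (q - 1)"
  let ?x = "\<lambda>s. ((V s)\<^sup>2 + (U s)\<^sup>2) * exp (C * s)"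
  have "?x a \<le> ?x b"
  proof (rule DERIV_nonneg_imp_increasing_open[where f = ?x])
    fix s assume s: "a < s" "s < b"
    then have sI: "s \<in> {a..<b}" by simp
    note S = solvesD[OF V sI]
    define A where "A = accel s (V s) (U s)"
    have d1: "((\<lambda>s. exp (C * s)) has_real_derivative C * exp (C * s)) (at s)"
      by (auto intro!: derivative_eq_intros)
    have d2: "((\<lambda>s. (V s)\<^sup>2 + (U s)\<^sup>2) has_real_derivative 2 * V s * U s + 2 * U s * A) (at s)"
      unfolding A_def by (auto intro!: derivative_eq_intros S)
    have "0 \<le> 2 * V s * U s + 2 * U s * A + C * ((V s)\<^sup>2 + (U s)\<^sup>2)"
    proof -
      have am: "\<bar>2 * (V s * U s)\<bar> \<le> (V s)\<^sup>2 + (U s)\<^sup>2"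
        using zero_le_power2[of "V s - U s"] zero_le_power2[of "V s + U s"]
        by (simp add: power2_diff power2_sum abs_le_iff)
      define y where "y = 1 + K - V s powr (q - 1)"
      have "V s powr (q - 1) \<le> M powr (q - 1)"
        using M[of s] S(1) s q_gt_1 by (intro powr_mono2) auto
      moreover have "0 \<le> V s powr (q - 1)" by simp
      ultimately have "\<bar>y\<bar> \<le> 1 + \<bar>K\<bar> + M powr (q - 1)"
        unfolding y_def by linarith
      then have "\<bar>y\<bar> * \<bar>2 * (V s * U s)\<bar> \<le> (1 + \<bar>K\<bar> + M powr (q - 1)) * ((V s)\<^sup>2 + (U s)\<^sup>2)"
        using am by (intro mult_mono) auto
      then have "- ((1 + \<bar>K\<bar> + M powr (q - 1)) * ((V s)\<^sup>2 + (U s)\<^sup>2)) \<le> y * (2 * (V s * U s))"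
        unfolding abs_mult[symmetric] by linarith
      moreover have "c * (U s)\<^sup>2 \<le> \<bar>c\<bar> * ((V s)\<^sup>2 + (U s)\<^sup>2)"
        by (rule mult_mono) auto
      moreover have "0 \<le> 2 * (h s * V s powr (r - 1) * (U s)\<^sup>2)"
        using h_pos[of s] by simp
      moreover have "2 * V s * U s + 2 * U s * A = y * (2 * (V s * U s)) - 2 * (c * (U s)\<^sup>2)
          + 2 * (h s * V s powr (r - 1) * (U s)\<^sup>2)"
        unfolding A_def accel_def y_def powr_q[OF S(1)] by (simp add: algebra_simps power2_eq_square)
      moreover have "C * ((V s)\<^sup>2 + (U s)\<^sup>2) = (1 + \<bar>K\<bar> + M powr (q - 1)) * ((V s)\<^sup>2 + (U s)\<^sup>2)
          + 2 * (\<bar>c\<bar> * ((V s)\<^sup>2 + (U s)\<^sup>2))"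
        by (simp add: C_def algebra_simps)
      ultimately show ?thesis by linarith
    qed
    then have "0 \<le> (2 * V s * U s + 2 * U s * A + C * ((V s)\<^sup>2 + (U s)\<^sup>2)) * exp (C * s)"
      by simp
    also have "\<dots> = (2 * V s * U s + 2 * U s * A) * exp (C * s) + C * exp (C * s) * ((V s)\<^sup>2 + (U s)\<^sup>2)"
      by (simp add: algebra_simps)
    finally show "\<exists>y. (?x has_real_derivative y) (at s) \<and> 0 \<le> y"
      using DERIV_mult[OF d2 d1] by blast
  qed (use \<open>a < b\<close> cont in \<open>auto intro!: continuous_intros\<close>)
  moreover have "0 < ((V a)\<^sup>2 + (U a)\<^sup>2) * exp (C * a)"
    using solvesD(1)[OF V, of a] \<open>a < b\<close> by (intro mult_pos_pos add_pos_nonneg) auto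
  ultimately show False using zero by simp
qed

text \<open>Up to the first time at which \<open>V\<close> \<le> 0 or the energy is nonnegative,
  \<open>V\<close> lies inside the well, where the energy dissipates. So the energy is still
  negative at that time, hence \<open>V = 0\<close> there, but at \<open>V = 0\<close> the energy is
  nonnegative. The equation is required only inside the well because a truncated equation will be
  fed in.\<close>

lemma trapping:
  assumes "K > 0" and cont: "continuous_on {a..} V" "continuous_on {a..} U"
    and start: "0 < V a" "energy V U a < 0"
    and ode: "\<And>s. a \<le> s \<Longrightarrow> 0 < V s \<Longrightarrow> V s < zero_level \<Longrightarrow> solves {s} V U"
    and damp: "\<And>s. a \<le> s \<Longrightarrow> 0 < V s \<Longrightarrow> V s < zero_level \<Longrightarrow> h s * V s powr (r - 1) \<le> c"
    and "a \<le> t"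
  shows "0 < V t \<and> energy V U t < 0"
proof (rule ccontr)
  assume neg: "\<not> (0 < V t \<and> energy V U t < 0)"
  have cont_t: "continuous_on {a..t} V" "continuous_on {a..t} (energy V U)"
    by (auto intro!: continuous_on_energy continuous_on_subset[OF cont(1)] continuous_on_subset[OF cont(2)])
  then have "continuous_on {a..t} (\<lambda>s. min (V s) (- energy V U s))"
    by (intro continuous_intros)
  moreover have "min (V t) (- energy V U t) \<le> 0"
    using neg by (auto simp: min_le_iff_disj)
  ultimately obtain s where s: "a \<le> s" "s \<le> t" "min (V s) (- energy V U s) \<le> 0"
    and s_first: "\<forall>x. a \<le> x \<longrightarrow> x < s \<longrightarrow> 0 < min (V x) (- energy V U x)"
    using first_nonpositive[of a t "\<lambda>s. min (V s) (- energy V U s)"] \<open>a \<le> t\<close> by auto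
  have good: "0 < V x" "energy V U x < 0" if "a \<le> x" "x < s" for x
    using s_first that by simp_all
  have "a \<noteq> s" using s(3) start by auto
  then have "a < s" using s(1) by simp
  have level: "V x < zero_level" if "a \<le> x" "x < s" for x
  proof -
    have "potential (V x) < 0"
      using good(2)[OF that] zero_le_power2[of "U x"] unfolding energy_def by linarith
    then show ?thesis using potential_neg_imp(2)[OF \<open>K > 0\<close>] good(1)[OF that] by simp
  qed
  have "energy V U s \<le> energy V U a"
  proof (rule DERIV_nonpos_imp_decreasing_open[where f = "energy V U"])
    fix x assume x: "a < x" "x < s"
    then have "solves {x} V U" using ode good level by simp
    then have "(energy V U has_real_derivative (U x)\<^sup>2 * (h x * V x powr (r - 1) - c)) (at x)"
      by (rule energy_derivative) simp
    moreover have "(U x)\<^sup>2 * (h x * V x powr (r - 1) - c) \<le> 0"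
      using damp[of x] good[of x] level[of x] x by (intro mult_nonneg_nonpos) auto
    ultimately show "\<exists>y. (energy V U has_real_derivative y) (at x) \<and> y \<le> 0" by blast
  qed (use \<open>a < s\<close> s(2) in \<open>auto intro!: continuous_on_subset[OF cont_t(2)]\<close>)
  then have "energy V U s < 0" using start by simp
  then have "V s \<le> 0" using s(3) by (simp add: min_le_iff_disj)
  moreover have "0 \<le> V s"
  proof (rule continuous_ge_on_closure[of "{a..<s}" V])
    show "continuous_on (closure {a..<s}) V"
      using \<open>a < s\<close> s(2) by (auto intro!: continuous_on_subset[OF cont_t(1)])
  qed (use \<open>a < s\<close> good in \<open>auto intro: less_imp_le\<close>)
  ultimately show False using \<open>energy V U s < 0\<close> by (simp add: energy_def)
qed

end

section \<open>A radial Volterra equation\<close>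

text \<open>The contraction principle in a Bielecki norm: division by \<omega> turns functions of
  controlled growth into bounded ones, on which \<open>T\<close> contracts by 1 / 2 on the whole
  half-line at once.\<close>

lemma weighted_fixed_point:
  fixes T :: "(real \<Rightarrow> real) \<Rightarrow> real \<Rightarrow> real"
  assumes w_cont: "continuous_on {0..} \<omega>" and w_ge: "\<And>x. x \<ge> 0 \<Longrightarrow> \<omega> x \<ge> 1" and "C \<ge> 0"
    and T_cont: "\<And>v. continuous_on {0..} v \<Longrightarrow> continuous_on {0..} (T v)"
    and T_bound: "\<And>v x. continuous_on {0..} v \<Longrightarrow> x \<ge> 0 \<Longrightarrow> \<bar>T v x\<bar> \<le> C * \<omega> x"
    and T_contr: "\<And>v w B x. continuous_on {0..} v \<Longrightarrow> continuous_on {0..} w \<Longrightarrow>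
      (\<And>y. y \<ge> 0 \<Longrightarrow> \<bar>v y - w y\<bar> \<le> B * \<omega> y) \<Longrightarrow> x \<ge> 0 \<Longrightarrow> \<bar>T v x - T w x\<bar> \<le> B / 2 * \<omega> x"
  shows "\<exists>v. continuous_on {0..} v \<and> (\<forall>x\<ge>0. v x = a + T v x)"
proof -
  define E :: "(real \<Rightarrow>\<^sub>C real) \<Rightarrow> real \<Rightarrow> real" where "E u x = apply_bcontfun u x * \<omega> x" for u x
  have E_cont: "continuous_on {0..} (E u)" for u
    unfolding E_def by (intro continuous_on_mult w_cont) simp
  \<comment> \<open>The bounded continuous functions live on the whole line; \<open>max 0\<close>
    extends the image constantly to negative arguments.\<close>
  define F where "F u x = (a + T (E u) (max 0 x)) / \<omega> (max 0 x)" for u x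
  have F_in: "F u \<in> bcontfun" for u
  proof (rule bcontfun_normI)
    have "continuous_on UNIV ((\<lambda>y. (a + T (E u) y) / \<omega> y) \<circ> max 0)"
    proof (rule continuous_on_compose)
      have "continuous_on {0..} (\<lambda>y. (a + T (E u) y) / \<omega> y)"
      proof (intro continuous_intros T_cont E_cont w_cont ballI)
        fix y :: real assume "y \<in> {0..}"
        then show "\<omega> y \<noteq> 0" using w_ge[of y] by auto
      qed
      then show "continuous_on (max 0 ` UNIV) (\<lambda>y. (a + T (E u) y) / \<omega> y)"
        by (rule continuous_on_subset) auto
    qed (intro continuous_intros)
    then show "continuous_on UNIV (F u)"
      by (simp add: F_def[abs_def] o_def)
  next
    fix x :: real
    define y where "y = max 0 x"
    have "y \<ge> 0" by (simp add: y_def)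
    have "\<bar>a + T (E u) y\<bar> \<le> \<bar>a\<bar> * 1 + C * \<omega> y"
      using T_bound[OF E_cont \<open>y \<ge> 0\<close>, of u] by simp
    also have "\<dots> \<le> \<bar>a\<bar> * \<omega> y + C * \<omega> y"
      using w_ge[OF \<open>y \<ge> 0\<close>] by (intro add_right_mono mult_left_mono) auto
    finally show "norm (F u x) \<le> \<bar>a\<bar> + C"
      using w_ge[OF \<open>y \<ge> 0\<close>] by (simp add: F_def y_def[symmetric] abs_divide pos_divide_le_eq distrib_right)
  qed
  define \<Phi> where "\<Phi> u = Bcontfun (F u)" for u
  have \<Phi>_apply: "apply_bcontfun (\<Phi> u) = F u" for u
    unfolding \<Phi>_def by (rule Bcontfun_inverse[OF F_in])
  have "dist (\<Phi> u) (\<Phi> w) \<le> 1 / 2 * dist u w" for u w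
  proof (rule dist_bound)
    fix x :: real
    define y where "y = max 0 x"
    have "y \<ge> 0" by (simp add: y_def)
    have "\<bar>E u z - E w z\<bar> \<le> dist u w * \<omega> z" if "z \<ge> 0" for z
    proof -
      have "\<bar>apply_bcontfun u z - apply_bcontfun w z\<bar> * \<omega> z \<le> dist u w * \<omega> z"
        using dist_bounded[of u z w] w_ge[OF that] by (intro mult_right_mono) (auto simp: dist_real_def)
      then show ?thesis
        using w_ge[OF that] by (simp add: E_def left_diff_distrib[symmetric] abs_mult)
    qed
    then have "\<bar>T (E u) y - T (E w) y\<bar> \<le> dist u w / 2 * \<omega> y"
      by (intro T_contr E_cont \<open>y \<ge> 0\<close>)
    then have "\<bar>T (E u) y - T (E w) y\<bar> / \<omega> y \<le> dist u w / 2"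
      using w_ge[OF \<open>y \<ge> 0\<close>] by (simp add: pos_divide_le_eq)
    moreover have "F u x - F w x = (T (E u) y - T (E w) y) / \<omega> y"
      by (simp add: F_def y_def[symmetric] diff_divide_distrib[symmetric])
    ultimately show "dist (\<Phi> u x) (\<Phi> w x) \<le> 1 / 2 * dist u w"
      using w_ge[OF \<open>y \<ge> 0\<close>] by (simp add: \<Phi>_apply dist_real_def abs_divide)
  qed
  then obtain u where u: "\<Phi> u = u"
    using banach_fix_type[of "1/2" \<Phi>] by auto
  have "E u x = a + T (E u) x" if "x \<ge> 0" for x
  proof -
    have "apply_bcontfun u x = F u x"
      using \<Phi>_apply[of u] u by simp
    then show ?thesis
      using that w_ge[OF that] by (simp add: E_def F_def)
  qed
  then show ?thesis using E_cont by blast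
qed

lemma deriv_abs_bound:
  fixes F G :: "real \<Rightarrow> real"
  assumes "a \<le> b" and cont: "continuous_on {a..b} F" "continuous_on {a..b} G"
    and F: "\<And>x. a < x \<Longrightarrow> x < b \<Longrightarrow> (F has_real_derivative f x) (at x)"
    and G: "\<And>x. a < x \<Longrightarrow> x < b \<Longrightarrow> (G has_real_derivative g x) (at x)"
    and le: "\<And>x. a < x \<Longrightarrow> x < b \<Longrightarrow> \<bar>f x\<bar> \<le> g x"
  shows "\<bar>F b - F a\<bar> \<le> G b - G a"
proof -
  have "G a - F a \<le> G b - F b"
  proof (rule DERIV_nonneg_imp_increasing_open[where f = "\<lambda>x. G x - F x"])
    fix x assume x: "a < x" "x < b"
    show "\<exists>y. ((\<lambda>x. G x - F x) has_real_derivative y) (at x) \<and> 0 \<le> y"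
      using DERIV_diff[OF G[OF x] F[OF x]] le[OF x] by (intro exI[of _ "g x - f x"]) simp
  qed (use assms(1) cont in \<open>auto intro: continuous_on_diff\<close>)
  moreover have "G a + F a \<le> G b + F b"
  proof (rule DERIV_nonneg_imp_increasing_open[where f = "\<lambda>x. G x + F x"])
    fix x assume x: "a < x" "x < b"
    show "\<exists>y. ((\<lambda>x. G x + F x) has_real_derivative y) (at x) \<and> 0 \<le> y"
      using DERIV_add[OF G[OF x] F[OF x]] le[OF x] by (intro exI[of _ "g x + f x"]) simp
  qed (use assms(1) cont in \<open>auto intro: continuous_on_add\<close>)
  ultimately show ?thesis by (simp add: abs_le_iff)
qed

lemma powr_lipschitz:
  fixes x y :: real
  assumes "0 \<le> x" "x \<le> M" "0 \<le> y" "y \<le> M" "e \<ge> 1"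
  shows "\<bar>x powr e - y powr e\<bar> \<le> e * M powr (e - 1) * \<bar>x - y\<bar>"
proof -
  have *: "\<bar>y powr e - x powr e\<bar> \<le> e * M powr (e - 1) * y - e * M powr (e - 1) * x"
    if "0 \<le> x" "x \<le> y" "y \<le> M" for x y :: real
  proof (rule deriv_abs_bound[OF that(2), where f = "\<lambda>t. e * t powr (e - 1)" and g = "\<lambda>t. e * M powr (e - 1)"])
    show "continuous_on {x..y} (\<lambda>x. x powr e)"
      using that \<open>e \<ge> 1\<close> by (intro continuous_on_powr' continuous_intros) auto
    fix t assume t: "x < t" "t < y"
    then have "t > 0" using that by simp
    show "((\<lambda>x. x powr e) has_real_derivative e * t powr (e - 1)) (at t)"
      using DERIV_powr_const[OF DERIV_ident \<open>t > 0\<close>, of e] by simp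
    show "((*) (e * M powr (e - 1)) has_real_derivative e * M powr (e - 1)) (at t)"
      using DERIV_cmult[OF DERIV_ident, of "e * M powr (e - 1)" t UNIV] by simp
    have "t powr (e - 1) \<le> M powr (e - 1)"
      using \<open>t > 0\<close> t that \<open>e \<ge> 1\<close> by (intro powr_mono2) auto
    then show "\<bar>e * t powr (e - 1)\<bar> \<le> e * M powr (e - 1)"
      using \<open>e \<ge> 1\<close> by (simp add: abs_mult)
  qed (intro continuous_intros)
  show ?thesis
  proof (cases "x \<le> y")
    case True
    then show ?thesis using *[of x y] assms by (simp add: right_diff_distrib abs_minus_commute)
  next
    case False
    then show ?thesis using *[of y x] assms by (simp add: right_diff_distrib abs_minus_commute)
  qed
qed

text \<open>The profile equation in divergence form for \<open>v = f powr m\<close>: writing \<beta>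
  \<xi> f' as a radial divergence produces N \<beta> f, so the derivative of
  \<open>\<xi> ^ (N - 1) * (v' - \<beta> * \<xi> * v powr r)\<close> is \<open>\<xi> ^ (N - 1) *
  (\<kappa> * v powr r - \<xi> powr \<sigma> * v powr q)\<close> with \<kappa> = \<alpha> - N
  \<beta>. No derivative of a power of \<open>v\<close> is left.\<close>

locale radial_volterra =
  fixes N :: nat and r q \<sigma> \<kappa> \<beta> M :: real
  assumes N_pos: "N \<ge> 1" and r1: "r > 1" and q1: "q > 1" and \<sigma>0: "\<sigma> > 0" and \<beta>0: "\<beta> > 0" and M0: "M > 0"
begin

text \<open>Truncation makes both powers bounded and globally Lipschitz, so solutions exist on the
  whole half-line; they solve the original equation wherever they lie strictly between 0 and
  \<open>M\<close>.\<close>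

definition clamp :: "real \<Rightarrow> real" where "clamp x = max 0 (min x M)"

definition source :: "real \<Rightarrow> real \<Rightarrow> real" where
  "source \<xi> x = \<kappa> * clamp x powr r - \<xi> powr \<sigma> * clamp x powr q"

definition flux :: "(real \<Rightarrow> real) \<Rightarrow> real \<Rightarrow> real" where
  "flux v \<xi> = integral {0..\<xi>} (\<lambda>\<zeta>. \<zeta> ^ (N - 1) * source \<zeta> (v \<zeta>))"

definition slope :: "(real \<Rightarrow> real) \<Rightarrow> real \<Rightarrow> real" where
  "slope v \<xi> = flux v \<xi> / \<xi> ^ (N - 1) + \<beta> * \<xi> * clamp (v \<xi>) powr r"

definition is_solution :: "real \<Rightarrow> (real \<Rightarrow> real) \<Rightarrow> bool" where
  "is_solution a v \<longleftrightarrow> continuous_on {0..} v \<and> (\<forall>\<xi>\<ge>0. v \<xi> = a + integral {0..\<xi>} (slope v))"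

text \<open>One constant that dominates the sizes and the Lipschitz constants of both clamped
  powers.\<close>

definition lip :: real where
  "lip = M powr r + M powr q + r * M powr (r - 1) + q * M powr (q - 1)"

definition growth :: "real \<Rightarrow> real" where
  "growth \<xi> = lip * \<xi> * (\<bar>\<kappa>\<bar> + \<beta> + \<xi> powr \<sigma>)"

text \<open>The exponent is twice a primitive of \<open>growth\<close>; the factor 2 becomes the
  contraction constant 1 / 2.\<close>

definition weight :: "real \<Rightarrow> real" where
  "weight \<xi> = exp (2 * lip * ((\<bar>\<kappa>\<bar> + \<beta>) * \<xi>\<^sup>2 / 2 + \<xi> powr (\<sigma> + 2) / (\<sigma> + 2)))"

section \<open>Estimates for the clamped nonlinearity\<close>

lemma clamp_bounds: "0 \<le> clamp x" "clamp x \<le> M"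
  using M0 by (auto simp: clamp_def)

lemma clamp_id: "0 \<le> x \<Longrightarrow> x \<le> M \<Longrightarrow> clamp x = x"
  by (simp add: clamp_def)

lemma clamp_lipschitz: "\<bar>clamp x - clamp y\<bar> \<le> \<bar>x - y\<bar>"
  by (auto simp: clamp_def max_def min_def)

lemma lip_pos: "lip > 0"
  using M0 r1 q1 unfolding lip_def by (intro add_pos_nonneg) auto

lemma clamp_powr_le: "clamp x powr r \<le> lip" "clamp x powr q \<le> lip"
proof -
  have "clamp x powr r \<le> M powr r" "clamp x powr q \<le> M powr q"
    using clamp_bounds r1 q1 by (auto intro!: powr_mono2)
  moreover have "0 \<le> r * M powr (r - 1)" "0 \<le> q * M powr (q - 1)" "0 \<le> M powr r" "0 \<le> M powr q"
    using r1 q1 by simp_all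
  ultimately show "clamp x powr r \<le> lip" "clamp x powr q \<le> lip"
    unfolding lip_def by linarith+
qed

lemma clamp_powr_lipschitz:
  "\<bar>clamp x powr r - clamp y powr r\<bar> \<le> lip * \<bar>x - y\<bar>" "\<bar>clamp x powr q - clamp y powr q\<bar> \<le> lip * \<bar>x - y\<bar>"
proof -
  have nn: "0 \<le> r * M powr (r - 1)" "0 \<le> q * M powr (q - 1)" "0 \<le> M powr r" "0 \<le> M powr q"
    using r1 q1 by simp_all
  have "\<bar>clamp x powr r - clamp y powr r\<bar> \<le> r * M powr (r - 1) * \<bar>clamp x - clamp y\<bar>"
    using r1 by (intro powr_lipschitz clamp_bounds) simp
  also have "\<dots> \<le> lip * \<bar>x - y\<bar>"
    using clamp_lipschitz lip_pos nn unfolding lip_def by (intro mult_mono) auto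
  finally show "\<bar>clamp x powr r - clamp y powr r\<bar> \<le> lip * \<bar>x - y\<bar>" .
  have "\<bar>clamp x powr q - clamp y powr q\<bar> \<le> q * M powr (q - 1) * \<bar>clamp x - clamp y\<bar>"
    using q1 by (intro powr_lipschitz clamp_bounds) simp
  also have "\<dots> \<le> lip * \<bar>x - y\<bar>"
    using clamp_lipschitz lip_pos nn unfolding lip_def by (intro mult_mono) auto
  finally show "\<bar>clamp x powr q - clamp y powr q\<bar> \<le> lip * \<bar>x - y\<bar>" .
qed

lemma continuous_on_clamp_powr:
  assumes "continuous_on S v" "e > 0"
  shows "continuous_on S (\<lambda>x. clamp (v x) powr e)"
  unfolding clamp_def using assms by (intro continuous_on_powr' continuous_intros) auto

lemma continuous_on_integrand:
  assumes "continuous_on {0..} v"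
  shows "continuous_on {0..} (\<lambda>\<zeta>. \<zeta> ^ (N - 1) * source \<zeta> (v \<zeta>))"
  unfolding source_def using assms r1 q1 \<sigma>0
  by (intro continuous_on_clamp_powr continuous_intros continuous_on_powr') auto

lemma source_bound: "\<bar>source \<xi> x\<bar> \<le> lip * (\<bar>\<kappa>\<bar> + \<xi> powr \<sigma>)"
proof -
  have "\<bar>source \<xi> x\<bar> \<le> \<bar>\<kappa>\<bar> * clamp x powr r + \<xi> powr \<sigma> * clamp x powr q"
    unfolding source_def by (rule order.trans[OF abs_triangle_ineq4]) (simp add: abs_mult)
  also have "\<dots> \<le> \<bar>\<kappa>\<bar> * lip + \<xi> powr \<sigma> * lip"
    by (intro add_mono mult_left_mono clamp_powr_le) auto
  finally show ?thesis by (simp add: algebra_simps)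
qed

lemma source_lipschitz: "\<bar>source \<xi> x - source \<xi> y\<bar> \<le> lip * (\<bar>\<kappa>\<bar> + \<xi> powr \<sigma>) * \<bar>x - y\<bar>"
proof -
  have "source \<xi> x - source \<xi> y = \<kappa> * (clamp x powr r - clamp y powr r) - \<xi> powr \<sigma> * (clamp x powr q - clamp y powr q)"
    by (simp add: source_def algebra_simps)
  also have "\<bar>\<dots>\<bar> \<le> \<bar>\<kappa>\<bar> * \<bar>clamp x powr r - clamp y powr r\<bar> + \<xi> powr \<sigma> * \<bar>clamp x powr q - clamp y powr q\<bar>"
    by (rule order.trans[OF abs_triangle_ineq4]) (simp add: abs_mult)
  also have "\<dots> \<le> \<bar>\<kappa>\<bar> * (lip * \<bar>x - y\<bar>) + \<xi> powr \<sigma> * (lip * \<bar>x - y\<bar>)"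
    by (intro add_mono mult_left_mono clamp_powr_lipschitz) auto
  finally show ?thesis by (simp add: algebra_simps)
qed

lemma power_N: "x * x ^ (N - 1) = x ^ N" for x :: real
  using N_pos by (cases N) auto

lemma flux_0 [simp]: "flux v 0 = 0"
  by (simp add: flux_def)

lemma slope_0 [simp]: "slope v 0 = 0"
  by (simp add: slope_def)

text \<open>Under the integral \<open>\<zeta> ^ (N - 1)\<close> is at most
  \<open>\<xi> ^ (N - 1)\<close>, so the singular division leaves only the length \<xi> of the
  interval.\<close>

lemma slope_diff_bound:
  assumes v: "continuous_on {0..} v" and w: "continuous_on {0..} w" and "\<xi> \<ge> 0" and "B \<ge> 0"
    and le: "\<And>y. 0 \<le> y \<Longrightarrow> y \<le> \<xi> \<Longrightarrow> \<bar>v y - w y\<bar> \<le> B"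
  shows "\<bar>slope v \<xi> - slope w \<xi>\<bar> \<le> growth \<xi> * B"
proof (cases "\<xi> = 0")
  case False
  then have "\<xi> > 0" using \<open>\<xi> \<ge> 0\<close> by simp
  have cv: "continuous_on {0..\<xi>} (\<lambda>\<zeta>. \<zeta> ^ (N - 1) * source \<zeta> (v \<zeta>))"
    by (rule continuous_on_subset[OF continuous_on_integrand[OF v]]) auto
  have cw: "continuous_on {0..\<xi>} (\<lambda>\<zeta>. \<zeta> ^ (N - 1) * source \<zeta> (w \<zeta>))"
    by (rule continuous_on_subset[OF continuous_on_integrand[OF w]]) auto
  define A where "A = lip * (\<bar>\<kappa>\<bar> + \<xi> powr \<sigma>) * B"
  have "flux v \<xi> - flux w \<xi> = integral {0..\<xi>} (\<lambda>\<zeta>. \<zeta> ^ (N - 1) * source \<zeta> (v \<zeta>) - \<zeta> ^ (N - 1) * source \<zeta> (w \<zeta>))"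
    unfolding flux_def by (rule integral_diff[symmetric]; rule integrable_continuous_interval[OF cv] integrable_continuous_interval[OF cw])
  also have "norm \<dots> \<le> \<xi> ^ (N - 1) * A * (\<xi> - 0)"
  proof (rule integral_bound[OF \<open>\<xi> \<ge> 0\<close>])
    fix t assume t: "t \<in> {0..\<xi>}"
    have "\<bar>source t (v t) - source t (w t)\<bar> \<le> lip * (\<bar>\<kappa>\<bar> + t powr \<sigma>) * \<bar>v t - w t\<bar>"
      by (rule source_lipschitz)
    also have "\<dots> \<le> A"
      unfolding A_def using t le[of t] lip_pos \<sigma>0
      by (intro mult_mono add_left_mono powr_mono2) auto
    finally have "\<bar>t ^ (N - 1)\<bar> * \<bar>source t (v t) - source t (w t)\<bar> \<le> \<xi> ^ (N - 1) * A"
      using t by (intro mult_mono) (auto intro: power_mono)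
    then show "norm (t ^ (N - 1) * source t (v t) - t ^ (N - 1) * source t (w t)) \<le> \<xi> ^ (N - 1) * A"
      by (simp add: right_diff_distrib[symmetric] abs_mult)
  qed (intro continuous_on_diff cv cw)
  finally have "\<bar>flux v \<xi> - flux w \<xi>\<bar> / \<xi> ^ (N - 1) \<le> A * \<xi>"
    using \<open>\<xi> > 0\<close> by (simp add: pos_divide_le_eq mult_ac)
  moreover have "\<bar>\<beta> * \<xi> * (clamp (v \<xi>) powr r - clamp (w \<xi>) powr r)\<bar> \<le> \<beta> * \<xi> * (lip * B)"
  proof -
    have "lip * \<bar>v \<xi> - w \<xi>\<bar> \<le> lip * B"
      using le[of \<xi>] \<open>\<xi> \<ge> 0\<close> lip_pos by (intro mult_left_mono) auto
    then have "\<bar>clamp (v \<xi>) powr r - clamp (w \<xi>) powr r\<bar> \<le> lip * B"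
      using clamp_powr_lipschitz(1)[of "v \<xi>" "w \<xi>"] by simp
    then show ?thesis using \<beta>0 \<open>\<xi> > 0\<close> by (simp add: abs_mult)
  qed
  moreover have "slope v \<xi> - slope w \<xi> = (flux v \<xi> - flux w \<xi>) / \<xi> ^ (N - 1)
      + \<beta> * \<xi> * (clamp (v \<xi>) powr r - clamp (w \<xi>) powr r)"
    by (simp add: slope_def diff_divide_distrib right_diff_distrib)
  ultimately have "\<bar>slope v \<xi> - slope w \<xi>\<bar> \<le> A * \<xi> + \<beta> * \<xi> * (lip * B)"
    using \<open>\<xi> > 0\<close> abs_triangle_ineq[of "(flux v \<xi> - flux w \<xi>) / \<xi> ^ (N - 1)" "\<beta> * \<xi> * (clamp (v \<xi>) powr r - clamp (w \<xi>) powr r)"]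
    by (simp add: abs_divide)
  then show ?thesis by (simp add: A_def growth_def algebra_simps)
qed (simp add: growth_def)

lemma slope_bound:
  assumes v: "continuous_on {0..} v" and "\<xi> \<ge> 0"
  shows "\<bar>slope v \<xi>\<bar> \<le> growth \<xi>"
proof (cases "\<xi> = 0")
  case False
  then have "\<xi> > 0" using \<open>\<xi> \<ge> 0\<close> by simp
  have cv: "continuous_on {0..\<xi>} (\<lambda>\<zeta>. \<zeta> ^ (N - 1) * source \<zeta> (v \<zeta>))"
    by (rule continuous_on_subset[OF continuous_on_integrand[OF v]]) auto
  define A where "A = lip * (\<bar>\<kappa>\<bar> + \<xi> powr \<sigma>)"
  have "norm (flux v \<xi>) \<le> \<xi> ^ (N - 1) * A * (\<xi> - 0)"
    unfolding flux_def
  proof (rule integral_bound[OF \<open>\<xi> \<ge> 0\<close> cv])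
    fix t assume t: "t \<in> {0..\<xi>}"
    have "\<bar>source t (v t)\<bar> \<le> lip * (\<bar>\<kappa>\<bar> + t powr \<sigma>)"
      by (rule source_bound)
    also have "\<dots> \<le> A"
      unfolding A_def using t lip_pos \<sigma>0 by (intro mult_left_mono add_left_mono powr_mono2) auto
    finally have "\<bar>t ^ (N - 1)\<bar> * \<bar>source t (v t)\<bar> \<le> \<xi> ^ (N - 1) * A"
      using t by (intro mult_mono) (auto intro: power_mono)
    then show "norm (t ^ (N - 1) * source t (v t)) \<le> \<xi> ^ (N - 1) * A"
      by (simp add: abs_mult)
  qed
  then have "\<bar>flux v \<xi>\<bar> / \<xi> ^ (N - 1) \<le> A * \<xi>"
    using \<open>\<xi> > 0\<close> by (simp add: pos_divide_le_eq mult_ac)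
  moreover have "\<beta> * \<xi> * clamp (v \<xi>) powr r \<le> \<beta> * \<xi> * lip"
    using \<beta>0 \<open>\<xi> > 0\<close> clamp_powr_le by (intro mult_left_mono) auto
  moreover have "\<bar>slope v \<xi>\<bar> \<le> \<bar>flux v \<xi>\<bar> / \<xi> ^ (N - 1) + \<beta> * \<xi> * clamp (v \<xi>) powr r"
    using \<open>\<xi> > 0\<close> \<beta>0 abs_triangle_ineq[of "flux v \<xi> / \<xi> ^ (N - 1)" "\<beta> * \<xi> * clamp (v \<xi>) powr r"]
    by (simp add: slope_def abs_divide)
  ultimately have "\<bar>slope v \<xi>\<bar> \<le> A * \<xi> + \<beta> * \<xi> * lip"
    by linarith
  then show ?thesis by (simp add: A_def growth_def algebra_simps)
qed (simp add: growth_def)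

lemma continuous_on_growth: "continuous_on {0..} growth"
  unfolding growth_def[abs_def] using \<sigma>0 by (intro continuous_intros continuous_on_powr') auto

lemma continuous_on_weight: "continuous_on {0..} weight"
  unfolding weight_def[abs_def] using \<sigma>0 by (intro continuous_intros continuous_on_powr') auto

definition half_exponent :: "real \<Rightarrow> real" where
  "half_exponent \<xi> = lip * ((\<bar>\<kappa>\<bar> + \<beta>) * \<xi>\<^sup>2 / 2 + \<xi> powr (\<sigma> + 2) / (\<sigma> + 2))"

lemma weight_eq: "weight \<xi> = exp (2 * half_exponent \<xi>)"
  by (simp add: weight_def half_exponent_def mult.assoc)

lemma half_exponent_0 [simp]: "half_exponent 0 = 0"
  using \<sigma>0 by (simp add: half_exponent_def)

lemma half_exponent_derivative:
  assumes "\<xi> > 0"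
  shows "(half_exponent has_real_derivative growth \<xi>) (at \<xi>)"
proof -
  have "((\<lambda>\<xi>. \<xi> powr (\<sigma> + 2) / (\<sigma> + 2)) has_real_derivative
      (\<sigma> + 2) * \<xi> powr (\<sigma> + 2 - 1) * 1 / (\<sigma> + 2)) (at \<xi>)"
    by (rule DERIV_cdivide[OF DERIV_powr_const[OF DERIV_ident assms]])
  moreover have "\<xi> powr (\<sigma> + 2 - 1) = \<xi> * \<xi> powr \<sigma>"
    using powr_add[of \<xi> 1 \<sigma>] assms by (simp add: add.commute)
  ultimately have 1: "((\<lambda>\<xi>. \<xi> powr (\<sigma> + 2) / (\<sigma> + 2)) has_real_derivative \<xi> * \<xi> powr \<sigma>) (at \<xi>)"
    using \<sigma>0 by simp
  have 2: "((\<lambda>\<xi>. (\<bar>\<kappa>\<bar> + \<beta>) * \<xi>\<^sup>2 / 2) has_real_derivative (\<bar>\<kappa>\<bar> + \<beta>) * \<xi>) (at \<xi>)"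
    by (auto intro!: derivative_eq_intros)
  have "(half_exponent has_real_derivative lip * ((\<bar>\<kappa>\<bar> + \<beta>) * \<xi> + \<xi> * \<xi> powr \<sigma>)) (at \<xi>)"
    unfolding half_exponent_def[abs_def] by (intro DERIV_cmult DERIV_add 1 2)
  then show ?thesis by (simp add: growth_def algebra_simps)
qed

lemma continuous_on_half_exponent: "continuous_on {0..} half_exponent"
  unfolding half_exponent_def[abs_def] using \<sigma>0 by (intro continuous_intros continuous_on_powr') auto

lemma weight_derivative:
  assumes "\<xi> > 0"
  shows "(weight has_real_derivative 2 * growth \<xi> * weight \<xi>) (at \<xi>)"
proof -
  have "((\<lambda>\<xi>. exp (2 * half_exponent \<xi>)) has_real_derivative exp (2 * half_exponent \<xi>) * (2 * growth \<xi>)) (at \<xi>)"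
    by (rule DERIV_chain2[OF DERIV_exp DERIV_cmult[OF half_exponent_derivative[OF assms]]])
  then show ?thesis by (simp add: weight_eq[abs_def] mult_ac)
qed

lemma half_exponent_mono: "0 \<le> x \<Longrightarrow> x \<le> y \<Longrightarrow> half_exponent x \<le> half_exponent y"
  unfolding half_exponent_def using lip_pos \<beta>0 \<sigma>0
  by (intro mult_left_mono add_mono divide_right_mono power_mono powr_mono2) auto

lemma weight_mono: "0 \<le> x \<Longrightarrow> x \<le> y \<Longrightarrow> weight x \<le> weight y"
  by (simp add: weight_eq half_exponent_mono)

lemma weight_ge_1: "0 \<le> x \<Longrightarrow> 1 \<le> weight x"
  using half_exponent_mono[of 0 x] by (simp add: weight_eq)

section \<open>Regularity and the contraction estimate\<close>

lemma flux_has_derivative: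
  assumes v: "continuous_on {0..} v" and "\<xi> > 0"
  shows "(flux v has_real_derivative \<xi> ^ (N - 1) * source \<xi> (v \<xi>)) (at \<xi>)"
proof -
  have "continuous_on {0..\<xi> + 1} (\<lambda>\<zeta>. \<zeta> ^ (N - 1) * source \<zeta> (v \<zeta>))"
    by (rule continuous_on_subset[OF continuous_on_integrand[OF v]]) auto
  then have "(flux v has_real_derivative \<xi> ^ (N - 1) * source \<xi> (v \<xi>)) (at \<xi> within {0..\<xi> + 1})"
    unfolding flux_def[abs_def] using \<open>\<xi> > 0\<close> by (intro integral_has_real_derivative) auto
  then show ?thesis using \<open>\<xi> > 0\<close> by (simp add: at_within_Icc_at)
qed

lemma continuous_on_slope:
  assumes v: "continuous_on {0..} v"
  shows "continuous_on {0..} (slope v)"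
  unfolding continuous_on_eq_continuous_within
proof
  fix \<xi> :: real assume "\<xi> \<in> {0..}"
  show "continuous (at \<xi> within {0..}) (slope v)"
  proof (cases "\<xi> = 0")
    case True
    \<comment> \<open>At the origin the quotient in \<open>slope\<close> is singular for
      \<open>N > 1\<close>; continuity there comes from the bound by \<open>growth\<close>, which
      vanishes at 0.\<close>
    have "(growth \<longlongrightarrow> growth 0) (at 0 within {0..})"
      using continuous_on_growth by (auto simp: continuous_on_def)
    then have "(growth \<longlongrightarrow> 0) (at 0 within {0..})"
      by (simp add: growth_def)
    then have "(slope v \<longlongrightarrow> 0) (at 0 within {0..})"
    proof (rule Lim_null_comparison[rotated])
      show "\<forall>\<^sub>F x in at 0 within {0..}. norm (slope v x) \<le> growth x"
        using slope_bound[OF v] by (auto simp: eventually_at_filter)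
    qed
    then show ?thesis using True by (simp add: continuous_within)
  next
    case False
    then have "\<xi> > 0" using \<open>\<xi> \<in> {0..}\<close> by simp
    have "continuous_on {0<..} (flux v)"
      using flux_has_derivative[OF v] by (intro continuous_at_imp_continuous_on) (auto intro: DERIV_isCont)
    then have "continuous_on {0<..} (slope v)"
      unfolding slope_def[abs_def] using r1
      by (intro continuous_intros continuous_on_clamp_powr continuous_on_subset[OF v]) auto
    then have "isCont (slope v) \<xi>"
      using \<open>\<xi> > 0\<close> by (simp add: continuous_on_eq_continuous_at)
    then show ?thesis by (rule continuous_at_imp_continuous_at_within)
  qed
qed

lemma integral_slope:
  assumes v: "continuous_on {0..} v"
  shows "continuous_on {0..} (\<lambda>\<xi>. integral {0..\<xi>} (slope v))"
    and "\<And>\<xi>. \<xi> > 0 \<Longrightarrow> ((\<lambda>\<xi>. integral {0..\<xi>} (slope v)) has_real_derivative slope v \<xi>) (at \<xi>)"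
proof -
  have c: "continuous_on {0..b} (slope v)" for b
    by (rule continuous_on_subset[OF continuous_on_slope[OF v]]) auto
  show "continuous_on {0..} (\<lambda>\<xi>. integral {0..\<xi>} (slope v))"
    by (intro continuous_on_atLeastI indefinite_integral_continuous_1 integrable_continuous_interval c)
  fix \<xi> :: real assume "\<xi> > 0"
  then have "((\<lambda>\<xi>. integral {0..\<xi>} (slope v)) has_real_derivative slope v \<xi>) (at \<xi> within {0..\<xi> + 1})"
    by (intro integral_has_real_derivative c) auto
  then show "((\<lambda>\<xi>. integral {0..\<xi>} (slope v)) has_real_derivative slope v \<xi>) (at \<xi>)"
    using \<open>\<xi> > 0\<close> by (simp add: at_within_Icc_at)
qed

lemma integral_slope_bound:
  assumes v: "continuous_on {0..} v" and "x \<ge> 0"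
  shows "\<bar>integral {0..x} (slope v)\<bar> \<le> weight x"
proof -
  have "\<bar>integral {0..x} (slope v) - integral {0..0} (slope v)\<bar> \<le> half_exponent x - half_exponent 0"
    using assms slope_bound[OF v]
    by (intro deriv_abs_bound[where F = "\<lambda>x. integral {0..x} (slope v)" and f = "slope v" and g = growth]
        integral_slope half_exponent_derivative continuous_on_subset[OF integral_slope(1)[OF v]]
        continuous_on_subset[OF continuous_on_half_exponent]) auto
  moreover have "half_exponent x \<le> weight x"
    using exp_ge_add_one_self[of "2 * half_exponent x"] half_exponent_mono[OF order_refl \<open>x \<ge> 0\<close>]
    unfolding weight_eq half_exponent_0 by linarith
  ultimately show ?thesis by simp
qed

text \<open>The difference of the slopes is at most \<open>growth * B * weight\<close>, and this is
  the derivative of \<open>B / 2 * weight\<close>.\<close>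

lemma integral_slope_contraction:
  assumes v: "continuous_on {0..} v" and w: "continuous_on {0..} w"
    and le: "\<And>y. y \<ge> 0 \<Longrightarrow> \<bar>v y - w y\<bar> \<le> B * weight y" and "x \<ge> 0"
  shows "\<bar>integral {0..x} (slope v) - integral {0..x} (slope w)\<bar> \<le> B / 2 * weight x"
proof -
  have "B \<ge> 0"
    using le[of 0] by (simp add: weight_eq)
  define F where "F x = integral {0..x} (slope v) - integral {0..x} (slope w)" for x
  have "\<bar>F x - F 0\<bar> \<le> B / 2 * weight x - B / 2 * weight 0"
  proof (rule deriv_abs_bound[OF \<open>x \<ge> 0\<close>])
    have "continuous_on {0..} F"
      unfolding F_def[abs_def] by (intro continuous_intros integral_slope v w)
    then show "continuous_on {0..x} F"
      by (rule continuous_on_subset) auto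
    show "continuous_on {0..x} (\<lambda>x. B / 2 * weight x)"
      by (intro continuous_intros continuous_on_subset[OF continuous_on_weight]) auto
    fix \<xi> :: real assume \<xi>: "0 < \<xi>" "\<xi> < x"
    show "(F has_real_derivative slope v \<xi> - slope w \<xi>) (at \<xi>)"
      unfolding F_def[abs_def] by (intro DERIV_diff integral_slope v w \<xi>)
    show "((\<lambda>x. B / 2 * weight x) has_real_derivative B / 2 * (2 * growth \<xi> * weight \<xi>)) (at \<xi>)"
      by (intro DERIV_cmult weight_derivative \<xi>)
    have "\<bar>slope v \<xi> - slope w \<xi>\<bar> \<le> growth \<xi> * (B * weight \<xi>)"
    proof (rule slope_diff_bound[OF v w])
      fix y assume y: "0 \<le> y" "y \<le> \<xi>"
      show "\<bar>v y - w y\<bar> \<le> B * weight \<xi>"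
        using le[OF y(1)] mult_left_mono[OF weight_mono[OF y] \<open>B \<ge> 0\<close>] by simp
    qed (use \<xi> \<open>B \<ge> 0\<close> weight_ge_1[of \<xi>] in auto)
    then show "\<bar>slope v \<xi> - slope w \<xi>\<bar> \<le> B / 2 * (2 * growth \<xi> * weight \<xi>)"
      by (simp add: mult_ac)
  qed
  moreover have "0 \<le> B / 2 * weight 0" using \<open>B \<ge> 0\<close> by (simp add: weight_eq)
  moreover have "F 0 = 0" by (simp add: F_def)
  ultimately show ?thesis by (simp add: F_def)
qed

section \<open>Existence and dependence on the initial value\<close>

lemma solution_exists: "\<exists>v. is_solution a v"
  unfolding is_solution_def
  by (rule weighted_fixed_point[of weight 1]; (rule continuous_on_weight weight_ge_1 integral_slope(1)
        integral_slope_contraction; assumption)?) (auto intro: integral_slope_bound)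

lemma solution_continuous: "is_solution a v \<Longrightarrow> continuous_on {0..} v"
  by (simp add: is_solution_def)

lemma solution_at_0: "is_solution a v \<Longrightarrow> v 0 = a"
  by (simp add: is_solution_def)

lemma solution_derivative:
  assumes v: "is_solution a v" and "\<xi> > 0"
  shows "(v has_real_derivative slope v \<xi>) (at \<xi>)"
proof -
  have "((\<lambda>\<xi>. a + integral {0..\<xi>} (slope v)) has_real_derivative slope v \<xi>) (at \<xi>)"
    using DERIV_add[OF DERIV_const integral_slope(2)[OF solution_continuous[OF v] \<open>\<xi> > 0\<close>], of a] by simp
  moreover have eq: "\<forall>\<^sub>F x in nhds \<xi>. v x = a + integral {0..x} (slope v)"
    using eventually_nhds_in_open[of "{0<..}" \<xi>] \<open>\<xi> > 0\<close> v
    by (auto simp: is_solution_def elim!: eventually_mono)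
  ultimately show ?thesis using DERIV_cong_ev[OF refl eq refl] by simp
qed

text \<open>The contraction estimate replaces Gronwall: if \<open>B\<close> is an admissible
  constant in the weighted bound, so is \<open>\<bar>a - b\<bar> + B / 2\<close>. The least
  admissible constant exists and therefore is at most \<open>2 * \<bar>a - b\<bar>\<close>.\<close>

lemma solution_dependence:
  assumes v: "is_solution a v" and w: "is_solution b w" and "x \<ge> 0"
  shows "\<bar>v x - w x\<bar> \<le> 2 * \<bar>a - b\<bar> * weight x"
proof -
  define S where "S = {B. \<forall>x\<ge>0. \<bar>v x - w x\<bar> \<le> B * weight x}"
  note cont = solution_continuous[OF v] solution_continuous[OF w]
  have diff: "\<bar>v x - w x\<bar> \<le> \<bar>a - b\<bar> + \<bar>integral {0..x} (slope v) - integral {0..x} (slope w)\<bar>"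
    if "x \<ge> 0" for x
    using v w that by (simp add: is_solution_def)
  have w1: "\<bar>a - b\<bar> \<le> \<bar>a - b\<bar> * weight x" if "x \<ge> 0" for x
    using mult_left_mono[OF weight_ge_1[OF that], of "\<bar>a - b\<bar>"] by simp
  have "\<bar>a - b\<bar> + 2 \<in> S"
    unfolding S_def
  proof (clarify)
    fix x :: real assume x: "0 \<le> x"
    show "\<bar>v x - w x\<bar> \<le> (\<bar>a - b\<bar> + 2) * weight x"
      using diff[OF x] w1[OF x] integral_slope_bound[OF cont(1) x] integral_slope_bound[OF cont(2) x]
      by (simp add: distrib_right)
  qed
  have step: "\<bar>a - b\<bar> + B / 2 \<in> S" if "B \<in> S" for B
    unfolding S_def
  proof (clarify)
    fix x :: real assume x: "0 \<le> x"
    have "\<bar>integral {0..x} (slope v) - integral {0..x} (slope w)\<bar> \<le> B / 2 * weight x"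
      using that x by (intro integral_slope_contraction cont) (auto simp: S_def)
    then show "\<bar>v x - w x\<bar> \<le> (\<bar>a - b\<bar> + B / 2) * weight x"
      using diff[OF x] w1[OF x] by (simp add: distrib_right)
  qed
  have nonneg: "0 \<le> B" if "B \<in> S" for B
  proof -
    have "\<bar>v 0 - w 0\<bar> \<le> B * weight 0" using that by (simp add: S_def)
    then show ?thesis by (simp add: weight_eq)
  qed
  have bdd: "bdd_below S" by (rule bdd_belowI[OF nonneg])
  define B where "B = Inf S"
  have "B \<in> S"
    unfolding S_def
  proof (clarify)
    fix x :: real assume x: "0 \<le> x"
    have "weight x > 0" using weight_ge_1[OF x] by simp
    have "\<bar>v x - w x\<bar> / weight x \<le> B"
      unfolding B_def using \<open>\<bar>a - b\<bar> + 2 \<in> S\<close> x \<open>weight x > 0\<close>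
      by (intro cInf_greatest) (auto simp: S_def pos_divide_le_eq)
    then show "\<bar>v x - w x\<bar> \<le> B * weight x"
      using \<open>weight x > 0\<close> by (simp add: pos_divide_le_eq)
  qed
  have "B \<le> \<bar>a - b\<bar> + B / 2"
    unfolding B_def by (rule cInf_lower[OF step[OF \<open>B \<in> S\<close>[unfolded B_def]] bdd])
  then have "B * weight x \<le> 2 * \<bar>a - b\<bar> * weight x"
    using weight_ge_1[OF \<open>x \<ge> 0\<close>] by (intro mult_right_mono) auto
  moreover have "\<bar>v x - w x\<bar> \<le> B * weight x"
    using \<open>B \<in> S\<close> \<open>x \<ge> 0\<close> by (simp add: S_def)
  ultimately show ?thesis by simp
qed

lemma slope_dependence:
  assumes v: "is_solution a v" and w: "is_solution b w" and "x \<ge> 0"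
  shows "\<bar>slope v x - slope w x\<bar> \<le> growth x * (2 * \<bar>a - b\<bar> * weight x)"
proof (rule slope_diff_bound[OF solution_continuous[OF v] solution_continuous[OF w] \<open>x \<ge> 0\<close>])
  fix y assume y: "0 \<le> y" "y \<le> x"
  have "2 * \<bar>a - b\<bar> * weight y \<le> 2 * \<bar>a - b\<bar> * weight x"
    using weight_mono[OF y] by (intro mult_left_mono) auto
  then show "\<bar>v y - w y\<bar> \<le> 2 * \<bar>a - b\<bar> * weight x"
    using solution_dependence[OF v w y(1)] by simp
qed (use weight_ge_1[OF \<open>x \<ge> 0\<close>] in simp)

lemma zero_solution: "is_solution 0 (\<lambda>_. 0)"
proof -
  have "slope (\<lambda>_. 0) \<xi> = 0" for \<xi>
    using M0 r1 q1 by (simp add: slope_def flux_def source_def clamp_def)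
  then have "slope (\<lambda>_. 0) = (\<lambda>_. 0)" by (rule ext)
  then show ?thesis by (simp add: is_solution_def)
qed

section \<open>Behavior near the origin and recovery of the equation\<close>

text \<open>L'Hopital's rule for \<open>flux v \<xi> / \<xi> ^ N\<close> gives the value of the
  source at the origin divided by N, where the reaction term drops out because \<sigma> > 0.\<close>

lemma slope_at_0:
  assumes v: "is_solution a v"
  shows "((\<lambda>\<xi>. slope v \<xi> / \<xi>) \<longlongrightarrow> (\<kappa> + real N * \<beta>) / real N * clamp a powr r) (at_right 0)"
proof -
  note cont = solution_continuous[OF v]
  have at0: "at_right (0::real) = at 0 within {0<..}" by simp
  have v0: "(v \<longlongrightarrow> a) (at_right 0)"
  proof -
    have "(v \<longlongrightarrow> v 0) (at 0 within {0..})"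
      using cont by (auto simp: continuous_on_def)
    then have "(v \<longlongrightarrow> v 0) (at_right 0)"
      by (rule tendsto_within_subset) auto
    then show ?thesis using solution_at_0[OF v] by simp
  qed
  have cl: "((\<lambda>\<xi>. clamp (v \<xi>) powr e) \<longlongrightarrow> clamp a powr e) (at_right 0)" if "e > 0" for e
    using continuous_on_tendsto_compose[OF continuous_on_clamp_powr[OF continuous_on_id that] v0, of UNIV] by simp
  have "((\<lambda>\<xi>. \<xi> powr \<sigma>) \<longlongrightarrow> 0) (at_right 0)"
    using \<sigma>0 by (intro tendsto_zero_powrI tendsto_const) (auto simp: eventually_at_filter intro: tendsto_ident_at)
  then have "((\<lambda>\<xi>. source \<xi> (v \<xi>)) \<longlongrightarrow> \<kappa> * clamp a powr r - 0 * clamp a powr q) (at_right 0)"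
    unfolding source_def using r1 q1 by (intro tendsto_intros cl) auto
  then have src: "((\<lambda>\<xi>. source \<xi> (v \<xi>) / real N) \<longlongrightarrow> \<kappa> * clamp a powr r / real N) (at_right 0)"
    using N_pos by (intro tendsto_divide tendsto_const) auto
  have "((\<lambda>\<xi>. flux v \<xi> / \<xi> ^ N) \<longlongrightarrow> \<kappa> * clamp a powr r / real N) (at_right 0)"
  proof (rule lhopital_right_0[where f' = "\<lambda>\<xi>. \<xi> ^ (N - 1) * source \<xi> (v \<xi>)" and g' = "\<lambda>\<xi>. real N * \<xi> ^ (N - 1)"])
    show "(flux v \<longlongrightarrow> 0) (at_right 0)"
    proof -
      have "continuous_on {0..1} (flux v)"
        unfolding flux_def[abs_def]
        by (intro indefinite_integral_continuous_1 integrable_continuous_interval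
            continuous_on_subset[OF continuous_on_integrand[OF cont]]) auto
      then have "(flux v \<longlongrightarrow> flux v 0) (at 0 within {0..1})"
        unfolding continuous_on_def by (rule bspec) simp
      moreover have "at 0 within {0..1} = at_right (0::real)"
        by (simp add: at_within_Icc_at_right)
      ultimately show ?thesis by simp
    qed
    have "((\<lambda>\<xi>. \<xi> ^ N) \<longlongrightarrow> 0 ^ N) (at_right (0::real))"
      by (intro tendsto_intros)
    then show "((\<lambda>\<xi>. \<xi> ^ N) \<longlongrightarrow> 0) (at_right (0::real))"
      using N_pos by (simp add: power_0_left)
    show "\<forall>\<^sub>F \<xi> in at_right (0::real). \<xi> ^ N \<noteq> 0"
      "\<forall>\<^sub>F \<xi> in at_right (0::real). real N * \<xi> ^ (N - 1) \<noteq> 0"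
      by (rule eventually_mono[OF eventually_at_right_less], use N_pos in simp)+
    show "\<forall>\<^sub>F \<xi> in at_right 0. (flux v has_real_derivative \<xi> ^ (N - 1) * source \<xi> (v \<xi>)) (at \<xi>)"
      using flux_has_derivative[OF cont] by (auto simp: eventually_at_filter)
    show "\<forall>\<^sub>F \<xi> in at_right 0. ((\<lambda>\<xi>. \<xi> ^ N) has_real_derivative real N * \<xi> ^ (N - 1)) (at \<xi>)"
      using DERIV_pow[of N] by (auto simp: eventually_at_filter)
    show "((\<lambda>\<xi>. \<xi> ^ (N - 1) * source \<xi> (v \<xi>) / (real N * \<xi> ^ (N - 1))) \<longlongrightarrow> \<kappa> * clamp a powr r / real N) (at_right 0)"
      using src by (rule Lim_transform_eventually) (auto simp: eventually_at_filter)
  qed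
  then have "((\<lambda>\<xi>. flux v \<xi> / \<xi> ^ N + \<beta> * clamp (v \<xi>) powr r) \<longlongrightarrow>
      \<kappa> * clamp a powr r / real N + \<beta> * clamp a powr r) (at_right 0)"
    using r1 by (intro tendsto_add tendsto_mult tendsto_const cl) auto
  then have "((\<lambda>\<xi>. slope v \<xi> / \<xi>) \<longlongrightarrow> \<kappa> * clamp a powr r / real N + \<beta> * clamp a powr r) (at_right 0)"
  proof (rule Lim_transform_eventually)
    show "\<forall>\<^sub>F \<xi> in at_right 0. flux v \<xi> / \<xi> ^ N + \<beta> * clamp (v \<xi>) powr r = slope v \<xi> / \<xi>"
      unfolding slope_def power_N[symmetric] by (auto simp: eventually_at_filter field_simps)
  qed
  then show ?thesis using N_pos by (simp add: field_simps)
qed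

lemma solution_isCont: "is_solution a v \<Longrightarrow> \<xi> > 0 \<Longrightarrow> isCont v \<xi>"
  by (rule DERIV_isCont[OF solution_derivative])

text \<open>The divergence form is undone where the clamp is inactive. Differentiating \<beta> *
  \<xi> gives one \<beta> * \<open>v powr r\<close>, and replacing the flux quotient
  \<open>Q\<close> by \<open>slope v \<xi>\<close> in the term with factor (N - 1) / \<xi> gives the
  other N - 1 copies.\<close>

lemma slope_has_derivative:
  assumes v: "is_solution a v" and "\<xi> > 0" and range: "0 < v \<xi>" "v \<xi> < M"
  shows "(slope v has_real_derivative (\<kappa> + real N * \<beta>) * v \<xi> powr r - \<xi> powr \<sigma> * v \<xi> powr q
    - (real N - 1) / \<xi> * slope v \<xi> + \<beta> * \<xi> * (r * v \<xi> powr (r - 1) * slope v \<xi>)) (at \<xi>)"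
proof -
  define P where "P = \<xi> ^ (N - 1)"
  define S where "S = \<kappa> * v \<xi> powr r - \<xi> powr \<sigma> * v \<xi> powr q"
  define Q where "Q = flux v \<xi> / P"
  have "P > 0" using \<open>\<xi> > 0\<close> by (simp add: P_def)
  have cl: "clamp (v \<xi>) = v \<xi>" using range by (simp add: clamp_id)
  have "((\<lambda>\<xi>. \<xi> ^ (N - 1)) has_real_derivative real (N - 1) * \<xi> ^ (N - 1 - Suc 0)) (at \<xi>)"
    by (rule DERIV_pow)
  moreover have "real (N - 1) * \<xi> ^ (N - 1 - Suc 0) = (real N - 1) / \<xi> * P"
  proof (cases "N - 1")
    case 0
    then show ?thesis using N_pos by simp
  next
    case (Suc k)
    then have "real N - 1 = real (Suc k)" using N_pos by linarith
    then show ?thesis using Suc \<open>\<xi> > 0\<close> by (simp add: P_def)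
  qed
  ultimately have 1: "((\<lambda>\<xi>. \<xi> ^ (N - 1)) has_real_derivative (real N - 1) / \<xi> * P) (at \<xi>)"
    by simp
  have 2: "(flux v has_real_derivative P * S) (at \<xi>)"
    using flux_has_derivative[OF solution_continuous[OF v] \<open>\<xi> > 0\<close>] by (simp add: P_def S_def source_def cl)
  have "((\<lambda>\<xi>. flux v \<xi> / \<xi> ^ (N - 1)) has_real_derivative
      (P * S * \<xi> ^ (N - 1) - flux v \<xi> * ((real N - 1) / \<xi> * P)) / (\<xi> ^ (N - 1) * \<xi> ^ (N - 1))) (at \<xi>)"
    using \<open>\<xi> > 0\<close> by (intro DERIV_divide 1 2) simp
  moreover have "(P * S * P - flux v \<xi> * ((real N - 1) / \<xi> * P)) / (P * P) = S - (real N - 1) / \<xi> * Q"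
    using \<open>P > 0\<close> by (simp add: Q_def diff_divide_distrib)
  ultimately have 3: "((\<lambda>\<xi>. flux v \<xi> / \<xi> ^ (N - 1)) has_real_derivative S - (real N - 1) / \<xi> * Q) (at \<xi>)"
    by (simp add: P_def)
  have 4: "((\<lambda>\<xi>. v \<xi> powr r) has_real_derivative r * v \<xi> powr (r - 1) * slope v \<xi>) (at \<xi>)"
    by (rule DERIV_powr_const[OF solution_derivative[OF v \<open>\<xi> > 0\<close>] range(1)])
  have "(v \<longlongrightarrow> v \<xi>) (nhds \<xi>)"
    using solution_isCont[OF v \<open>\<xi> > 0\<close>] by (simp add: isCont_def tendsto_at_iff_tendsto_nhds)
  then have "\<forall>\<^sub>F x in nhds \<xi>. 0 < v x" "\<forall>\<^sub>F x in nhds \<xi>. v x < M"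
    using range by (auto intro: order_tendstoD)
  then have ev: "\<forall>\<^sub>F x in nhds \<xi>. clamp (v x) powr r = v x powr r"
    by eventually_elim (simp add: clamp_id)
  have 5: "((\<lambda>\<xi>. clamp (v \<xi>) powr r) has_real_derivative r * v \<xi> powr (r - 1) * slope v \<xi>) (at \<xi>)"
    using 4 DERIV_cong_ev[OF refl ev refl] by simp
  have "((\<lambda>\<xi>. \<beta> * \<xi>) has_real_derivative \<beta>) (at \<xi>)"
    by (auto intro!: derivative_eq_intros)
  from DERIV_add[OF 3 DERIV_mult[OF this 5]]
  have der: "(slope v has_real_derivative S - (real N - 1) / \<xi> * Q +
      (\<beta> * (clamp (v \<xi>) powr r) + r * v \<xi> powr (r - 1) * slope v \<xi> * (\<beta> * \<xi>))) (at \<xi>)"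
    by (simp add: slope_def[abs_def])
  have "slope v \<xi> = Q + \<beta> * \<xi> * v \<xi> powr r"
    by (simp add: slope_def Q_def P_def cl)
  then have "(real N - 1) / \<xi> * slope v \<xi> = (real N - 1) / \<xi> * Q + (real N - 1) * \<beta> * v \<xi> powr r"
    using \<open>\<xi> > 0\<close> by (simp add: distrib_left)
  then have eq: "S - (real N - 1) / \<xi> * Q + (\<beta> * (clamp (v \<xi>) powr r) + r * v \<xi> powr (r - 1) * slope v \<xi> * (\<beta> * \<xi>)) =
      (\<kappa> + real N * \<beta>) * v \<xi> powr r - \<xi> powr \<sigma> * v \<xi> powr q
      - (real N - 1) / \<xi> * slope v \<xi> + \<beta> * \<xi> * (r * v \<xi> powr (r - 1) * slope v \<xi>)"
    unfolding cl S_def by (simp add: algebra_simps)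
  show ?thesis using der unfolding eq .
qed

text \<open>If the slope had a first zero \<open>y\<close>, then \<open>v\<close> would be largest at \<open>y\<close> on \<open>{0..y}\<close>, which bounds
  the flux from below and makes the slope positive at \<open>y\<close>.\<close>

lemma initial_increase:
  assumes v: "is_solution a v" and "a > 0" and A: "\<kappa> + real N * \<beta> > 0" and "r \<le> q"
    and small: "\<xi>\<^sub>0 powr \<sigma> * M powr (q - r) \<le> (\<kappa> + real N * \<beta>) / 2"
    and \<eta>: "0 < \<eta>" "\<eta> \<le> \<xi>\<^sub>0"
  shows "slope v \<eta> > 0"
proof (rule ccontr)
  assume neg: "\<not> slope v \<eta> > 0"
  define A where "A = \<kappa> + real N * \<beta>"
  have "A > 0" using A by (simp add: A_def)
  note cont = solution_continuous[OF v]
  have "clamp a > 0" using \<open>a > 0\<close> M0 by (simp add: clamp_def)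
  then have "\<forall>\<^sub>F \<xi> in at_right 0. slope v \<xi> / \<xi> > 0"
    using N_pos A by (intro order_tendstoD(1)[OF slope_at_0[OF v]]) auto
  then obtain \<delta> where \<delta>: "\<delta> > 0" "\<And>\<xi>. 0 < \<xi> \<Longrightarrow> \<xi> < \<delta> \<Longrightarrow> slope v \<xi> / \<xi> > 0"
    by (auto simp: eventually_at_right_field)
  then have "\<delta> \<le> \<eta>" using neg \<eta> by (force simp: zero_less_divide_iff)
  \<comment> \<open>\<open>slope v\<close> vanishes at 0, so the search for its first nonpositive
    value starts at \<open>\<delta> / 2\<close>, where positivity is already known.\<close>
  have "continuous_on {\<delta> / 2..\<eta>} (slope v)"
    using \<delta>(1) by (intro continuous_on_subset[OF continuous_on_slope[OF cont]]) auto
  then obtain y where y: "\<delta> / 2 \<le> y" "y \<le> \<eta>" "slope v y \<le> 0"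
    and y_first: "\<forall>x. \<delta> / 2 \<le> x \<longrightarrow> x < y \<longrightarrow> 0 < slope v x"
    using first_nonpositive[of "\<delta> / 2" \<eta> "slope v"] neg \<open>\<delta> \<le> \<eta>\<close> \<delta>(1) by auto
  then have "y > 0" using \<delta>(1) by simp
  have pos: "slope v x > 0" if "0 < x" "x < y" for x
    using \<delta>(2)[OF that(1)] y_first[rule_format, OF _ that(2)] that(1) \<delta>(1)
    by (cases "x < \<delta>") (auto simp: zero_less_divide_iff)
  have v_le: "v x \<le> v z" if "0 \<le> x" "x \<le> z" "z \<le> y" for x z
  proof (rule DERIV_nonneg_imp_increasing_open[OF that(2)])
    fix t assume "x < t" "t < z"
    then show "\<exists>d. (v has_real_derivative d) (at t) \<and> 0 \<le> d"
      using solution_derivative[OF v, of t] pos[of t] that by (intro exI[of _ "slope v t"]) auto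
  qed (use that in \<open>auto intro: continuous_on_subset[OF cont]\<close>)
  define \<phi> where "\<phi> = clamp (v y) powr r"
  have "v y \<ge> a" using v_le[of 0 y] \<open>y > 0\<close> solution_at_0[OF v] by simp
  then have "clamp (v y) > 0" using \<open>a > 0\<close> M0 by (simp add: clamp_def)
  then have "\<phi> > 0" by (simp add: \<phi>_def)
  \<comment> \<open>With \<open>A = \<kappa> + N * \<beta>\<close> and the reaction coefficient at
    most \<open>A / 2\<close>, the source is at least
    \<open>(A / 2 - N * \<beta>) * k powr r\<close>. The maximum with 0 makes \<open>B\<close>
    nonnegative, so that \<open>k powr r\<close> may be replaced by its upper bound \<phi>. Since
    \<open>B < N * \<beta>\<close>, the positive term of the slope wins at \<open>y\<close>.\<close>
  define B where "B = max 0 (real N * \<beta> - A / 2)"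
  have "B \<ge> 0" "B < real N * \<beta>"
    using \<open>A > 0\<close> N_pos \<beta>0 by (auto simp: B_def)
  have src: "source x (v x) \<ge> - B * \<phi>" if x: "0 < x" "x < y" for x
  proof -
    define k where "k = clamp (v x)"
    have "k \<ge> 0" "k \<le> M" using clamp_bounds by (simp_all add: k_def)
    have "k powr q = k powr r * k powr (q - r)"
      using powr_add[of k r "q - r"] by simp
    moreover have "x powr \<sigma> * k powr (q - r) \<le> \<xi>\<^sub>0 powr \<sigma> * M powr (q - r)"
      using x y(2) \<eta> \<sigma>0 \<open>k \<ge> 0\<close> \<open>k \<le> M\<close> \<open>r \<le> q\<close> by (intro mult_mono powr_mono2) auto
    then have "k powr r * (x powr \<sigma> * k powr (q - r)) \<le> k powr r * (A / 2)"
      using small unfolding A_def by (intro mult_left_mono) auto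
    ultimately have "source x (v x) \<ge> k powr r * (\<kappa> - A / 2)"
      by (simp add: source_def k_def[symmetric] algebra_simps)
    moreover have "k powr r * (- B) \<le> k powr r * (\<kappa> - A / 2)"
    proof (rule mult_left_mono)
      have "real N * \<beta> - A / 2 \<le> B" by (simp add: B_def)
      then show "- B \<le> \<kappa> - A / 2" using A_def by linarith
    qed simp
    moreover have "k powr r \<le> \<phi>"
    proof -
      have "k \<le> clamp (v y)"
        using v_le[of x y] x by (auto simp: k_def clamp_def)
      then show ?thesis unfolding \<phi>_def using \<open>k \<ge> 0\<close> r1 by (intro powr_mono2) auto
    qed
    then have "B * k powr r \<le> B * \<phi>" using \<open>B \<ge> 0\<close> by (intro mult_left_mono)
    ultimately show ?thesis by (simp add: mult.commute)
  qed
  have "flux v 0 + B * \<phi> * (0 ^ N / real N) \<le> flux v y + B * \<phi> * (y ^ N / real N)"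
  proof (rule DERIV_nonneg_imp_increasing_open[where f = "\<lambda>x. flux v x + B * \<phi> * (x ^ N / real N)"])
    fix x assume x: "0 < x" "x < y"
    have "((\<lambda>x. x ^ N / real N) has_real_derivative real N * x ^ (N - Suc 0) / real N) (at x)"
      by (intro DERIV_cdivide DERIV_pow)
    then have "((\<lambda>x. x ^ N / real N) has_real_derivative x ^ (N - 1)) (at x)"
      using N_pos by simp
    then have "((\<lambda>x. flux v x + B * \<phi> * (x ^ N / real N)) has_real_derivative
        x ^ (N - 1) * source x (v x) + B * \<phi> * x ^ (N - 1)) (at x)"
      by (intro DERIV_add DERIV_cmult flux_has_derivative cont x)
    moreover have "0 \<le> x ^ (N - 1) * (source x (v x) + B * \<phi>)"
      using src[OF x] x by (intro mult_nonneg_nonneg) auto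
    then have "0 \<le> x ^ (N - 1) * source x (v x) + B * \<phi> * x ^ (N - 1)"
      by (simp add: algebra_simps)
    ultimately show "\<exists>d. ((\<lambda>x. flux v x + B * \<phi> * (x ^ N / real N)) has_real_derivative d) (at x) \<and> 0 \<le> d"
      by blast
  next
    have "continuous_on {0..y} (flux v)"
      unfolding flux_def[abs_def]
      by (intro indefinite_integral_continuous_1 integrable_continuous_interval
          continuous_on_subset[OF continuous_on_integrand[OF cont]]) auto
    then show "continuous_on {0..y} (\<lambda>x. flux v x + B * \<phi> * (x ^ N / real N))"
      using N_pos by (intro continuous_intros) auto
  qed (use \<open>y > 0\<close> in simp)
  then have "- (B * \<phi> * (y ^ N / real N)) \<le> flux v y"
    using N_pos by (simp add: power_0_left)
  then have "- (B * \<phi> * (y ^ N / real N)) / y ^ (N - 1) \<le> flux v y / y ^ (N - 1)"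
    using \<open>y > 0\<close> by (intro divide_right_mono) auto
  moreover have "- (B * \<phi> * (y ^ N / real N)) / y ^ (N - 1) = - (B / real N * \<phi> * y)"
    using \<open>y > 0\<close> unfolding power_N[symmetric] by simp
  ultimately have "(\<beta> - B / real N) * (\<phi> * y) \<le> slope v y"
    by (simp add: slope_def \<phi>_def algebra_simps)
  moreover have "B / real N < \<beta>"
    using \<open>B < real N * \<beta>\<close> N_pos by (simp add: divide_less_eq mult.commute)
  then have "0 < (\<beta> - B / real N) * (\<phi> * y)"
    using \<open>\<phi> > 0\<close> \<open>y > 0\<close> by simp
  ultimately show False using y(3) by simp
qed

end

section \<open>The profile equation\<close>

locale profile_eq =
  fixes N :: nat and m \<sigma> p :: real
  assumes N1: "N \<ge> 1" and m0: "0 < m" and m1: "m < 1" and \<sigma>0: "\<sigma> > 0" and p1: "1 < p"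
    and pL: "p < p_L m \<sigma>"
begin

abbreviation \<alpha> :: real where "\<alpha> \<equiv> alpha m \<sigma> p"
abbreviation \<beta> :: real where "\<beta> \<equiv> beta m \<sigma> p"

text \<open>For f = \<xi> powr (-\<theta>) diffusion and reaction have the same order, and the
  first-order part \<alpha> f + \<beta> \<xi> f' vanishes.\<close>

definition \<theta> :: real where "\<theta> = (\<sigma> + 2) / (p - m)"
definition \<nu> :: real where "\<nu> = \<theta> * m"
text \<open>Multiplication by \<open>\<xi> powr (- \<nu>)\<close> turns the decay
  \<open>\<xi> powr (- \<mu>)\<close> of \<open>V\<close> into the fundamental decay
  \<open>\<xi> powr (- (N - 2))\<close> of \<open>f powr m\<close>.\<close>

definition \<mu> :: real where "\<mu> = real N - 2 - \<nu>"

section \<open>Relations between the exponents\<close>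

lemma L_neg: "L_exp m \<sigma> p < 0"
  using pL by (simp add: L_exp_def p_L_def field_simps)

lemma \<beta>_pos: "\<beta> > 0"
  using L_neg p1 m1 by (simp add: beta_def divide_neg_neg)

lemma \<theta>_pos: "\<theta> > 0"
  using \<sigma>0 p1 m1 by (simp add: \<theta>_def)

lemma \<nu>_pos: "\<nu> > 0"
  using \<theta>_pos m0 by (simp add: \<nu>_def)

lemma \<theta>_balance: "\<theta> * (p - m) = \<sigma> + 2"
  using p1 m1 by (simp add: \<theta>_def)

lemma \<alpha>_eq: "\<alpha> = \<beta> * \<theta>"
proof -
  have "\<beta> * \<theta> = - (\<theta> * (p - m)) / L_exp m \<sigma> p"
    unfolding beta_def times_divide_eq_left by (simp only: mult_minus_left mult.commute[of \<theta>])
  then show ?thesis unfolding \<theta>_balance by (simp add: alpha_def)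
qed

lemma \<alpha>_pos: "\<alpha> > 0"
  using \<beta>_pos \<theta>_pos by (simp add: \<alpha>_eq)

text \<open>The left side is the decay exponent of the drift in the logarithmic variable; the right
  side is positive because p < p_L.\<close>

lemma \<beta>_balance: "\<theta> * (1 - m) - 2 = 1 / \<beta>"
proof -
  have "(p - m) * (\<theta> * (1 - m) - 2) = (\<theta> * (p - m)) * (1 - m) - 2 * (p - m)"
    by (simp add: algebra_simps)
  also have "\<dots> = - L_exp m \<sigma> p"
    unfolding \<theta>_balance by (simp add: L_exp_def algebra_simps)
  finally have "\<theta> * (1 - m) - 2 = - L_exp m \<sigma> p / (p - m)"
    using p1 m1 by (simp add: field_simps)
  also have "\<dots> = 1 / \<beta>"
    using divide_minus_right[of "L_exp m \<sigma> p" "p - m"] by (simp add: beta_def)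
  finally show ?thesis .
qed

lemma \<nu>_div_m: "\<nu> / m = \<theta>"
  using m0 by (simp add: \<nu>_def)

sublocale emden "\<mu> - \<nu>" "\<nu> * \<mu>" "p / m" "1 / m" \<beta>
  using m0 m1 p1 \<beta>_pos by unfold_locales (simp_all add: divide_strict_right_mono)

section \<open>Logarithmic variables\<close>

definition V_of :: "(real \<Rightarrow> real) \<Rightarrow> real \<Rightarrow> real" where
  "V_of v s = exp (\<nu> * s) * v (exp s)"

definition U_of :: "(real \<Rightarrow> real) \<Rightarrow> (real \<Rightarrow> real) \<Rightarrow> real \<Rightarrow> real" where
  "U_of v v' s = exp (\<nu> * s) * (\<nu> * v (exp s) + exp s * v' (exp s))"

lemma V_of_derivative:
  assumes "(v has_real_derivative v' (exp s)) (at (exp s))"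
  shows "(V_of v has_real_derivative U_of v v' s) (at s)"
proof -
  have 1: "((\<lambda>s. exp (\<nu> * s)) has_real_derivative exp (\<nu> * s) * \<nu>) (at s)"
    by (auto intro!: derivative_eq_intros)
  have 2: "((\<lambda>s. v (exp s)) has_real_derivative v' (exp s) * exp s) (at s)"
    by (rule DERIV_chain2[OF assms DERIV_exp])
  show ?thesis
    using DERIV_mult[OF 1 2] by (simp add: V_of_def[abs_def] U_of_def algebra_simps)
qed

text \<open>Although \<open>h\<close> is unbounded as \<open>s\<close> tends to minus infinity, in
  the original variable the drift coefficient is a multiple of
  \<open>\<xi>^2 * v powr (1 / m - 1)\<close>, hence uniformly small on bounded intervals when
  \<open>v\<close> is small.\<close>

lemma damping_V_of:
  assumes "v (exp s) > 0"
  shows "h s * V_of v s powr (1 / m - 1) = \<beta> / m * exp (2 * s) * v (exp s) powr (1 / m - 1)"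
proof -
  have "\<nu> * (1 / m - 1) - 1 / \<beta> = 2"
    unfolding \<beta>_balance[symmetric] using m0 by (simp add: \<nu>_def algebra_simps)
  moreover have "- s / \<beta> + \<nu> * s * (1 / m - 1) = (\<nu> * (1 / m - 1) - 1 / \<beta>) * s"
    by (simp add: algebra_simps)
  ultimately have "- s / \<beta> + \<nu> * s * (1 / m - 1) = 2 * s"
    by simp
  then have "exp (- s / \<beta>) * exp (\<nu> * s * (1 / m - 1)) = exp (2 * s)"
    by (simp add: exp_add[symmetric])
  moreover have "V_of v s powr (1 / m - 1) = exp (\<nu> * s * (1 / m - 1)) * v (exp s) powr (1 / m - 1)"
    using assms by (simp add: V_of_def powr_mult exp_powr_real)
  ultimately show ?thesis by (simp add: h_def)
qed

text \<open>The exponent \<open>\<nu>\<close> balances diffusion against reaction (\<open>\<theta>_balance\<close>); by \<open>\<beta>_balance\<close> the drift then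
  carries the factor \<open>exp (- s / \<beta>)\<close>.\<close>

lemma solves_V_of:
  assumes pos: "v (exp s) > 0"
    and v: "(v has_real_derivative v' (exp s)) (at (exp s))"
    and v': "(v' has_real_derivative d) (at (exp s))"
    and ode: "d + (real N - 1) / exp s * v' (exp s) - \<alpha> * v (exp s) powr (1 / m)
      - \<beta> * exp s * (1 / m * v (exp s) powr (1 / m - 1) * v' (exp s))
      + exp s powr \<sigma> * v (exp s) powr (p / m) = 0"
  shows "solves {s} (V_of v) (U_of v v')"
proof -
  define E where "E = exp (\<nu> * s)"
  define w where "w = v (exp s)"
  define x where "x = exp s * v' (exp s)"
  define g where "g = w powr (1 / m - 1)"
  have "w > 0" using pos by (simp add: w_def)
  have V: "V_of v s = E * w" and U: "U_of v v' s = E * (\<nu> * w + x)"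
    by (simp_all add: V_of_def U_of_def E_def w_def x_def)
  have w_r: "w powr (1 / m) = w * g"
    using \<open>w > 0\<close> powr_add[of w 1 "1 / m - 1"] by (simp add: g_def)
  have V_q: "V_of v s powr (p / m) = E * (exp (2 * s) * (exp s powr \<sigma> * w powr (p / m)))"
  proof -
    have "\<nu> * (p / m) = \<nu> + (\<sigma> + 2)"
      using m0 \<theta>_balance by (simp add: \<nu>_def right_diff_distrib)
    moreover have "\<nu> * s * (p / m) = \<nu> * (p / m) * s" by simp
    ultimately have "\<nu> * s * (p / m) = \<nu> * s + 2 * s + s * \<sigma>"
      by (simp add: algebra_simps)
    then show ?thesis
      using \<open>w > 0\<close> by (simp add: V powr_mult E_def exp_powr_real exp_add)
  qed
  have damp: "h s * V_of v s powr (1 / m - 1) = \<beta> / m * exp (2 * s) * g"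
    using damping_V_of[of v s, OF pos] by (simp add: g_def w_def)
  have e2: "exp (2 * s) = exp s * exp s"
    by (simp add: exp_add[symmetric])
  have ode': "exp (2 * s) * d = - (real N - 1) * x + exp (2 * s) * (\<alpha> * (w * g)) + \<beta> / m * exp (2 * s) * g * x
      - exp (2 * s) * (exp s powr \<sigma> * w powr (p / m))"
  proof -
    define T1 where "T1 = (real N - 1) / exp s * v' (exp s)"
    define T2 where "T2 = \<beta> * exp s * (1 / m * g * v' (exp s))"
    have T: "- (exp (2 * s) * T1) = - (real N - 1) * x"
    proof -
      have "exp (2 * s) * T1 = (real N - 1) * x"
        unfolding T1_def x_def e2 by simp
      then show ?thesis by (simp only: mult_minus_left)
    qed
    have T': "exp (2 * s) * T2 = \<beta> / m * exp (2 * s) * g * x"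
      unfolding T2_def x_def e2 by simp
    have "d = - T1 + \<alpha> * (w * g) + T2 - exp s powr \<sigma> * w powr (p / m)"
      using ode[folded w_def, folded g_def, folded T1_def T2_def, unfolded w_r] by simp
    then have "exp (2 * s) * d = exp (2 * s) * (- T1 + \<alpha> * (w * g) + T2 - exp s powr \<sigma> * w powr (p / m))"
      by (rule arg_cong)
    then have "exp (2 * s) * d = - (exp (2 * s) * T1) + exp (2 * s) * (\<alpha> * (w * g)) + exp (2 * s) * T2
        - exp (2 * s) * (exp s powr \<sigma> * w powr (p / m))"
      by (simp add: algebra_simps)
    then show ?thesis unfolding T T' .
  qed
  have 1: "((\<lambda>s. exp (\<nu> * s)) has_real_derivative \<nu> * E) (at s)"
    unfolding E_def by (auto intro!: derivative_eq_intros)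
  have 2: "((\<lambda>s. v (exp s)) has_real_derivative x) (at s)"
    using DERIV_chain2[OF v DERIV_exp] by (simp add: x_def mult.commute)
  have 3: "((\<lambda>s. exp s * v' (exp s)) has_real_derivative x + exp (2 * s) * d) (at s)"
    using DERIV_mult[OF DERIV_exp[of s] DERIV_chain2[OF v' DERIV_exp]]
    unfolding e2 by (simp add: x_def mult_ac)
  have U_der: "(U_of v v' has_real_derivative
      \<nu> * E * (\<nu> * w + x) + (\<nu> * x + (x + exp (2 * s) * d)) * E) (at s)"
    unfolding U_of_def[abs_def] w_def x_def E_def
    using DERIV_mult[OF 1[unfolded E_def] DERIV_add[OF DERIV_cmult[OF 2] 3, of \<nu>]] by (simp add: x_def)
  \<comment> \<open>The term \<alpha> f has no separate counterpart in \<open>accel\<close>: the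
    velocity contains \<open>\<nu> * w\<close>, and \<beta> * \<nu> / m = \<beta> * \<theta> =
    \<alpha>, so the drift term accounts for it.\<close>
  have "\<nu> * E * (\<nu> * w + x) + (\<nu> * x + (x + exp (2 * s) * d)) * E = accel s (V_of v s) (U_of v v' s)"
    unfolding accel_def V_q damp unfolding V U ode' \<mu>_def
    using m0 by (simp add: \<alpha>_eq \<nu>_def algebra_simps add_divide_distrib)
  then have "(U_of v v' has_real_derivative accel s (V_of v s) (U_of v v' s)) (at s)"
    using U_der by simp
  moreover have "0 < V_of v s" using \<open>w > 0\<close> by (simp add: V E_def)
  moreover have "(V_of v has_real_derivative U_of v v' s) (at s)"
    by (rule V_of_derivative[of v v' s, OF v])
  ultimately show ?thesis by (simp add: solves_def)
qed

section \<open>Nonexistence\<close>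

lemma no_profile:
  assumes damp: "\<mu> - \<nu> < 0" and prof: "is_profile N m \<sigma> p f"
  shows False
proof -
  define v where "v x = f x powr m" for x
  have f_nonneg: "f x \<ge> 0" if "x \<ge> 0" for x
    using prof that by (simp add: is_profile_def)
  have f_0: "f 0 > 0" and f_der0: "(f has_real_derivative 0) (at 0 within {0..})"
    using prof by (simp_all add: is_profile_def)
  \<comment> \<open>The continuous representative of the derivative of \<open>f powr m\<close> is
    defined also at zeros of \<open>f\<close>; it makes the velocity, and with it the energy,
    continuous up to an interface.\<close>
  obtain D where D: "\<And>x. x > 0 \<Longrightarrow> (v has_real_derivative D x) (at x)" "continuous_on {0<..} D"
    using prof unfolding is_profile_def C1_differentiable_on_def v_def[abs_def]
    by (auto simp: has_real_derivative_iff_has_vector_derivative)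
  have deriv_v: "deriv v x = D x" if "x > 0" for x
    by (rule DERIV_imp_deriv[OF D(1)[OF that]])
  have "(f \<longlongrightarrow> f 0) (at 0 within {0..})"
    using DERIV_continuous[OF f_der0] by (simp add: continuous_within)
  then have v_lim: "(v \<longlongrightarrow> v 0) (at 0 within {0..})"
    unfolding v_def using f_0 by (intro tendsto_intros) auto
  have v_cont: "continuous_on {0..} v"
    unfolding continuous_on_eq_continuous_within
  proof
    fix x :: real assume "x \<in> {0..}"
    show "continuous (at x within {0..}) v"
    proof (cases "x = 0")
      case True
      then show ?thesis using v_lim by (simp add: continuous_within)
    next
      case False
      then have "isCont v x" using D(1)[of x] \<open>x \<in> {0..}\<close> by (auto intro: DERIV_isCont)
      then show ?thesis by (rule continuous_at_imp_continuous_at_within)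
    qed
  qed
  have V_der: "(V_of v has_real_derivative U_of v D s) (at s)" for s
    by (rule V_of_derivative[of v D s, OF D(1)]) simp
  have V_cont: "continuous_on S (V_of v)" for S
    using V_der by (intro continuous_at_imp_continuous_on) (auto intro: DERIV_isCont)
  have U_cont: "continuous_on S (U_of v D)" for S
    unfolding U_of_def[abs_def]
    by (intro continuous_intros continuous_on_compose2[OF D(2)] continuous_on_compose2[OF v_cont]) auto
  have solves: "solves {s} (V_of v) (U_of v D)" if "v (exp s) > 0" for s
  proof -
    define x where "x = exp s"
    have "x > 0" by (simp add: x_def)
    have "f x > 0" using that f_nonneg[of x] \<open>x > 0\<close> unfolding v_def x_def[symmetric] by (cases "f x = 0") auto
    have ev: "\<forall>\<^sub>F y in nhds x. y \<in> {0<..}"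
      using \<open>x > 0\<close> by (intro eventually_nhds_in_open) auto
    have "deriv v differentiable (at x)" and f_diff: "f differentiable (at x)" and
      ode: "deriv (deriv v) x + (real N - 1) / x * deriv v x - \<alpha> * f x - \<beta> * x * deriv f x + x powr \<sigma> * f x powr p = 0"
      using prof \<open>f x > 0\<close> \<open>x > 0\<close> unfolding is_profile_def v_def[abs_def] by blast+
    then have "(deriv v has_real_derivative deriv (deriv v) x) (at x)"
      by (simp add: DERIV_deriv_iff_real_differentiable)
    moreover have evD: "\<forall>\<^sub>F y in nhds x. deriv v y = D y"
      using ev by (rule eventually_mono) (simp add: deriv_v)
    ultimately have D_der: "(D has_real_derivative deriv (deriv v) x) (at x)"
      using DERIV_cong_ev[OF refl evD refl] by simp
    have f_eq: "f y = v y powr (1 / m)" if "y \<ge> 0" for y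
      using f_nonneg[OF that] m0 by (simp add: v_def powr_powr)
    have "v x > 0" using that by (simp add: x_def)
    have "((\<lambda>y. v y powr (1 / m)) has_real_derivative 1 / m * v x powr (1 / m - 1) * D x) (at x)"
      by (rule DERIV_powr_const[OF D(1)[OF \<open>x > 0\<close>] \<open>v x > 0\<close>])
    moreover have evf: "\<forall>\<^sub>F y in nhds x. f y = v y powr (1 / m)"
      using ev by (rule eventually_mono) (simp add: f_eq)
    ultimately have "(f has_real_derivative 1 / m * v x powr (1 / m - 1) * D x) (at x)"
      using DERIV_cong_ev[OF refl evf refl] by simp
    then have f': "deriv f x = 1 / m * v x powr (1 / m - 1) * D x"
      by (rule DERIV_imp_deriv)
    have f_p: "f x powr p = v x powr (p / m)"
      using f_eq[of x] \<open>x > 0\<close> by (simp add: powr_powr)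
    show ?thesis
    proof (rule solves_V_of[of v s D])
      show "(D has_real_derivative deriv (deriv v) x) (at (exp s))"
        using D_der by (simp add: x_def)
      show "deriv (deriv v) x + (real N - 1) / exp s * D (exp s) - \<alpha> * v (exp s) powr (1 / m)
          - \<beta> * exp s * (1 / m * v (exp s) powr (1 / m - 1) * D (exp s))
          + exp s powr \<sigma> * v (exp s) powr (p / m) = 0"
        using ode f_eq[of x] \<open>x > 0\<close> unfolding f' f_p deriv_v[OF \<open>x > 0\<close>] x_def[symmetric] by simp
    qed (use that D(1)[of "exp s"] in auto)
  qed
  have solvesI: "solves I (V_of v) (U_of v D)" if "\<And>s. s \<in> I \<Longrightarrow> v (exp s) > 0" for I
    using solves[OF that] by (auto simp: solves_def)
  have lim: "(V_of v \<longlongrightarrow> 0) at_bot"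
  proof -
    have "filterlim (exp :: real \<Rightarrow> real) (at 0 within {0..}) at_bot"
      using exp_at_bot by (auto simp: filterlim_at)
    then have "((\<lambda>s. v (exp s)) \<longlongrightarrow> v 0) at_bot"
      by (rule filterlim_compose[OF v_lim])
    moreover have "((\<lambda>s. exp (\<nu> * s)) \<longlongrightarrow> 0) at_bot"
      using \<nu>_pos by (intro filterlim_compose[OF exp_at_bot] filterlim_tendsto_pos_mult_at_bot[OF tendsto_const]
          filterlim_ident)
    ultimately have "((\<lambda>s. exp (\<nu> * s) * v (exp s)) \<longlongrightarrow> 0 * v 0) at_bot"
      by (intro tendsto_mult)
    then show ?thesis by (simp add: V_of_def[abs_def])
  qed
  have E_pos: "energy (V_of v) (U_of v D) b > 0" if "\<And>s. s \<le> b \<Longrightarrow> v (exp s) > 0" for b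
    using that by (intro energy_positive_from_minus_infinity[OF damp] solvesI lim) auto
  show False
  proof (cases "\<exists>x>0. f x = 0")
    case False
    have pos: "v (exp s) > 0" for s
    proof -
      have "f (exp s) \<noteq> 0" using False by auto
      then have "f (exp s) > 0" using f_nonneg[of "exp s"] by (simp add: less_le)
      then show ?thesis by (simp add: v_def)
    qed
    show False
      by (rule no_positive_energy_if_antidamped[OF damp solvesI E_pos]) (rule pos)+
  next
    case True
    then obtain z where z: "z > 0" "f z = 0" by blast
    have "v z \<le> 0" using z m0 by (simp add: v_def)
    moreover have "continuous_on {0..z} v"
      by (rule continuous_on_subset[OF v_cont]) auto
    ultimately obtain y where y: "0 \<le> y" "y \<le> z" "v y \<le> 0"
      and y_first: "\<forall>x. 0 \<le> x \<longrightarrow> x < y \<longrightarrow> 0 < v x"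
      using first_nonpositive[of 0 z v] z(1) by auto
    have "v 0 > 0" using f_0 by (simp add: v_def)
    then have "y > 0" using y(1,3) by (cases "y = 0") auto
    define b where "b = ln y"
    have "exp b = y" using \<open>y > 0\<close> by (simp add: b_def)
    have pos: "v (exp s) > 0" if "s < b" for s
      using that \<open>exp b = y\<close> exp_less_mono[of s b] by (intro y_first[rule_format]) auto
    have "f y = 0"
      using y(3) m0 powr_gt_zero[of "f y" m] unfolding v_def by linarith
    then have "D y = 0"
      using DERIV_unique[OF D(1)[OF \<open>y > 0\<close>]] is_profile_interface[OF prof \<open>y > 0\<close>]
      unfolding v_def[abs_def] by blast
    then have E0: "energy (V_of v) (U_of v D) b = 0"
      using \<open>f y = 0\<close> m0 by (simp add: energy_def V_of_def U_of_def \<open>exp b = y\<close> v_def)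
    \<comment> \<open>The equation holds only before the interface, so monotonicity is used in the
      open interval and extended to \<open>b\<close> by continuity.\<close>
    have "energy (V_of v) (U_of v D) (b - 1) \<le> energy (V_of v) (U_of v D) b"
    proof (rule DERIV_nonneg_imp_increasing_open[where f = "energy (V_of v) (U_of v D)"])
      fix x assume "b - 1 < x" "x < b"
      then have "(energy (V_of v) (U_of v D) has_real_derivative
          (U_of v D x)\<^sup>2 * (h x * V_of v x powr (1 / m - 1) - (\<mu> - \<nu>))) (at x)"
        by (intro energy_derivative[of "{x}"] solvesI pos) auto
      moreover have "0 \<le> h x * V_of v x powr (1 / m - 1)"
        using h_pos[of x] by simp
      then have "0 \<le> (U_of v D x)\<^sup>2 * (h x * V_of v x powr (1 / m - 1) - (\<mu> - \<nu>))"
        using damp by (intro mult_nonneg_nonneg) auto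
      ultimately show "\<exists>y. (energy (V_of v) (U_of v D) has_real_derivative y) (at x) \<and> 0 \<le> y"
        by blast
    qed (auto intro: continuous_on_energy V_cont U_cont)
    moreover have "energy (V_of v) (U_of v D) (b - 1) > 0"
      by (intro E_pos pos) simp
    ultimately show False using E0 by simp
  qed
qed

section \<open>Sign of the damping coefficient\<close>

lemma \<nu>_times: "\<nu> * (p - m) = (\<sigma> + 2) * m"
  using \<theta>_balance by (simp add: \<nu>_def mult_ac)

lemma damped_iff: "\<mu> - \<nu> > 0 \<longleftrightarrow> 2 * ((\<sigma> + 2) * m) < (real N - 2) * (p - m)"
proof -
  have "p - m > 0" using p1 m1 by simp
  have "\<mu> - \<nu> > 0 \<longleftrightarrow> 0 < (\<mu> - \<nu>) * (p - m)"
    using \<open>p - m > 0\<close> by (simp add: zero_less_mult_iff)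
  also have "(\<mu> - \<nu>) * (p - m) = (real N - 2) * (p - m) - 2 * ((\<sigma> + 2) * m)"
    unfolding \<nu>_times[symmetric] \<mu>_def by (simp add: algebra_simps)
  finally show ?thesis by simp
qed

lemma antidamped_iff: "\<mu> - \<nu> < 0 \<longleftrightarrow> (real N - 2) * (p - m) < 2 * ((\<sigma> + 2) * m)"
proof -
  have "p - m > 0" using p1 m1 by simp
  have "\<mu> - \<nu> < 0 \<longleftrightarrow> (\<mu> - \<nu>) * (p - m) < 0"
    using \<open>p - m > 0\<close> by (simp add: mult_less_0_iff)
  also have "(\<mu> - \<nu>) * (p - m) = (real N - 2) * (p - m) - 2 * ((\<sigma> + 2) * m)"
    unfolding \<nu>_times[symmetric] \<mu>_def by (simp add: algebra_simps)
  finally show ?thesis by simp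
qed

lemma supercritical_damped:
  assumes "N \<ge> 3" "p_s N m \<sigma> < ereal p"
  shows "\<mu> - \<nu> > 0"
proof -
  have "m * (real N + 2 * \<sigma> + 2) < p * (real N - 2)"
    using assms by (simp add: p_s_def divide_less_eq)
  then show ?thesis unfolding damped_iff by (simp add: algebra_simps)
qed

text \<open>For N \<le> 2 the coefficient N - 2 - 2 \<nu> is visibly negative. For N \<ge> 3, m
  \<ge> m_s means (N - 2)(1 - m) \<le> 4 m, and p < p_L means p - m < (\<sigma> + 2)(1 - m) / 2;
  together they give the inequality of \<open>antidamped_iff\<close>. The last case is that
  inequality rewritten.\<close>

lemma subcritical_antidamped:
  assumes "m \<ge> m_s N \<or> N \<in> {1, 2} \<or> ereal p < p_s N m \<sigma>"
  shows "\<mu> - \<nu> < 0"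
proof (cases "N \<ge> 3")
  case False
  then have "real N - 2 \<le> 0" by simp
  then show ?thesis using \<nu>_pos by (simp add: \<mu>_def)
next
  case True
  then consider "m \<ge> m_s N" | "ereal p < p_s N m \<sigma>" using assms by auto
  then show ?thesis
  proof cases
    case 1
    then have "(real N - 2) * (1 - m) \<le> 4 * m"
      by (simp add: m_s_def divide_le_eq algebra_simps)
    then have "(\<sigma> + 2) / 2 * ((real N - 2) * (1 - m)) \<le> (\<sigma> + 2) / 2 * (4 * m)"
      using \<sigma>0 by (intro mult_left_mono) auto
    moreover have "(real N - 2) * (p - m) < (real N - 2) * ((\<sigma> + 2) / 2 * (1 - m))"
    proof (rule mult_strict_left_mono)
      show "p - m < (\<sigma> + 2) / 2 * (1 - m)"
        using pL by (simp add: p_L_def field_simps)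
    qed (use True in simp)
    moreover have "(real N - 2) * ((\<sigma> + 2) / 2 * (1 - m)) = (\<sigma> + 2) / 2 * ((real N - 2) * (1 - m))"
      "(\<sigma> + 2) / 2 * (4 * m) = 2 * ((\<sigma> + 2) * m)"
      by simp_all
    ultimately show ?thesis unfolding antidamped_iff by linarith
  next
    case 2
    then have "p * (real N - 2) < m * (real N + 2 * \<sigma> + 2)"
      using True by (simp add: p_s_def less_divide_eq)
    then show ?thesis unfolding antidamped_iff by (simp add: algebra_simps)
  qed
qed

end

section \<open>Truncated solutions as profiles\<close>

locale truncated_profile_eq = profile_eq +
  fixes M :: real
  assumes M_pos: "M > 0"
begin

sublocale vol: radial_volterra N "1 / m" "p / m" \<sigma> "\<alpha> - real N * \<beta>" \<beta> M
  using N1 m0 m1 p1 \<sigma>0 \<beta>_pos M_pos by unfold_locales auto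

lemma solves_solution:
  assumes v: "vol.is_solution a v" and "0 < v (exp s)" "v (exp s) < M"
  shows "solves {s} (V_of v) (U_of v (vol.slope v))"
  by (rule solves_V_of[of v s "vol.slope v", OF assms(2) vol.solution_derivative[OF v]
        vol.slope_has_derivative[OF v _ assms(2,3)]]) (auto simp: algebra_simps)

lemma profile_of_solution:
  assumes v: "vol.is_solution a v" and range: "\<And>\<xi>. \<xi> \<ge> 0 \<Longrightarrow> 0 < v \<xi> \<and> v \<xi> < M"
  shows "is_profile N m \<sigma> p (\<lambda>\<xi>. v \<xi> powr (1 / m))"
proof -
  define f where "f \<xi> = v \<xi> powr (1 / m)" for \<xi>
  have f_m: "f \<xi> powr m = v \<xi>" if "\<xi> > 0" for \<xi>
    using range[of \<xi>] that m0 by (simp add: f_def powr_powr)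
  note cont = vol.solution_continuous[OF v]
  have v_der: "(v has_real_derivative vol.slope v \<xi>) (at \<xi>)" if "\<xi> > 0" for \<xi>
    by (rule vol.solution_derivative[OF v that])
  have ev_pos: "\<forall>\<^sub>F x in nhds \<xi>. x > 0" if "\<xi> > 0" for \<xi> :: real
    using eventually_nhds_in_open[of "{0<..}" \<xi>] that by simp
  have fm_der: "((\<lambda>\<xi>. f \<xi> powr m) has_real_derivative vol.slope v \<xi>) (at \<xi>)" if "\<xi> > 0" for \<xi>
  proof -
    have ev: "\<forall>\<^sub>F x in nhds \<xi>. f x powr m = v x"
      using ev_pos[OF that] by (rule eventually_mono) (rule f_m)
    show ?thesis using v_der[OF that] DERIV_cong_ev[OF refl ev refl] by simp
  qed
  have d1: "deriv (\<lambda>\<xi>. f \<xi> powr m) \<xi> = vol.slope v \<xi>" if "\<xi> > 0" for \<xi>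
    by (rule DERIV_imp_deriv[OF fm_der[OF that]])
  have f_der: "(f has_real_derivative 1 / m * v \<xi> powr (1 / m - 1) * vol.slope v \<xi>) (at \<xi>)" if "\<xi> > 0" for \<xi>
    unfolding f_def[abs_def] using range[of \<xi>] that by (intro DERIV_powr_const v_der) auto
  \<comment> \<open>The integral equation yields the one-sided derivative
    \<open>slope v 0 = 0\<close> relative to \<open>{0..1}\<close>, which near 0 is the same as the
    half-line.\<close>
  have "(f has_real_derivative 0) (at 0 within {0..})"
  proof -
    have "continuous_on {0..1} (vol.slope v)"
      by (rule continuous_on_subset[OF vol.continuous_on_slope[OF cont]]) auto
    then have "((\<lambda>\<xi>. a + integral {0..\<xi>} (vol.slope v)) has_real_derivative 0 + vol.slope v 0) (at 0 within {0..1})"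
      by (intro DERIV_add DERIV_const integral_has_real_derivative) auto
    then have "((\<lambda>\<xi>. a + integral {0..\<xi>} (vol.slope v)) has_real_derivative 0) (at 0 within {0..1})"
      by simp
    then have "(v has_real_derivative 0) (at 0 within {0..1})"
      by (rule has_field_derivative_transform_within[where d = 1])
        (use v in \<open>auto simp: vol.is_solution_def\<close>)
    moreover have "at 0 within {0..1} = at (0::real) within {0..}"
      by (rule at_within_nhd[of 0 "{..<1}"]) auto
    ultimately have "(v has_real_derivative 0) (at 0 within {0..})" by simp
    moreover have "((\<lambda>z. z powr (1 / m)) has_real_derivative 1 / m * v 0 powr (1 / m - 1) * 1) (at (v 0))"
      using range[of 0] by (intro DERIV_powr_const DERIV_ident) auto
    ultimately show ?thesis
      unfolding f_def[abs_def] using DERIV_chain2 by fastforce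
  qed
  moreover have "(\<lambda>\<xi>. f \<xi> powr m) C1_differentiable_on {0<..}"
    unfolding C1_differentiable_on_def
    by (intro exI[of _ "vol.slope v"] conjI continuous_on_subset[OF vol.continuous_on_slope[OF cont]])
      (auto simp: has_real_derivative_iff_has_vector_derivative[symmetric] fm_der)
  moreover have "f differentiable (at \<xi>) \<and> deriv (\<lambda>\<xi>. f \<xi> powr m) differentiable (at \<xi>) \<and>
      deriv (deriv (\<lambda>\<xi>. f \<xi> powr m)) \<xi> + (real N - 1) / \<xi> * deriv (\<lambda>\<xi>. f \<xi> powr m) \<xi>
        - \<alpha> * f \<xi> - \<beta> * \<xi> * deriv f \<xi> + \<xi> powr \<sigma> * f \<xi> powr p = 0" if "\<xi> > 0" for \<xi>
  proof -
    define d where "d = \<alpha> * v \<xi> powr (1 / m) - \<xi> powr \<sigma> * v \<xi> powr (p / m)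
      - (real N - 1) / \<xi> * vol.slope v \<xi> + \<beta> * \<xi> * (1 / m * v \<xi> powr (1 / m - 1) * vol.slope v \<xi>)"
    have "(vol.slope v has_real_derivative d) (at \<xi>)"
      using vol.slope_has_derivative[OF v that] range[of \<xi>] that by (simp add: d_def)
    moreover have ev: "\<forall>\<^sub>F x in nhds \<xi>. deriv (\<lambda>\<xi>. f \<xi> powr m) x = vol.slope v x"
      using ev_pos[OF that] by (rule eventually_mono) (rule d1)
    ultimately have d2: "(deriv (\<lambda>\<xi>. f \<xi> powr m) has_real_derivative d) (at \<xi>)"
      using DERIV_cong_ev[OF refl ev refl] by simp
    have "deriv f \<xi> = 1 / m * v \<xi> powr (1 / m - 1) * vol.slope v \<xi>"
      by (rule DERIV_imp_deriv[OF f_der[OF that]])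
    moreover have "f \<xi> powr p = v \<xi> powr (p / m)"
      by (simp add: f_def powr_powr)
    ultimately show ?thesis
      unfolding DERIV_imp_deriv[OF d2] d1[OF that]
      using f_der[OF that] d2 by (auto simp: real_differentiable_def d_def f_def)
  qed
  moreover have "f 0 > 0" using range[of 0] by (simp add: f_def)
  ultimately have "is_profile N m \<sigma> p f"
    unfolding is_profile_def by (simp add: f_def)
  then show ?thesis by (simp add: f_def[abs_def])
qed

text \<open>Here f^(m-1) is \<open>v powr e\<close> with \<open>e = (m - 1) / m\<close>. L'Hopital's
  rule reduces its quadratic coefficient to the limit of \<open>slope v \<xi> / \<xi>\<close> from
  \<open>vol.slope_at_0\<close>, and since e - 1 + 1 / m = 0 the powers of \<open>a\<close> cancel:
  the coefficient is the same for every initial value.\<close>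

lemma behavior_of_solution:
  assumes v: "vol.is_solution a v" and range: "\<And>\<xi>. \<xi> \<ge> 0 \<Longrightarrow> 0 < v \<xi> \<and> v \<xi> < M"
  shows "behavior_at_0 N m \<sigma> p (a powr ((m - 1) / m)) (\<lambda>\<xi>. v \<xi> powr (1 / m))"
proof -
  define e where "e = (m - 1) / m"
  have a: "0 < a" "a < M" using range[of 0] vol.solution_at_0[OF v] by auto
  have v_lim: "(v \<longlongrightarrow> a) (at_right 0)"
  proof -
    have "(v \<longlongrightarrow> v 0) (at 0 within {0..})"
      using vol.solution_continuous[OF v] by (auto simp: continuous_on_def)
    then have "(v \<longlongrightarrow> v 0) (at_right 0)"
      by (rule tendsto_within_subset) auto
    then show ?thesis using vol.solution_at_0[OF v] by simp
  qed
  have pos: "\<forall>\<^sub>F \<xi> in at_right (0::real). \<xi> > 0"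
    by (rule eventually_at_right_less)
  have "((\<lambda>\<xi>. (v \<xi> powr e - a powr e) / \<xi>\<^sup>2) \<longlongrightarrow> e * \<alpha> / (2 * real N)) (at_right 0)"
  proof (rule lhopital_right_0[where f' = "\<lambda>\<xi>. e * v \<xi> powr (e - 1) * vol.slope v \<xi>" and g' = "\<lambda>\<xi>. 2 * \<xi>"])
    have "((\<lambda>\<xi>. v \<xi> powr e - a powr e) \<longlongrightarrow> a powr e - a powr e) (at_right 0)"
      using a by (intro tendsto_intros v_lim) auto
    then show "((\<lambda>\<xi>. v \<xi> powr e - a powr e) \<longlongrightarrow> 0) (at_right 0)" by simp
    have "((\<lambda>\<xi>. \<xi>\<^sup>2) \<longlongrightarrow> 0\<^sup>2) (at_right (0::real))"
      by (intro tendsto_intros)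
    then show "((\<lambda>\<xi>. \<xi>\<^sup>2) \<longlongrightarrow> 0) (at_right (0::real))" by simp
    show "\<forall>\<^sub>F \<xi> in at_right (0::real). \<xi>\<^sup>2 \<noteq> 0" "\<forall>\<^sub>F \<xi> in at_right (0::real). 2 * \<xi> \<noteq> 0"
      using pos by (auto elim!: eventually_mono)
    show "\<forall>\<^sub>F \<xi> in at_right 0. ((\<lambda>\<xi>. v \<xi> powr e - a powr e) has_real_derivative e * v \<xi> powr (e - 1) * vol.slope v \<xi>) (at \<xi>)"
      using pos
    proof eventually_elim
      case (elim \<xi>)
      have "((\<lambda>\<xi>. v \<xi> powr e - a powr e) has_real_derivative e * v \<xi> powr (e - 1) * vol.slope v \<xi> - 0) (at \<xi>)"
        using elim range[of \<xi>] by (intro DERIV_diff DERIV_const DERIV_powr_const vol.solution_derivative[OF v]) auto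
      then show ?case by simp
    qed
    show "\<forall>\<^sub>F \<xi> in at_right (0::real). ((\<lambda>\<xi>. \<xi>\<^sup>2) has_real_derivative 2 * \<xi>) (at \<xi>)"
      by (intro always_eventually allI) (auto intro!: derivative_eq_intros)
    have cl: "vol.clamp a = a" using a by (simp add: vol.clamp_id)
    have "((\<lambda>\<xi>. e / 2 * v \<xi> powr (e - 1) * (vol.slope v \<xi> / \<xi>)) \<longlongrightarrow>
        e / 2 * a powr (e - 1) * ((\<alpha> - real N * \<beta> + real N * \<beta>) / real N * vol.clamp a powr (1 / m))) (at_right 0)"
      using a by (intro tendsto_intros vol.slope_at_0[OF v] v_lim) auto
    moreover have eq: "e / 2 * a powr (e - 1) * ((\<alpha> - real N * \<beta> + real N * \<beta>) / real N * vol.clamp a powr (1 / m)) = e * \<alpha> / (2 * real N)"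
    proof -
      have "e - 1 + 1 / m = 0" using m0 by (simp add: e_def field_simps)
      then have "a powr (e - 1) * a powr (1 / m) = 1"
        using a by (simp add: powr_add[symmetric])
      have "e / 2 * a powr (e - 1) * ((\<alpha> - real N * \<beta> + real N * \<beta>) / real N * vol.clamp a powr (1 / m)) =
          e / 2 * (\<alpha> / real N) * (a powr (e - 1) * a powr (1 / m))"
        unfolding cl by simp
      also have "\<dots> = e * \<alpha> / (2 * real N)"
        unfolding \<open>a powr (e - 1) * a powr (1 / m) = 1\<close> by simp
      finally show ?thesis .
    qed
    ultimately have "((\<lambda>\<xi>. e / 2 * v \<xi> powr (e - 1) * (vol.slope v \<xi> / \<xi>)) \<longlongrightarrow> e * \<alpha> / (2 * real N)) (at_right 0)"
      by (simp only:)
    then show "((\<lambda>\<xi>. e * v \<xi> powr (e - 1) * vol.slope v \<xi> / (2 * \<xi>)) \<longlongrightarrow> e * \<alpha> / (2 * real N)) (at_right 0)"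
      by (simp add: mult_ac)
  qed
  then have "((\<lambda>\<xi>. (v \<xi> powr e - a powr e) / \<xi>\<^sup>2 - e * \<alpha> / (2 * real N)) \<longlongrightarrow>
      e * \<alpha> / (2 * real N) - e * \<alpha> / (2 * real N)) (at_right 0)"
    by (rule tendsto_diff[OF _ tendsto_const])
  then have lim: "((\<lambda>\<xi>. (v \<xi> powr e - a powr e) / \<xi>\<^sup>2 - e * \<alpha> / (2 * real N)) \<longlongrightarrow> 0) (at_right 0)"
    by simp
  have eq: "e * \<alpha> / (2 * real N) = - (\<alpha> * (1 - m) / (2 * m * real N))"
    using m0 N1 by (simp add: e_def field_simps)
  show ?thesis
    unfolding behavior_at_0_def
  proof (rule smalloI_tendsto)
    show "((\<lambda>\<xi>. ((v \<xi> powr (1 / m)) powr (m - 1) - (a powr ((m - 1) / m) - \<alpha> * (1 - m) / (2 * m * real N) * \<xi>\<^sup>2)) / \<xi>\<^sup>2) \<longlongrightarrow> 0) (at_right 0)"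
    proof (rule Lim_transform_eventually[OF lim])
      show "\<forall>\<^sub>F \<xi> in at_right 0. (v \<xi> powr e - a powr e) / \<xi>\<^sup>2 - e * \<alpha> / (2 * real N) =
          ((v \<xi> powr (1 / m)) powr (m - 1) - (a powr ((m - 1) / m) - \<alpha> * (1 - m) / (2 * m * real N) * \<xi>\<^sup>2)) / \<xi>\<^sup>2"
        using pos
      proof eventually_elim
        case (elim \<xi>)
        then show ?case
          unfolding eq by (simp add: e_def powr_powr diff_divide_distrib)
      qed
    qed
    show "\<forall>\<^sub>F \<xi> in at_right (0::real). \<xi>\<^sup>2 \<noteq> 0"
      using pos by (auto elim!: eventually_mono)
  qed
qed

end

section \<open>Shooting\<close>

text \<open>\<open>H\<close> is the level of no return, \<open>s\<^sub>1\<close> the time after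
  which the drift cannot beat the damping inside the well, and \<open>\<xi>\<^sub>0\<close> the
  length of the initial interval of increase. The last assumption is the smallness condition of
  \<open>initial_increase\<close> for the clamp level used here, since \<sigma> - \<nu> (p - 1) / m
  = 1 / \<beta>.\<close>

locale shooting = profile_eq +
  fixes H s\<^sub>1 \<xi>\<^sub>0 :: real
  assumes damped: "\<mu> - \<nu> > 0"
    and H_gt: "H > zero_level" and H_pos: "H > 0"
    and H_overshoot: "\<And>V U a. solves {a..} V U \<Longrightarrow> V a = H \<Longrightarrow> U a \<noteq> 0"
    and s1_damp: "\<And>s. s \<ge> s\<^sub>1 \<Longrightarrow> h s * zero_level powr (1 / m - 1) \<le> \<mu> - \<nu>"
    and \<xi>0_pos: "\<xi>\<^sub>0 > 0" and \<xi>0_le: "\<xi>\<^sub>0 \<le> exp s\<^sub>1"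
    and \<xi>0_small: "\<xi>\<^sub>0 powr (1 / \<beta>) * (2 * H) powr ((p - 1) / m) \<le> \<alpha> / 2"
begin

lemma K_pos: "\<nu> * \<mu> > 0"
  using damped \<nu>_pos by simp

text \<open>While \<open>V\<close> \<le> \<open>H\<close>, the function
  \<open>v = \<xi> powr (- \<nu>) * V\<close> is at most half this level from
  \<open>\<xi>\<^sub>0\<close> on, and before \<open>\<xi>\<^sub>0\<close> it increases. The factor
  2 keeps it strictly below the clamp.\<close>

sublocale truncated_profile_eq N m \<sigma> p "2 * H * \<xi>\<^sub>0 powr (- \<nu>)"
  using H_pos \<xi>0_pos by unfold_locales simp

abbreviation M :: real where "M \<equiv> 2 * H * \<xi>\<^sub>0 powr (- \<nu>)"

definition sol :: "real \<Rightarrow> real \<Rightarrow> real" where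
  "sol a = (SOME v. vol.is_solution a v)"

abbreviation V :: "real \<Rightarrow> real \<Rightarrow> real" where "V a \<equiv> V_of (sol a)"
abbreviation U :: "real \<Rightarrow> real \<Rightarrow> real" where "U a \<equiv> U_of (sol a) (vol.slope (sol a))"

section \<open>Solutions that do not feel the truncation\<close>

lemma sol: "vol.is_solution a (sol a)"
  unfolding sol_def by (rule someI_ex[OF vol.solution_exists])

lemma sol_0: "sol a 0 = a"
  by (rule vol.solution_at_0[OF sol])

lemma sol_cont: "continuous_on {0..} (sol a)"
  by (rule vol.solution_continuous[OF sol])

lemma V_pos_iff: "0 < V a s \<longleftrightarrow> 0 < sol a (exp s)"
  by (simp add: V_of_def zero_less_mult_iff)

lemma V_derivative: "(V a has_real_derivative U a s) (at s)"
  by (rule V_of_derivative[of "sol a" "vol.slope (sol a)" s, OF vol.solution_derivative[OF sol]]) simp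

lemma V_cont: "continuous_on S (V a)"
  using V_derivative by (intro continuous_at_imp_continuous_on) (auto intro: DERIV_isCont)

lemma U_cont: "continuous_on S (U a)"
  unfolding U_of_def[abs_def]
  by (intro continuous_intros continuous_on_compose2[OF vol.continuous_on_slope[OF sol_cont]]
      continuous_on_compose2[OF sol_cont]) auto

lemma solves_at: "0 < sol a (exp s) \<Longrightarrow> sol a (exp s) < M \<Longrightarrow> solves {s} (V a) (U a)"
  by (rule solves_solution[OF sol])

lemma solvesI: "(\<And>s. s \<in> I \<Longrightarrow> 0 < sol a (exp s) \<and> sol a (exp s) < M) \<Longrightarrow> solves I (V a) (U a)"
  using solves_at by (simp add: solves_def)

lemma sol_eq: "sol a (exp s) = V a s * exp (- \<nu> * s)"
  by (simp add: V_of_def exp_minus)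

lemma slope_pos:
  assumes "a > 0" "0 < x" "x \<le> \<xi>\<^sub>0"
  shows "vol.slope (sol a) x > 0"
proof (rule vol.initial_increase[OF sol \<open>a > 0\<close> _ _ _ assms(2,3)])
  show "\<alpha> - real N * \<beta> + real N * \<beta> > 0" using \<alpha>_pos by simp
  show "1 / m \<le> p / m" using p1 m0 by (simp add: divide_right_mono)
  have "\<nu> * ((p - 1) / m) = \<theta> * (p - 1)"
    using m0 by (simp add: \<nu>_def)
  moreover have "\<sigma> - \<theta> * (p - 1) = 1 / \<beta>"
    using \<theta>_balance \<beta>_balance by (simp add: algebra_simps)
  ultimately have "\<xi>\<^sub>0 powr \<sigma> * \<xi>\<^sub>0 powr (- \<nu> * ((p - 1) / m)) = \<xi>\<^sub>0 powr (1 / \<beta>)"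
    by (simp add: powr_add[symmetric])
  moreover have "M powr ((p - 1) / m) = (2 * H) powr ((p - 1) / m) * \<xi>\<^sub>0 powr (- \<nu> * ((p - 1) / m))"
    using H_pos \<xi>0_pos by (simp add: powr_mult powr_powr)
  ultimately have "\<xi>\<^sub>0 powr \<sigma> * M powr ((p - 1) / m) = \<xi>\<^sub>0 powr (1 / \<beta>) * (2 * H) powr ((p - 1) / m)"
    by (simp add: mult_ac)
  then show "\<xi>\<^sub>0 powr \<sigma> * M powr (p / m - 1 / m) \<le> (\<alpha> - real N * \<beta> + real N * \<beta>) / 2"
    using \<xi>0_small by (simp add: diff_divide_distrib)
qed

lemma sol_mono:
  assumes "a > 0" "0 \<le> x" "x \<le> y" "y \<le> \<xi>\<^sub>0"
  shows "sol a x \<le> sol a y"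
proof (rule DERIV_nonneg_imp_increasing_open[OF assms(3)])
  fix t assume "x < t" "t < y"
  then show "\<exists>d. (sol a has_real_derivative d) (at t) \<and> 0 \<le> d"
    using vol.solution_derivative[OF sol, of t] slope_pos[of a t] assms
    by (intro exI[of _ "vol.slope (sol a) t"]) auto
qed (use assms in \<open>auto intro: continuous_on_subset[OF sol_cont]\<close>)

lemma sol_le_of_V_le:
  assumes "ln \<xi>\<^sub>0 \<le> s" "V a s \<le> H"
  shows "sol a (exp s) \<le> M / 2"
proof -
  have "exp (- \<nu> * s) \<le> exp (- \<nu> * ln \<xi>\<^sub>0)"
    using assms(1) \<nu>_pos by (simp add: mult_left_mono)
  then have "exp (- \<nu> * s) \<le> \<xi>\<^sub>0 powr (- \<nu>)"
    using \<xi>0_pos by (simp add: powr_def)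
  then have "V a s * exp (- \<nu> * s) \<le> H * \<xi>\<^sub>0 powr (- \<nu>)"
    using assms(2) H_pos by (intro mult_mono) auto
  then show ?thesis unfolding sol_eq by simp
qed

lemma sol_le_M:
  assumes "a > 0" "ln \<xi>\<^sub>0 \<le> s" and le: "\<And>t. t \<le> s \<Longrightarrow> V a t \<le> H" and x: "0 \<le> x" "x \<le> exp s"
  shows "sol a x \<le> M / 2"
proof (cases "x \<le> \<xi>\<^sub>0")
  case True
  have "sol a x \<le> sol a \<xi>\<^sub>0"
    using True x assms by (intro sol_mono) auto
  also have "\<dots> \<le> M / 2"
    using sol_le_of_V_le[of "ln \<xi>\<^sub>0" a] le[OF assms(2)] \<xi>0_pos by simp
  finally show ?thesis .
next
  case False
  then have "x > 0" "ln \<xi>\<^sub>0 \<le> ln x" "ln x \<le> s"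
    using \<xi>0_pos x ln_le_cancel_iff[of x "exp s"] by auto
  then show ?thesis using sol_le_of_V_le[of "ln x" a] le[of "ln x"] by simp
qed

lemma half_M: "M / 2 < M"
  using M_pos by simp

lemma ln_\<xi>0_le: "ln \<xi>\<^sub>0 \<le> s\<^sub>1"
  using \<xi>0_le \<xi>0_pos ln_le_cancel_iff[of \<xi>\<^sub>0 "exp s\<^sub>1"] by simp

text \<open>Negative energy is demanded at a time \<open>s \<ge> s\<^sub>1\<close>, because only
  from then on is it certain to persist; before, the drift might raise the energy again.\<close>

definition subthreshold :: "real set" where
  "subthreshold = {a. a > 0 \<and> (\<exists>s\<ge>s\<^sub>1. (\<forall>t\<le>s. 0 < V a t \<and> V a t < H) \<and> energy (V a) (U a) s < 0)}"

lemma trapped: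
  assumes "s \<ge> s\<^sub>1" "0 < V a s" "energy (V a) (U a) s < 0" "s \<le> t"
  shows "0 < V a t \<and> energy (V a) (U a) t < 0"
proof (rule trapping[OF K_pos V_cont U_cont assms(2,3) _ _ assms(4)])
  fix t assume t: "s \<le> t" "0 < V a t" "V a t < zero_level"
  have "sol a (exp t) \<le> M / 2"
    using t assms(1) ln_\<xi>0_le H_gt by (intro sol_le_of_V_le) auto
  then show "solves {t} (V a) (U a)"
    using t half_M by (intro solves_at) (auto simp: V_pos_iff)
  have "h t * V a t powr (1 / m - 1) \<le> h t * zero_level powr (1 / m - 1)"
    using t h_pos[of t] m0 m1 by (intro mult_left_mono powr_mono2) auto
  also have "\<dots> \<le> \<mu> - \<nu>" using s1_damp[of t] t assms(1) by simp
  finally show "h t * V a t powr (1 / m - 1) \<le> \<mu> - \<nu>" .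
qed

lemma below_zero_level:
  assumes "0 < V a t" "energy (V a) (U a) t < 0"
  shows "V a t < zero_level"
proof -
  have "potential (V a t) < 0"
    using assms(2) zero_le_power2[of "U a t"] unfolding energy_def by linarith
  then show ?thesis using potential_neg_imp(2)[OF K_pos] assms(1) by simp
qed

lemma subthreshold_global:
  assumes "a \<in> subthreshold"
  shows "0 < V a t \<and> V a t < H" "\<exists>s. \<forall>t\<ge>s. energy (V a) (U a) t < 0"
proof -
  obtain s where s: "s \<ge> s\<^sub>1" "\<And>t. t \<le> s \<Longrightarrow> 0 < V a t \<and> V a t < H" "energy (V a) (U a) s < 0"
    using assms by (auto simp: subthreshold_def)
  have tr: "0 < V a t \<and> energy (V a) (U a) t < 0" if "t \<ge> s" for t
    using s that by (intro trapped[of s]) auto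
  then show "\<exists>s. \<forall>t\<ge>s. energy (V a) (U a) t < 0" by blast
  show "0 < V a t \<and> V a t < H"
  proof (cases "t \<le> s")
    case False
    then have "0 < V a t" "energy (V a) (U a) t < 0" using tr[of t] by auto
    then show ?thesis using below_zero_level H_gt by fastforce
  qed (use s(2) in blast)
qed

lemma sol_less_M:
  assumes "a > 0" and V: "\<And>t. V a t \<le> H" and "x \<ge> 0"
  shows "sol a x < M"
proof -
  define s where "s = max (ln (x + 1)) (ln \<xi>\<^sub>0)"
  have "x + 1 \<le> exp s"
    using \<open>x \<ge> 0\<close> exp_le_cancel_iff[of "ln (x + 1)" s] by (simp add: s_def)
  then have "sol a x \<le> M / 2"
    using V \<open>x \<ge> 0\<close> by (intro sol_le_M[OF \<open>a > 0\<close>, of s]) (auto simp: s_def)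
  then show ?thesis using half_M by simp
qed

lemma sol_pos:
  assumes "a > 0" and V: "\<And>t. 0 < V a t" and "x \<ge> 0"
  shows "0 < sol a x"
  using V[of "ln x"] assms sol_0[of a] by (cases "x = 0") (auto simp: V_pos_iff)

section \<open>Continuous dependence and openness\<close>

lemma solution_diff: "x \<ge> 0 \<Longrightarrow> \<bar>sol b x - sol a x\<bar> \<le> 2 * \<bar>b - a\<bar> * vol.weight x"
  by (rule vol.solution_dependence[OF sol sol])

lemma tendsto_sol:
  assumes "x \<ge> 0"
  shows "((\<lambda>b. sol b x) \<longlongrightarrow> sol a x) (nhds a)"
proof (rule tendsto_parameter)
  fix b
  show "\<bar>sol b x - sol a x\<bar> \<le> 2 * vol.weight x * \<bar>b - a\<bar>"
    using solution_diff[OF assms, of b a] by (simp add: mult.commute mult.left_commute)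
qed

lemma tendsto_slope:
  assumes "x \<ge> 0"
  shows "((\<lambda>b. vol.slope (sol b) x) \<longlongrightarrow> vol.slope (sol a) x) (nhds a)"
proof (rule tendsto_parameter)
  fix b
  show "\<bar>vol.slope (sol b) x - vol.slope (sol a) x\<bar> \<le> vol.growth x * (2 * vol.weight x) * \<bar>b - a\<bar>"
    using vol.slope_dependence[OF sol sol assms, of b a] by (simp add: mult_ac)
qed

lemma tendsto_V: "((\<lambda>b. V b s) \<longlongrightarrow> V a s) (nhds a)"
  unfolding V_of_def by (intro tendsto_intros tendsto_sol) simp

lemma tendsto_U: "((\<lambda>b. U b s) \<longlongrightarrow> U a s) (nhds a)"
  unfolding U_of_def by (intro tendsto_intros tendsto_sol tendsto_slope) simp_all

lemma tendsto_energy: "((\<lambda>b. energy (V b) (U b) s) \<longlongrightarrow> energy (V a) (U a) s) (nhds a)"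
  unfolding energy_def by (intro tendsto_intros tendsto_U tendsto_potential tendsto_V) simp

text \<open>The condition on all \<open>t \<le> s\<close> concerns an unbounded interval. In the
  variable \<open>x = exp t\<close> it becomes \<open>0 < sol a x\<close> and
  \<open>x powr \<nu> * sol a x < H\<close> on the compact interval [0, X], with strict inequalities
  also at \<open>x = 0\<close>. Extrema then leave a margin, and solutions with nearby initial
  values are uniformly close there.\<close>

lemma open_subthreshold: "open subthreshold"
proof (subst open_subopen, intro ballI)
  fix a assume "a \<in> subthreshold"
  then obtain s where a: "a > 0" and s: "s \<ge> s\<^sub>1" "\<And>t. t \<le> s \<Longrightarrow> 0 < V a t \<and> V a t < H" "energy (V a) (U a) s < 0"
    by (auto simp: subthreshold_def)
  define X where "X = exp s"
  have "X > 0" by (simp add: X_def)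
  have V_ln: "V b (ln x) = x powr \<nu> * sol b x" if "x > 0" for b x
    using that by (simp add: V_of_def powr_def)
  have ln_s: "ln x \<le> s" if "0 < x" "x \<le> X" for x
    using that ln_le_cancel_iff[of x X] by (simp add: X_def)
  have "continuous_on {0..X} (sol a)"
    by (rule continuous_on_subset[OF sol_cont]) auto
  then obtain x1 where x1: "x1 \<in> {0..X}" "\<And>x. x \<in> {0..X} \<Longrightarrow> sol a x1 \<le> sol a x"
    using continuous_attains_inf[of "{0..X}" "sol a"] \<open>X > 0\<close> by auto
  have "sol a x1 > 0"
  proof (cases "x1 = 0")
    case False
    then show ?thesis using s(2)[of "ln x1"] x1(1) ln_s[of x1] by (simp add: V_pos_iff)
  qed (use a sol_0 in simp)
  have "continuous_on {0..X} (\<lambda>x. x powr \<nu> * sol a x)"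
    using \<nu>_pos by (intro continuous_intros continuous_on_powr' continuous_on_subset[OF sol_cont]) auto
  then obtain x2 where x2: "x2 \<in> {0..X}" "\<And>x. x \<in> {0..X} \<Longrightarrow> x powr \<nu> * sol a x \<le> x2 powr \<nu> * sol a x2"
    using continuous_attains_sup[of "{0..X}" "\<lambda>x. x powr \<nu> * sol a x"] \<open>X > 0\<close> by auto
  have top: "x2 powr \<nu> * sol a x2 < H"
  proof (cases "x2 = 0")
    case False
    then show ?thesis using s(2)[of "ln x2"] x2(1) ln_s[of x2] V_ln[of x2 a] by simp
  qed (use H_pos in simp)
  define W where "W = 2 * vol.weight X"
  have diff: "\<bar>sol b x - sol a x\<bar> \<le> W * \<bar>b - a\<bar>" if "0 \<le> x" "x \<le> X" for b x
  proof -
    have "2 * \<bar>b - a\<bar> * vol.weight x \<le> 2 * \<bar>b - a\<bar> * vol.weight X"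
      using vol.weight_mono[OF that] by (intro mult_left_mono) auto
    then show ?thesis using solution_diff[OF that(1), of b a] by (simp add: W_def mult_ac)
  qed
  have "((\<lambda>b. W * \<bar>b - a\<bar>) \<longlongrightarrow> W * \<bar>a - a\<bar>) (nhds a)"
    by (intro tendsto_intros filterlim_ident)
  then have e1: "\<forall>\<^sub>F b in nhds a. W * \<bar>b - a\<bar> < sol a x1"
    using \<open>sol a x1 > 0\<close> by (intro order_tendstoD(2)) auto
  have "((\<lambda>b. x2 powr \<nu> * sol a x2 + X powr \<nu> * (W * \<bar>b - a\<bar>)) \<longlongrightarrow>
      x2 powr \<nu> * sol a x2 + X powr \<nu> * (W * \<bar>a - a\<bar>)) (nhds a)"
    by (intro tendsto_intros filterlim_ident)
  then have e2: "\<forall>\<^sub>F b in nhds a. x2 powr \<nu> * sol a x2 + X powr \<nu> * (W * \<bar>b - a\<bar>) < H"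
    using top by (intro order_tendstoD(2)) auto
  have e3: "\<forall>\<^sub>F b in nhds a. energy (V b) (U b) s < 0"
    using order_tendstoD(2)[OF tendsto_energy s(3)] .
  have e4: "\<forall>\<^sub>F b in nhds a. b > 0"
    using eventually_nhds_in_open[of "{0<..}" a] a by simp
  have "\<forall>\<^sub>F b in nhds a. b \<in> subthreshold"
    using e1 e2 e3 e4
  proof eventually_elim
    case (elim b)
    have "0 < V b t \<and> V b t < H" if "t \<le> s" for t
    proof -
      define x where "x = exp t"
      have x: "0 < x" "x \<le> X" using that by (simp_all add: x_def X_def)
      have d: "\<bar>sol b x - sol a x\<bar> \<le> W * \<bar>b - a\<bar>" using x by (intro diff) auto
      then have "0 < sol b x" using x1(2)[of x] x elim(1) by simp
      moreover have "V b t < H"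
      proof -
        have "V b t = x powr \<nu> * sol a x + x powr \<nu> * (sol b x - sol a x)"
          using V_ln[OF x(1), of b] by (simp add: x_def algebra_simps)
        also have "\<dots> \<le> x2 powr \<nu> * sol a x2 + X powr \<nu> * (W * \<bar>b - a\<bar>)"
        proof (rule add_mono)
          have "x powr \<nu> * (sol b x - sol a x) \<le> x powr \<nu> * (W * \<bar>b - a\<bar>)"
            using d by (intro mult_left_mono) auto
          also have "\<dots> \<le> X powr \<nu> * (W * \<bar>b - a\<bar>)"
            using x \<nu>_pos order.trans[OF abs_ge_zero d] by (intro mult_right_mono powr_mono2) auto
          finally show "x powr \<nu> * (sol b x - sol a x) \<le> X powr \<nu> * (W * \<bar>b - a\<bar>)" .
        qed (use x2(2)[of x] x in auto)
        finally show ?thesis using elim(2) by simp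
      qed
      ultimately show ?thesis by (simp add: V_pos_iff x_def)
    qed
    then show ?case using elim(3,4) s(1) by (auto simp: subthreshold_def)
  qed
  then show "\<exists>T. open T \<and> a \<in> T \<and> T \<subseteq> subthreshold"
    unfolding eventually_nhds by blast
qed

section \<open>Small initial values\<close>

lemma exp_at_0: "filterlim (exp :: real \<Rightarrow> real) (at 0 within {0..}) at_bot"
  using exp_at_bot by (auto simp: filterlim_at)

lemma energy_at_bot: "((\<lambda>t. energy (V a) (U a) t) \<longlongrightarrow> 0) at_bot"
proof -
  have 1: "((\<lambda>t. sol a (exp t)) \<longlongrightarrow> sol a 0) at_bot"
    using sol_cont[of a] by (intro filterlim_compose[OF _ exp_at_0]) (auto simp: continuous_on_def)
  have 2: "((\<lambda>t. vol.slope (sol a) (exp t)) \<longlongrightarrow> vol.slope (sol a) 0) at_bot"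
    using vol.continuous_on_slope[OF sol_cont[of a]]
    by (intro filterlim_compose[OF _ exp_at_0]) (auto simp: continuous_on_def simp del: vol.slope_0)
  have 3: "((\<lambda>t. exp (\<nu> * t)) \<longlongrightarrow> 0) at_bot"
    using \<nu>_pos by (intro filterlim_compose[OF exp_at_bot] filterlim_tendsto_pos_mult_at_bot[OF tendsto_const]
        filterlim_ident)
  have "((\<lambda>t. V a t) \<longlongrightarrow> 0 * sol a 0) at_bot"
    unfolding V_of_def by (intro tendsto_intros 1 3)
  moreover have "((\<lambda>t. U a t) \<longlongrightarrow> 0 * (\<nu> * sol a 0 + 0 * vol.slope (sol a) 0)) at_bot"
    unfolding U_of_def by (intro tendsto_intros 1 2 3 exp_at_bot)
  ultimately have "((\<lambda>t. energy (V a) (U a) t) \<longlongrightarrow> 0\<^sup>2 / 2 + potential 0) at_bot"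
    unfolding energy_def by (intro tendsto_intros tendsto_potential) auto
  then show ?thesis by simp
qed

text \<open>For small initial values the drift is too weak to overcome the damping before \<open>s\<^sub>1\<close>.\<close>

lemma subthreshold_nonempty: "\<exists>a. a \<in> subthreshold"
proof -
  \<comment> \<open>Comparison with the zero solution bounds \<open>sol a\<close> by
    \<open>2 * a * W\<close> up to \<open>exp s\<^sub>1\<close>; a small \<open>a\<close> thus
    deactivates the clamp and keeps the drift below the damping there.\<close>
  define W where "W = vol.weight (exp s\<^sub>1)"
  have l1: "((\<lambda>a. 2 * a * W) \<longlongrightarrow> 2 * 0 * W) (at_right 0)"
    by (intro tendsto_intros)
  then have e1: "\<forall>\<^sub>F a in at_right 0. 2 * a * W < M"
    using M_pos by (intro order_tendstoD(2)) auto
  have "((\<lambda>a. (2 * a * W) powr (1 / m - 1)) \<longlongrightarrow> 0) (at_right 0)"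
  proof (rule tendsto_zero_powrI[OF _ tendsto_const])
    show "\<forall>\<^sub>F a in at_right 0. 0 \<le> 2 * a * W"
      by (rule eventually_mono[OF eventually_at_right_less]) (simp add: W_def vol.weight_def)
  qed (use l1 m0 m1 in auto)
  then have "((\<lambda>a. \<beta> / m * exp (2 * s\<^sub>1) * (2 * a * W) powr (1 / m - 1)) \<longlongrightarrow> 0) (at_right 0)"
    by (rule tendsto_mult_right_zero)
  then have e2: "\<forall>\<^sub>F a in at_right 0. \<beta> / m * exp (2 * s\<^sub>1) * (2 * a * W) powr (1 / m - 1) < \<mu> - \<nu>"
    using damped by (rule order_tendstoD(2))
  have "\<forall>\<^sub>F a in at_right 0. 2 * a * W < M \<and> \<beta> / m * exp (2 * s\<^sub>1) * (2 * a * W) powr (1 / m - 1) < \<mu> - \<nu> \<and> 0 < a"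
    using e1 e2 eventually_at_right_less[of "0::real"] by eventually_elim simp
  then obtain a where a: "2 * a * W < M" "\<beta> / m * exp (2 * s\<^sub>1) * (2 * a * W) powr (1 / m - 1) < \<mu> - \<nu>" "0 < a"
    using eventually_happens[of _ "at_right (0::real)"] by (auto simp: trivial_limit_at_right_real)
  have sol_le: "sol a x \<le> 2 * a * W" if "0 \<le> x" "x \<le> exp s\<^sub>1" for x
  proof -
    have "\<bar>sol a x - 0\<bar> \<le> 2 * \<bar>a - 0\<bar> * vol.weight x"
      by (rule vol.solution_dependence[OF sol vol.zero_solution that(1)])
    also have "\<dots> \<le> 2 * \<bar>a - 0\<bar> * W"
      unfolding W_def using vol.weight_mono[OF that] by (intro mult_left_mono) auto
    finally show ?thesis using a(3) by simp
  qed
  have early: "solves {t} (V a) (U a) \<and> h t * V a t powr (1 / m - 1) < \<mu> - \<nu>"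
    if "t \<le> s\<^sub>1" "0 < V a t" for t
  proof -
    have pos: "0 < sol a (exp t)" using that by (simp add: V_pos_iff)
    have le: "sol a (exp t) \<le> 2 * a * W" using that by (intro sol_le) auto
    have "h t * V a t powr (1 / m - 1) = \<beta> / m * exp (2 * t) * sol a (exp t) powr (1 / m - 1)"
      by (rule damping_V_of[of "sol a" t, OF pos])
    also have "\<dots> \<le> \<beta> / m * exp (2 * s\<^sub>1) * (2 * a * W) powr (1 / m - 1)"
      using that(1) pos le \<beta>_pos m0 m1 by (intro mult_mono powr_mono2) auto
    finally show ?thesis
      using a(1,2) pos le by (intro conjI solves_at) auto
  qed
  \<comment> \<open>Until this time the solution increases, so \<open>U > 0\<close> and the energy
    decreases strictly from its limit 0 at minus infinity.\<close>
  define t0 where "t0 = ln \<xi>\<^sub>0"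
  have "t0 \<le> s\<^sub>1" using ln_\<xi>0_le by (simp add: t0_def)
  have exp_t0: "exp t \<le> \<xi>\<^sub>0" if "t \<le> t0" for t
    using that \<xi>0_pos exp_le_cancel_iff[of t t0] by (simp add: t0_def)
  have V_pos: "0 < V a t" and U_pos: "0 < U a t" if "t \<le> t0" for t
  proof -
    have "a \<le> sol a (exp t)"
      using sol_mono[of a 0 "exp t"] exp_t0[OF that] a(3) sol_0[of a] by simp
    then have "0 < sol a (exp t)" using a(3) by simp
    moreover have "0 < vol.slope (sol a) (exp t)"
      using exp_t0[OF that] a(3) by (intro slope_pos) auto
    ultimately show "0 < V a t" "0 < U a t"
      using \<nu>_pos by (simp_all add: V_pos_iff U_of_def add_pos_pos)
  qed
  let ?E = "energy (V a) (U a)" and ?E' = "\<lambda>t. (U a t)\<^sup>2 * (h t * V a t powr (1 / m - 1) - (\<mu> - \<nu>))"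
  have E_der: "(?E has_real_derivative ?E' t) (at t)" and E_neg: "?E' t < 0" if "t \<le> t0" for t
  proof -
    have e: "solves {t} (V a) (U a)" "h t * V a t powr (1 / m - 1) < \<mu> - \<nu>"
      using early[of t] that \<open>t0 \<le> s\<^sub>1\<close> V_pos[OF that] by auto
    show "(?E has_real_derivative ?E' t) (at t)"
      by (rule energy_derivative[OF e(1)]) simp
    show "?E' t < 0"
      using e(2) U_pos[OF that] by (intro mult_pos_neg) auto
  qed
  have "?E t0 < 0"
  proof -
    have "?E t0 < ?E (t0 - 1)"
      by (rule DERIV_neg_imp_decreasing) (use E_der E_neg in auto)
    moreover have "?E (t0 - 1) \<le> 0"
    proof (rule tendsto_lowerbound[OF energy_at_bot])
      show "\<forall>\<^sub>F t in at_bot. ?E (t0 - 1) \<le> ?E t"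
      proof (rule eventually_mono[OF eventually_le_at_bot[of "t0 - 1"]])
        fix t assume "t \<le> t0 - 1"
        then show "?E (t0 - 1) \<le> ?E t"
          by (rule deriv_nonpos_antimono[where f' = ?E']) (use E_der E_neg in \<open>auto intro: less_imp_le\<close>)
      qed
    qed simp
    ultimately show ?thesis by simp
  qed
  \<comment> \<open>Inside the well dissipation holds at all later times: up to
    \<open>s\<^sub>1\<close> by the smallness of \<open>a\<close>, afterwards by
    \<open>s1_damp\<close>.\<close>
  have late: "0 < V a t \<and> ?E t < 0" if "t0 \<le> t" for t
  proof (rule trapping[OF K_pos V_cont U_cont V_pos[OF order_refl] \<open>?E t0 < 0\<close> _ _ that])
    fix t assume t: "t0 \<le> t" "0 < V a t" "V a t < zero_level"
    show "solves {t} (V a) (U a)"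
    proof (cases "t \<le> s\<^sub>1")
      case False
      have "sol a (exp t) \<le> M / 2"
        using t H_gt by (intro sol_le_of_V_le) (auto simp: t0_def)
      then show ?thesis using t half_M by (intro solves_at) (auto simp: V_pos_iff)
    qed (use early t in blast)
    show "h t * V a t powr (1 / m - 1) \<le> \<mu> - \<nu>"
    proof (cases "t \<le> s\<^sub>1")
      case False
      have "h t * V a t powr (1 / m - 1) \<le> h t * zero_level powr (1 / m - 1)"
        using t h_pos[of t] m0 m1 by (intro mult_left_mono powr_mono2) auto
      then show ?thesis using s1_damp[of t] False by simp
    qed (use early t in \<open>auto intro: less_imp_le\<close>)
  qed
  have below: "V a t < H" if "t0 \<le> t" for t
    using below_zero_level[of a t] late[OF that] H_gt by simp
  have "0 < V a t \<and> V a t < H" for t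
  proof (cases "t \<le> t0")
    case True
    have "V a t \<le> V a t0"
      by (rule deriv_nonneg_mono[OF True V_derivative]) (use U_pos in \<open>auto intro: less_imp_le\<close>)
    then show ?thesis using V_pos[OF True] below[of t0] by simp
  qed (use late below in auto)
  moreover have "?E s\<^sub>1 < 0" using late[OF \<open>t0 \<le> s\<^sub>1\<close>] by simp
  ultimately show ?thesis
    using a(3) by (intro exI[of _ a]) (auto simp: subthreshold_def)
qed

section \<open>The threshold value\<close>

lemma subthreshold_less_M:
  assumes "a \<in> subthreshold"
  shows "a < M"
proof -
  have "sol a 0 < M"
  proof (rule sol_less_M)
    show "a > 0" using assms by (simp add: subthreshold_def)
    show "V a t \<le> H" for t using subthreshold_global(1)[OF assms, of t] by simp
  qed simp
  then show ?thesis by (simp add: sol_0)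
qed

text \<open>The half-line of positive initial values is connected and \<open>M\<close> lies outside
  \<open>subthreshold\<close>, so there is a positive boundary value, for which 0 \<le>
  \<open>V\<close> \<le> \<open>H\<close> by closure. Touching 0 would be a minimum, hence a double
  zero; touching \<open>H\<close> would be a maximum with \<open>U = 0\<close>, excluded by
  overshoot. Negative energy after \<open>s\<^sub>1\<close> would put the value into the open
  set.\<close>

lemma threshold_exists:
  obtains a where "a > 0" "\<And>t. 0 < V a t \<and> V a t < H" "\<And>s. s \<ge> s\<^sub>1 \<Longrightarrow> 0 \<le> energy (V a) (U a) s"
proof -
  have "{0<..} \<inter> subthreshold \<noteq> {}"
    using subthreshold_nonempty by (auto simp: subthreshold_def)
  moreover have "M \<in> {0<..} - subthreshold"
    using subthreshold_less_M[of M] M_pos by auto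
  then have "{0<..} - subthreshold \<noteq> {}" by blast
  ultimately obtain a where a: "a > 0" "a \<in> frontier subthreshold"
    using connected_Int_frontier[of "{0::real<..}" subthreshold] by auto
  then have cl: "a \<in> closure subthreshold" and "a \<notin> subthreshold"
    using open_subthreshold by (auto simp: frontier_def interior_open)
  have cont: "continuous_on (closure subthreshold) (\<lambda>b. V b t)" for t
    unfolding continuous_on_def by (intro ballI tendsto_mono[OF at_within_le_nhds tendsto_V])
  have V_ge: "0 \<le> V a t" for t
    by (rule continuous_ge_on_closure[OF cont cl]) (use subthreshold_global(1) in \<open>auto intro: less_imp_le\<close>)
  have V_le: "V a t \<le> H" for t
    by (rule continuous_le_on_closure[OF cont cl]) (use subthreshold_global(1) in \<open>auto intro: less_imp_le\<close>)
  have less_M: "sol a x < M" if "x \<ge> 0" for x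
    by (rule sol_less_M[OF a(1) V_le that])
  have V_pos: "0 < V a t" for t
  proof (rule ccontr)
    assume "\<not> 0 < V a t"
    then have "sol a (exp t) \<le> 0" by (simp add: V_pos_iff)
    have "continuous_on {0..exp t} (sol a)"
      by (rule continuous_on_subset[OF sol_cont]) auto
    then obtain y where y: "0 \<le> y" "sol a y \<le> 0"
      and y_first: "\<forall>x. 0 \<le> x \<longrightarrow> x < y \<longrightarrow> 0 < sol a x"
      using first_nonpositive[of 0 "exp t" "sol a"] \<open>sol a (exp t) \<le> 0\<close> by auto
    then have "y > 0" using sol_0[of a] a(1) by (cases "y = 0") auto
    define b where "b = ln y"
    have "exp b = y" using \<open>y > 0\<close> by (simp add: b_def)
    have "V a b = 0"
      using V_ge[of b] y(2) V_pos_iff[of a b] \<open>exp b = y\<close> by simp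
    have "U a b = 0"
      using DERIV_local_min[OF V_derivative[of a b], of 1] \<open>V a b = 0\<close> V_ge by simp
    have "0 < sol a (exp s)" if "s < b" for s
      using that \<open>exp b = y\<close> exp_less_mono[of s b] by (intro y_first[rule_format]) auto
    then have "solves {b - 1..<b} (V a) (U a)"
      using less_M by (intro solvesI) auto
    then show False
      using no_double_zero[of "b - 1" b "V a" "U a"] \<open>V a b = 0\<close> \<open>U a b = 0\<close> V_cont U_cont by simp
  qed
  have V_less: "V a t < H" for t
  proof (rule ccontr)
    assume "\<not> V a t < H"
    then have "V a t = H" using V_le[of t] by simp
    then have "U a t = 0"
      using DERIV_local_max[OF V_derivative[of a t], of 1] V_le by simp
    moreover have "solves {t..} (V a) (U a)"
      using V_pos less_M by (intro solvesI) (auto simp: V_pos_iff[symmetric])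
    ultimately show False using H_overshoot[of t "V a" "U a"] \<open>V a t = H\<close> by blast
  qed
  show thesis
  proof (rule that[OF a(1)])
    show "0 < V a t \<and> V a t < H" for t using V_pos V_less by blast
    show "0 \<le> energy (V a) (U a) s" if "s \<ge> s\<^sub>1" for s
    proof (rule ccontr)
      assume "\<not> 0 \<le> energy (V a) (U a) s"
      then have "a \<in> subthreshold"
        using that a(1) V_pos V_less unfolding subthreshold_def by force
      then show False using \<open>a \<notin> subthreshold\<close> by simp
    qed
  qed
qed

section \<open>Decay of the two kinds of profiles\<close>

text \<open>Used with \<open>k = \<mu>\<close> for fast decay, as \<nu> + \<mu> = N - 2, and with
  \<open>k = 0\<close> for slow decay, as \<nu> / m = \<theta>.\<close>

lemma profile_asymptotics:
  assumes pos: "\<And>s. 0 < V a s" and "C > 0" and lim: "((\<lambda>s. V a s * exp (k * s)) \<longlongrightarrow> C) at_top"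
  shows "(\<lambda>\<xi>. sol a \<xi> powr (1 / m)) \<sim>[at_top] (\<lambda>\<xi>. C powr (1 / m) * \<xi> powr (- (\<nu> + k) / m))"
proof (rule asymp_equivI')
  have "((\<lambda>\<xi>. V a (ln \<xi>) * exp (k * ln \<xi>)) \<longlongrightarrow> C) at_top"
    by (rule filterlim_compose[OF lim ln_at_top])
  then have "((\<lambda>\<xi>. (V a (ln \<xi>) * exp (k * ln \<xi>)) powr (1 / m) / C powr (1 / m)) \<longlongrightarrow> C powr (1 / m) / C powr (1 / m)) at_top"
    using \<open>C > 0\<close> by (intro tendsto_intros) auto
  then have "((\<lambda>\<xi>. (V a (ln \<xi>) * exp (k * ln \<xi>)) powr (1 / m) / C powr (1 / m)) \<longlongrightarrow> 1) at_top"
    using \<open>C > 0\<close> by simp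
  then show "((\<lambda>\<xi>. sol a \<xi> powr (1 / m) / (C powr (1 / m) * \<xi> powr (- (\<nu> + k) / m))) \<longlongrightarrow> 1) at_top"
  proof (rule Lim_transform_eventually)
    show "\<forall>\<^sub>F \<xi> in at_top. (V a (ln \<xi>) * exp (k * ln \<xi>)) powr (1 / m) / C powr (1 / m) =
        sol a \<xi> powr (1 / m) / (C powr (1 / m) * \<xi> powr (- (\<nu> + k) / m))"
    proof (rule eventually_mono[OF eventually_gt_at_top[of 0]])
      fix \<xi> :: real assume "\<xi> > 0"
      have "sol a \<xi> = V a (ln \<xi>) * exp (- \<nu> * ln \<xi>)"
        using sol_eq[of a "ln \<xi>"] \<open>\<xi> > 0\<close> by simp
      also have "exp (- \<nu> * ln \<xi>) = exp (k * ln \<xi>) * \<xi> powr (- (\<nu> + k))"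
        using \<open>\<xi> > 0\<close> by (simp add: powr_def exp_add[symmetric] algebra_simps)
      finally have "sol a \<xi> powr (1 / m) = (V a (ln \<xi>) * exp (k * ln \<xi>) * \<xi> powr (- (\<nu> + k))) powr (1 / m)"
        by (simp add: mult.assoc)
      also have "\<dots> = (V a (ln \<xi>) * exp (k * ln \<xi>)) powr (1 / m) * \<xi> powr (- (\<nu> + k) / m)"
        using pos[of "ln \<xi>"] by (simp add: powr_mult powr_powr)
      finally show "(V a (ln \<xi>) * exp (k * ln \<xi>)) powr (1 / m) / C powr (1 / m) =
          sol a \<xi> powr (1 / m) / (C powr (1 / m) * \<xi> powr (- (\<nu> + k) / m))"
        using \<open>\<xi> > 0\<close> by simp
    qed
  qed
qed

lemma global_profile:
  assumes "a > 0" and V: "\<And>t. 0 < V a t \<and> V a t < H"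
  shows "is_profile N m \<sigma> p (\<lambda>\<xi>. sol a \<xi> powr (1 / m))"
    and "behavior_at_0 N m \<sigma> p (a powr ((m - 1) / m)) (\<lambda>\<xi>. sol a \<xi> powr (1 / m))"
    and "solves UNIV (V a) (U a)"
proof -
  have range: "0 < sol a x \<and> sol a x < M" if "x \<ge> 0" for x
    using sol_pos[OF \<open>a > 0\<close> _ that] sol_less_M[OF \<open>a > 0\<close> _ that] V by (meson less_imp_le)
  show "is_profile N m \<sigma> p (\<lambda>\<xi>. sol a \<xi> powr (1 / m))"
    by (rule profile_of_solution[OF sol range])
  show "behavior_at_0 N m \<sigma> p (a powr ((m - 1) / m)) (\<lambda>\<xi>. sol a \<xi> powr (1 / m))"
    by (rule behavior_of_solution[OF sol range])
  show "solves UNIV (V a) (U a)"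
    by (rule solvesI) (simp add: range)
qed

lemma fast_decaying_profile:
  "\<exists>f C D. is_profile N m \<sigma> p f \<and> C > 0 \<and> D > 0 \<and> behavior_at_0 N m \<sigma> p D f \<and>
    f \<sim>[at_top] (\<lambda>\<xi>. C * \<xi> powr (- (real N - 2) / m))"
proof -
  obtain a where a: "a > 0" "\<And>t. 0 < V a t \<and> V a t < H" "\<And>s. s \<ge> s\<^sub>1 \<Longrightarrow> 0 \<le> energy (V a) (U a) s"
    using threshold_exists by blast
  note prof = global_profile[OF a(1,2)]
  have "\<exists>C>0. ((\<lambda>s. V a s * exp (\<mu> * s)) \<longlongrightarrow> C) at_top"
  proof (rule decay_rate[OF \<nu>_pos _ refl refl])
    show "solves {s\<^sub>1..} (V a) (U a)" by (rule solves_subset[OF prof(3)]) simp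
    show "V a s \<le> H" for s using a(2)[of s] by simp
  qed (use damped a(3) in auto)
  then obtain C where C: "C > 0" "((\<lambda>s. V a s * exp (\<mu> * s)) \<longlongrightarrow> C) at_top" by blast
  have "0 < V a s" for s using a(2) by blast
  from profile_asymptotics[OF this C]
  have "(\<lambda>\<xi>. sol a \<xi> powr (1 / m)) \<sim>[at_top] (\<lambda>\<xi>. C powr (1 / m) * \<xi> powr (- (real N - 2) / m))"
    by (simp add: \<mu>_def)
  then show ?thesis
    using prof(1,2) a(1) C(1)
    by (intro exI[of _ "\<lambda>\<xi>. sol a \<xi> powr (1 / m)"] exI[of _ "C powr (1 / m)"] exI[of _ "a powr ((m - 1) / m)"]) simp
qed

lemma slowly_decaying_profile:
  "\<exists>f C D. is_profile N m \<sigma> p f \<and> C > 0 \<and> D > 0 \<and> behavior_at_0 N m \<sigma> p D f \<and>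
    f \<sim>[at_top] (\<lambda>\<xi>. C * \<xi> powr (- (\<sigma> + 2) / (p - m)))"
proof -
  obtain a where a: "a \<in> subthreshold" using subthreshold_nonempty by blast
  then have "a > 0" by (simp add: subthreshold_def)
  note V = subthreshold_global(1)[OF a]
  note prof = global_profile[OF \<open>a > 0\<close> V]
  obtain s where s: "\<forall>t\<ge>s. energy (V a) (U a) t < 0"
    using subthreshold_global(2)[OF a] by blast
  define C where "C = (\<nu> * \<mu>) powr (1 / (p / m - 1))"
  have "(V a \<longlongrightarrow> C) at_top"
    unfolding C_def
  proof (rule converges_to_equilibrium[OF damped K_pos])
    show "solves {s..} (V a) (U a)" by (rule solves_subset[OF prof(3)]) simp
    show "V a t \<le> H" for t using V[of t] by simp
  qed (use s in blast)
  then have lim: "((\<lambda>s. V a s * exp (0 * s)) \<longlongrightarrow> C) at_top" by simp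
  have "C > 0" using \<nu>_pos damped by (simp add: C_def)
  have "0 < V a s" for s using V by blast
  from profile_asymptotics[OF this \<open>C > 0\<close> lim]
  have "(\<lambda>\<xi>. sol a \<xi> powr (1 / m)) \<sim>[at_top] (\<lambda>\<xi>. C powr (1 / m) * \<xi> powr (- (\<nu> / m)))"
    by simp
  also have "- (\<nu> / m) = - (\<sigma> + 2) / (p - m)"
    unfolding \<nu>_div_m \<theta>_def by (rule minus_divide_left)
  finally show ?thesis
    using prof(1,2) \<open>a > 0\<close> \<open>C > 0\<close>
    by (intro exI[of _ "\<lambda>\<xi>. sol a \<xi> powr (1 / m)"] exI[of _ "C powr (1 / m)"] exI[of _ "a powr ((m - 1) / m)"]) simp
qed

end

context profile_eq
begin

text \<open>The order of choice matters: \<open>H\<close> depends on the Emden equation only,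
  \<open>s\<^sub>1\<close> on the decay of the drift, and \<open>\<xi>\<^sub>0\<close> is taken
  last, small in terms of both.\<close>

lemma shooting_parameters:
  assumes damped: "\<mu> - \<nu> > 0"
  shows "\<exists>H s\<^sub>1 \<xi>\<^sub>0. shooting N m \<sigma> p H s\<^sub>1 \<xi>\<^sub>0"
proof -
  have K: "\<nu> * \<mu> > 0" using damped \<nu>_pos by simp
  have "\<forall>\<^sub>F H in at_top. (\<forall>V U a. solves {a..} V U \<longrightarrow> V a = H \<longrightarrow> U a \<noteq> 0) \<and> max zero_level 0 < H"
    by (rule eventually_conj[OF overshoot[OF damped K] eventually_gt_at_top])
  then obtain H where H: "\<forall>V U a. solves {a..} V U \<longrightarrow> V a = H \<longrightarrow> U a \<noteq> 0" "max zero_level 0 < H"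
    using eventually_happens'[OF trivial_limit_at_top_linorder] by blast
  have "((\<lambda>s. h s * zero_level powr (1 / m - 1)) \<longlongrightarrow> 0) at_top"
    by (rule tendsto_mult_left_zero[OF h_tendsto_0])
  then have "\<forall>\<^sub>F s in at_top. h s * zero_level powr (1 / m - 1) < \<mu> - \<nu>"
    using damped by (rule order_tendstoD(2))
  then obtain s1 where s1: "\<And>s. s \<ge> s1 \<Longrightarrow> h s * zero_level powr (1 / m - 1) < \<mu> - \<nu>"
    unfolding eventually_at_top_linorder by blast
  \<comment> \<open>The required bound reads \<open>\<xi>0 powr (1 / \<beta>)\<close> \<le>
    \<open>A\<close>; since 1 / \<beta> > 0 it holds up to \<open>A powr \<beta>\<close>.\<close>
  define A where "A = \<alpha> / 2 / (2 * H) powr ((p - 1) / m)"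
  define \<xi>0 where "\<xi>0 = min (exp s1) (A powr \<beta>)"
  have "H > 0" using H(2) by simp
  then have "A > 0" using \<alpha>_pos by (simp add: A_def)
  then have "\<xi>0 > 0" by (simp add: \<xi>0_def)
  have "\<xi>0 powr (1 / \<beta>) \<le> (A powr \<beta>) powr (1 / \<beta>)"
    using \<open>\<xi>0 > 0\<close> \<beta>_pos by (intro powr_mono2) (auto simp: \<xi>0_def)
  also have "\<dots> = A" using \<open>A > 0\<close> \<beta>_pos by (simp add: powr_powr)
  finally have "\<xi>0 powr (1 / \<beta>) * (2 * H) powr ((p - 1) / m) \<le> \<alpha> / 2"
    using \<open>H > 0\<close> by (simp add: A_def pos_le_divide_eq)
  then have "shooting N m \<sigma> p H s1 \<xi>0"
    using damped H \<open>H > 0\<close> s1 \<open>\<xi>0 > 0\<close>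
    by unfold_locales (auto simp: \<xi>0_def intro: less_imp_le)
  then show ?thesis by blast
qed

end

lemma self_similar_solution_exists:
  assumes "is_profile CARD('n::finite) m \<sigma> p f"
  shows "\<exists>u :: real ^ 'n \<Rightarrow> real \<Rightarrow> real. self_similar_solution m \<sigma> p f u"
  using assms unfolding self_similar_solution_def
  by (intro exI[of _ "\<lambda>x t. t powr alpha m \<sigma> p * f (norm x * t powr beta m \<sigma> p)"]) simp

theorem theorem1p1:
  fixes m \<sigma> p :: real
  assumes "0 < m" "m < 1" "\<sigma> > 0" "1 < p" "p < p_L m \<sigma>"
  shows
    "(CARD('n) \<ge> 3 \<and> m < m_s CARD('n) \<and> max 1 (p_s CARD('n) m \<sigma>) < ereal p \<longrightarrow>
        (\<exists>f (u :: real ^ 'n::finite \<Rightarrow> real \<Rightarrow> real). self_similar_solution m \<sigma> p f u \<and>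
          (\<exists>C>0. \<exists>D>0. behavior_at_0 CARD('n) m \<sigma> p D f \<and>
            f \<sim>[at_top] (\<lambda>\<xi>. C * \<xi> powr (- (real CARD('n) - 2) / m)))))
   \<and> (CARD('n) \<ge> 3 \<and> m < m_s CARD('n) \<and> max 1 (p_s CARD('n) m \<sigma>) < ereal p \<longrightarrow>
        (\<exists>f (u :: real ^ 'n \<Rightarrow> real \<Rightarrow> real). self_similar_solution m \<sigma> p f u \<and>
          (\<exists>C>0. \<exists>D>0. behavior_at_0 CARD('n) m \<sigma> p D f \<and>
            f \<sim>[at_top] (\<lambda>\<xi>. C * \<xi> powr (- (\<sigma> + 2) / (p - m))))))
   \<and> (m \<ge> m_s CARD('n) \<or> CARD('n) \<in> {1, 2} \<or> ereal p < p_s CARD('n) m \<sigma> \<longrightarrow>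
        \<not> (\<exists>f (u :: real ^ 'n \<Rightarrow> real \<Rightarrow> real). self_similar_solution m \<sigma> p f u))"
proof -
  interpret profile_eq "CARD('n)" m \<sigma> p
    using assms by unfold_locales (simp_all add: Suc_le_eq)
  show ?thesis
  proof (intro conjI impI notI)
    assume *: "CARD('n) \<ge> 3 \<and> m < m_s CARD('n) \<and> max 1 (p_s CARD('n) m \<sigma>) < ereal p"
    then have "p_s CARD('n) m \<sigma> < ereal p"
      by (meson max.cobounded2 order.strict_trans1)
    then have "\<mu> - \<nu> > 0"
      using * by (intro supercritical_damped) auto
    then obtain H s\<^sub>1 \<xi>\<^sub>0 where "shooting CARD('n) m \<sigma> p H s\<^sub>1 \<xi>\<^sub>0"
      using shooting_parameters by blast
    then interpret shooting "CARD('n)" m \<sigma> p H s\<^sub>1 \<xi>\<^sub>0 .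
    show "\<exists>f (u :: real ^ 'n \<Rightarrow> real \<Rightarrow> real). self_similar_solution m \<sigma> p f u \<and>
          (\<exists>C>0. \<exists>D>0. behavior_at_0 CARD('n) m \<sigma> p D f \<and>
            f \<sim>[at_top] (\<lambda>\<xi>. C * \<xi> powr (- (real CARD('n) - 2) / m)))"
      using fast_decaying_profile self_similar_solution_exists by blast
    show "\<exists>f (u :: real ^ 'n \<Rightarrow> real \<Rightarrow> real). self_similar_solution m \<sigma> p f u \<and>
          (\<exists>C>0. \<exists>D>0. behavior_at_0 CARD('n) m \<sigma> p D f \<and>
            f \<sim>[at_top] (\<lambda>\<xi>. C * \<xi> powr (- (\<sigma> + 2) / (p - m))))"
      using slowly_decaying_profile self_similar_solution_exists by blast
  next
    assume "m \<ge> m_s CARD('n) \<or> CARD('n) \<in> {1, 2} \<or> ereal p < p_s CARD('n) m \<sigma>"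
    then have "\<mu> - \<nu> < 0" by (rule subcritical_antidamped)
    moreover assume "\<exists>f (u :: real ^ 'n \<Rightarrow> real \<Rightarrow> real). self_similar_solution m \<sigma> p f u"
    ultimately show False
      using no_profile by (auto simp: self_similar_solution_def)
  qed
qed

end
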